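(* Let $q$ be a prime power, $n\ge1$, $m\ge1$, $G=GL_n(\mathbb{F}_q)$. For every field $k\supseteq\mathbb{F}_q$, the $kG$-modules $Q_k$ and $k[\mathbb{F}_{q^m}^n]$ are Brauer-isomorphic. Furthermore, when $k\supseteq\mathbb{F}_{q^m}$, the $k[G\times C]$-modules $Q_k$ and $k[\mathbb{F}_{q^m}^n]$ are Brauer-isomorphic, where $C=\mathbb{F}_{q^m}^\times$.
   Context: Graded parking space: $Q_k=k[x_1,\dots,x_n]/(x_1^{q^m},\dots,x_n^{q^m})$, on which $g=(g_{ij})\in G$ acts by the $k$-algebra automorphism induced by $x_j\mapsto\sum_i g_{ij}x_i$; when $k\supseteq\mathbb{F}_{q^m}$, $\gamma\in C$ acts by the $k$-algebra automorphism induced by $x_i\mapsto\gamma x_i$ for all $i$. Ungraded parking space: $k[\mathbb{F}_{q^m}^n]$ is the $k$-vector space with basis $\{e_v: v\in\mathbb{F}_{q^m}^n\}$, with $g\in G$ acting by $g(e_v)=e_{gv}$, $(gv)_i=\sum_j g_{ij}v_j$, and $\gamma\in C$ acting by $e_v\mapsto e_{\gamma v}$ (scalar multiplication). The actions of $G$ and $C$ commute. Two finite-dimensional $kH$-modules, for a finite group $H$, are Brauer-isomorphic if each simple $kH$-module occurs with the same multiplicity as a composition factor in both. *)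

theory Defs
  imports
    "HOL-Analysis.Analysis"
    "HOL-Algebra.Algebra"
    "HOL-Algebra.Algebraic_Closure_Type"
    "HOL-Library.Poly_Mapping"
    "HOL-Number_Theory.Prime_Powers"
begin

section \<open>Modules over group algebras\<close>

text \<open>
  A \<open>K H\<close>-module is given as a \<open>K\<close>-vector space with a \<open>K\<close>-linear action of \<open>H\<close>. It extends the
  record \<^type>\<open>module\<close>, whose ring fields \<open>mult\<close> and \<open>one\<close> carry no meaning for modules.
\<close>

record ('k, 'v, 'h) gmodule = "('k, 'v) module" +
  act :: "'h \<Rightarrow> 'v \<Rightarrow> 'v"

locale group_module =
  K?: Ring.field K + H?: Group.group H + M?: Module.module K M
  for K :: "'k ring" and H :: "'h monoid" and M :: "('k, 'v, 'h) gmodule" +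
  assumes act_closed:
      "\<lbrakk>h \<in> carrier H; x \<in> carrier M\<rbrakk> \<Longrightarrow> act M h x \<in> carrier M"
    and act_add:
      "\<lbrakk>h \<in> carrier H; x \<in> carrier M; y \<in> carrier M\<rbrakk> \<Longrightarrow>
        act M h (x \<oplus>\<^bsub>M\<^esub> y) = act M h x \<oplus>\<^bsub>M\<^esub> act M h y"
    and act_smult:
      "\<lbrakk>h \<in> carrier H; c \<in> carrier K; x \<in> carrier M\<rbrakk> \<Longrightarrow>
        act M h (c \<odot>\<^bsub>M\<^esub> x) = c \<odot>\<^bsub>M\<^esub> act M h x"
    and act_one:
      "x \<in> carrier M \<Longrightarrow> act M \<one>\<^bsub>H\<^esub> x = x"
    and act_mult:
      "\<lbrakk>g \<in> carrier H; h \<in> carrier H; x \<in> carrier M\<rbrakk> \<Longrightarrow>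
        act M (g \<otimes>\<^bsub>H\<^esub> h) x = act M g (act M h x)"

definition group_submodule ::
  "'k ring \<Rightarrow> 'h monoid \<Rightarrow> ('k, 'v, 'h) gmodule \<Rightarrow> 'v set \<Rightarrow> bool" where
  "group_submodule K H M N \<longleftrightarrow>
     submodule N K M \<and> (\<forall>h\<in>carrier H. \<forall>x\<in>N. act M h x \<in> N)"

definition quotient_gmodule ::
  "('k, 'v, 'h) gmodule \<Rightarrow> 'v set \<Rightarrow> ('k, 'v set, 'h) gmodule" where
  "quotient_gmodule M N =
     \<lparr>carrier = a_rcosets\<^bsub>M\<^esub> N,
      monoid.mult = rcoset_mult M N,
      one = N +>\<^bsub>M\<^esub> \<one>\<^bsub>M\<^esub>,
      ring.zero = N,
      add = set_add M,
      smult = (\<lambda>c Y. \<Union>x\<in>Y. N +>\<^bsub>M\<^esub> (c \<odot>\<^bsub>M\<^esub> x)),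
      act = (\<lambda>h Y. \<Union>x\<in>Y. N +>\<^bsub>M\<^esub> act M h x)\<rparr>"

definition finite_dimensional :: "'k ring \<Rightarrow> ('k, 'v, 'h) gmodule \<Rightarrow> bool" where
  "finite_dimensional K M \<longleftrightarrow>
     (\<exists>B. finite B \<and> B \<subseteq> carrier M \<and>
        (\<forall>x\<in>carrier M. \<exists>a\<in>B \<rightarrow> carrier K. x = (\<Oplus>\<^bsub>M\<^esub>b\<in>B. a b \<odot>\<^bsub>M\<^esub> b)))"

definition isomorphic_gmodule ::
  "'k ring \<Rightarrow> 'h monoid \<Rightarrow> ('k, 'v, 'h) gmodule \<Rightarrow> ('k, 'w, 'h) gmodule \<Rightarrow> bool" where
  "isomorphic_gmodule K H M N \<longleftrightarrow>
     (\<exists>f. bij_betw f (carrier M) (carrier N) \<and>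
        (\<forall>x\<in>carrier M. \<forall>y\<in>carrier M. f (x \<oplus>\<^bsub>M\<^esub> y) = f x \<oplus>\<^bsub>N\<^esub> f y) \<and>
        (\<forall>c\<in>carrier K. \<forall>x\<in>carrier M. f (c \<odot>\<^bsub>M\<^esub> x) = c \<odot>\<^bsub>N\<^esub> f x) \<and>
        (\<forall>h\<in>carrier H. \<forall>x\<in>carrier M. f (act M h x) = act N h (f x)))"

definition simple_gmodule :: "'k ring \<Rightarrow> 'h monoid \<Rightarrow> ('k, 'v, 'h) gmodule \<Rightarrow> bool" where
  "simple_gmodule K H M \<longleftrightarrow>
     group_module K H M \<and> carrier M \<noteq> {\<zero>\<^bsub>M\<^esub>} \<and>
     (\<forall>N. group_submodule K H M N \<longrightarrow> N = {\<zero>\<^bsub>M\<^esub>} \<or> N = carrier M)"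

definition series_factor ::
  "('k, 'v, 'h) gmodule \<Rightarrow> 'v set list \<Rightarrow> nat \<Rightarrow> ('k, 'v set, 'h) gmodule" where
  "series_factor M Ns i = quotient_gmodule (M\<lparr>carrier := Ns ! Suc i\<rparr>) (Ns ! i)"

definition composition_series ::
  "'k ring \<Rightarrow> 'h monoid \<Rightarrow> ('k, 'v, 'h) gmodule \<Rightarrow> 'v set list \<Rightarrow> bool" where
  "composition_series K H M Ns \<longleftrightarrow>
     Ns \<noteq> [] \<and> hd Ns = {\<zero>\<^bsub>M\<^esub>} \<and> last Ns = carrier M \<and>
     (\<forall>N\<in>set Ns. group_submodule K H M N) \<and>
     (\<forall>i. Suc i < length Ns \<longrightarrow>
        Ns ! i \<subseteq> Ns ! Suc i \<and> simple_gmodule K H (series_factor M Ns i))"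

text \<open>
  A finite-dimensional module has a composition series, and by Jordan--Hoelder the value below does
  not depend on the one chosen.
\<close>

definition composition_multiplicity ::
  "'k ring \<Rightarrow> 'h monoid \<Rightarrow> ('k, 's, 'h) gmodule \<Rightarrow> ('k, 'v, 'h) gmodule \<Rightarrow> nat" where
  "composition_multiplicity K H S M =
     (let Ns = (SOME Ns. composition_series K H M Ns)
      in card {i. Suc i < length Ns \<and> isomorphic_gmodule K H (series_factor M Ns i) S})"

text \<open>
  HOL cannot quantify over types inside a formula, so the type \<open>'s\<close> of the elements of the simple
  modules is a parameter. A theorem in which \<open>'s\<close> is a type variable speaks about all simple modules.
\<close>

definition brauer_isomorphic ::
  "'s itself \<Rightarrow> 'k ring \<Rightarrow> 'h monoid \<Rightarrow> ('k, 'v, 'h) gmodule \<Rightarrow> ('k, 'w, 'h) gmodule \<Rightarrow> bool"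
  where
  "brauer_isomorphic (_ :: 's itself) K H M N \<longleftrightarrow>
     group_module K H M \<and> finite_dimensional K M \<and>
     group_module K H N \<and> finite_dimensional K N \<and>
     (\<forall>S :: ('k, 's, 'h) gmodule. simple_gmodule K H S \<longrightarrow>
        composition_multiplicity K H S M = composition_multiplicity K H S N)"


section \<open>The groups\<close>

definition GL :: "('q::field ^ 'n ^ 'n) monoid" where
  "GL = \<lparr>carrier = {A. invertible A}, monoid.mult = (**), one = mat 1\<rparr>"

abbreviation unit_group :: "'f::field monoid" where
  "unit_group \<equiv> units_of ring_of_type_algebra"


section \<open>The graded parking space\<close>

text \<open>
  The polynomial ring over \<open>'k\<close> in variables indexed by \<open>'n\<close> is \<open>('n \<Rightarrow>\<^sub>0 nat) \<Rightarrow>\<^sub>0 'k\<close>: coefficients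
  indexed by exponent vectors, with the convolution product.
\<close>

type_synonym ('n, 'k) mpoly = "('n \<Rightarrow>\<^sub>0 nat) \<Rightarrow>\<^sub>0 'k"

definition mconst :: "'k::field \<Rightarrow> ('n, 'k) mpoly" where
  "mconst c = Poly_Mapping.single 0 c"

definition mvar :: "'n \<Rightarrow> ('n, 'k::field) mpoly" where
  "mvar i = Poly_Mapping.single (Poly_Mapping.single i 1) 1"

text \<open>The \<open>'k\<close>-algebra endomorphism with \<open>x\<^sub>i \<mapsto> \<sigma> i\<close>.\<close>

definition msubst ::
  "('n::finite \<Rightarrow> ('n, 'k) mpoly) \<Rightarrow> ('n, 'k::field) mpoly \<Rightarrow> ('n, 'k) mpoly" where
  "msubst \<sigma> p =
     (\<Sum>\<alpha>\<in>Poly_Mapping.keys p.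
        mconst (Poly_Mapping.lookup p \<alpha>) * (\<Prod>i\<in>UNIV. \<sigma> i ^ Poly_Mapping.lookup \<alpha> i))"

text \<open>In the following, \<open>j\<close> is the inclusion of the respective finite field into \<open>'k\<close>.\<close>

definition GL_poly_act ::
  "('q \<Rightarrow> 'k) \<Rightarrow> 'q ^ 'n ^ 'n \<Rightarrow> ('n::finite, 'k::field) mpoly \<Rightarrow> ('n, 'k) mpoly" where
  "GL_poly_act j g = msubst (\<lambda>l. \<Sum>i\<in>UNIV. mconst (j (g $ i $ l)) * mvar i)"

definition scalar_poly_act ::
  "('f \<Rightarrow> 'k) \<Rightarrow> 'f \<Rightarrow> ('n::finite, 'k::field) mpoly \<Rightarrow> ('n, 'k) mpoly" where
  "scalar_poly_act j \<gamma> = msubst (\<lambda>i. mconst (j \<gamma>) * mvar i)"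

definition poly_gmodule ::
  "('h \<Rightarrow> ('n, 'k::field) mpoly \<Rightarrow> ('n, 'k) mpoly) \<Rightarrow> ('k, ('n, 'k) mpoly, 'h) gmodule" where
  "poly_gmodule \<rho> =
     \<lparr>carrier = UNIV, monoid.mult = (*), one = 1, ring.zero = 0, add = (+),
      smult = (\<lambda>c p. mconst c * p), act = \<rho>\<rparr>"

text \<open>\<open>k[x\<^sub>1,\<dots>,x\<^sub>n]/(x\<^sub>1\<^sup>N,\<dots>,x\<^sub>n\<^sup>N)\<close> with the action induced by \<open>\<rho>\<close>.\<close>

definition graded_parking ::
  "nat \<Rightarrow> ('h \<Rightarrow> ('n, 'k::field) mpoly \<Rightarrow> ('n, 'k) mpoly) \<Rightarrow>
   ('k, ('n, 'k) mpoly set, 'h) gmodule" where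
  "graded_parking N \<rho> =
     quotient_gmodule (poly_gmodule \<rho>)
       (Idl\<^bsub>ring_of_type_algebra\<^esub> (\<Union>i. {mvar i ^ N}))"


section \<open>The ungraded parking space\<close>

text \<open>The permutation module with basis \<open>e\<^sub>v = Poly_Mapping.single v 1\<close> and \<open>h(e\<^sub>v) = e\<^bsub>\<pi> h v\<^esub>\<close>.\<close>

definition permutation_gmodule :: "('h \<Rightarrow> 'v \<Rightarrow> 'v) \<Rightarrow> ('k::field, 'v \<Rightarrow>\<^sub>0 'k, 'h) gmodule" where
  "permutation_gmodule \<pi> =
     \<lparr>carrier = UNIV, monoid.mult = undefined, one = undefined, ring.zero = 0, add = (+),
      smult = (\<lambda>c. Poly_Mapping.map ((*) c)),
      act = (\<lambda>h a. \<Sum>v\<in>Poly_Mapping.keys a.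
               Poly_Mapping.single (\<pi> h v) (Poly_Mapping.lookup a v))\<rparr>"

definition GL_vec_act ::
  "('q \<Rightarrow> 'f) \<Rightarrow> 'q ^ 'n ^ 'n \<Rightarrow> 'f::field ^ 'n \<Rightarrow> 'f ^ ('n::finite)" where
  "GL_vec_act \<iota> g v = map_matrix \<iota> g *v v"

end

(*
  Write q^m = p^r with p prime, let z_(i,l) = x_l^(p^i) in the graded parking space, for i < r, and
  expand exponents in base p: the monomials in the z_(i,l) with exponents < p form a basis. An
  element g maps such a monomial to its image in the ring k[z_(i,l)] / (z_(i,l)^p), up to monomials
  of smaller degree, since a carry z_(i,l)^p = z_(i+1,l) lowers the degree in the z.

  The ungraded parking space is the group algebra of an elementary abelian p-group. Its augmentation
  ideal I is nilpotent, every element of I has p-th power 0, and I/I^2 is the tensor product of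
  F_(q^m)^n with k over F_p. Decomposing this with finite Fourier transforms gives y_(i,l) in I, on
  which g acts modulo I^2 by the same matrices as on the z_(i,l). Hence the monomials in the y_(i,l)
  with exponents < p are a basis, and g acts on them as above, up to monomials of larger degree.

  So both modules have filtrations, one ascending and one descending, with isomorphic associated
  graded modules. By Jordan-Hoelder they have the same composition multiplicities.
*)
theory Submission
  imports Defs "HOL-Number_Theory.Residues"
begin

section \<open>Submodules and quotients\<close>

text \<open>The field \<open>k\<close> need only contain \<open>F_q\<close>, and on matrices over
  \<open>F_q\<close> the twist by \<open>p^i\<close> depends only on \<open>i mod s\<close>, where
  \<open>q = p^s\<close>. So the index is split as \<open>i = u*s + i'\<close>: \<open>i'\<close> is
  a Fourier frequency over \<open>F_q\<close>, and \<open>u < m\<close> numbers a spanning family of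
  \<open>F_(q^m)\<close> over \<open>F_q\<close>. This provides one \<open>y\<close> for each
  \<open>z\<close>. The reduced monomials in the \<open>y\<close> span because the augmentation
  ideal is nilpotent and spanned by the \<open>y\<close> modulo its square; they are independent
  because their number \<open>p^(r*n)\<close> is the dimension.

  The graded pieces are compared by matrices. Both actions are triangular for the total degree, in
  opposite directions. Their diagonal blocks agree, since both consist of the expansion coefficients
  of the same linear substitution, where monomials with an exponent of at least \<open>p\<close> are
  dropped. Multiplicities are compared by two inequalities: each occurrence of a simple module in
  one module is transported to a layer of the other, and non-overlapping layers are counted against
  a composition series.\<close>

lemma group_moduleI:
  assumes "Ring.field K" "Group.group H" "Module.module K M"
    and "\<And>h x. \<lbrakk>h \<in> carrier H; x \<in> carrier M\<rbrakk> \<Longrightarrow> act M h x \<in> carrier M"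
    and "\<And>h x y. \<lbrakk>h \<in> carrier H; x \<in> carrier M; y \<in> carrier M\<rbrakk> \<Longrightarrow>
        act M h (x \<oplus>\<^bsub>M\<^esub> y) = act M h x \<oplus>\<^bsub>M\<^esub> act M h y"
    and "\<And>h c x. \<lbrakk>h \<in> carrier H; c \<in> carrier K; x \<in> carrier M\<rbrakk> \<Longrightarrow>
        act M h (c \<odot>\<^bsub>M\<^esub> x) = c \<odot>\<^bsub>M\<^esub> act M h x"
    and "\<And>x. x \<in> carrier M \<Longrightarrow> act M \<one>\<^bsub>H\<^esub> x = x"
    and "\<And>g h x. \<lbrakk>g \<in> carrier H; h \<in> carrier H; x \<in> carrier M\<rbrakk> \<Longrightarrow>
        act M (g \<otimes>\<^bsub>H\<^esub> h) x = act M g (act M h x)"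
  shows "group_module K H M"
  by (intro group_module.intro group_module_axioms.intro assms)

text \<open>A surjective homomorphism from \<open>A\<close> onto \<open>S\<close> with kernel
  \<open>B\<close>, given on elements of \<open>M\<close>. It expresses that \<open>A/B\<close> is
  isomorphic to \<open>S\<close> without cosets, so that factors of different chains can be compared
  inside \<open>M\<close>.\<close>

definition factor_map ::
  "'k ring \<Rightarrow> 'h monoid \<Rightarrow> ('k, 'v, 'h) gmodule \<Rightarrow> ('k, 's, 'h) gmodule \<Rightarrow> 'v set \<Rightarrow> 'v set \<Rightarrow>
    ('v \<Rightarrow> 's) \<Rightarrow> bool" where
  "factor_map K H M S B A f \<longleftrightarrow>
     (\<forall>x\<in>A. \<forall>y\<in>A. f (x \<oplus>\<^bsub>M\<^esub> y) = f x \<oplus>\<^bsub>S\<^esub> f y) \<and>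
     (\<forall>c\<in>carrier K. \<forall>x\<in>A. f (c \<odot>\<^bsub>M\<^esub> x) = c \<odot>\<^bsub>S\<^esub> f x) \<and>
     (\<forall>h\<in>carrier H. \<forall>x\<in>A. f (act M h x) = act S h (f x)) \<and>
     f ` A = carrier S \<and> {x \<in> A. f x = \<zero>\<^bsub>S\<^esub>} = B"

definition has_factor ::
  "'k ring \<Rightarrow> 'h monoid \<Rightarrow> ('k, 'v, 'h) gmodule \<Rightarrow> ('k, 's, 'h) gmodule \<Rightarrow> 'v set \<Rightarrow> 'v set \<Rightarrow> bool"
  where "has_factor K H M S B A \<longleftrightarrow> (\<exists>f. factor_map K H M S B A f)"

lemma factor_mapD:
  assumes "factor_map K H M S B A f"
  shows "\<And>x y. x \<in> A \<Longrightarrow> y \<in> A \<Longrightarrow> f (x \<oplus>\<^bsub>M\<^esub> y) = f x \<oplus>\<^bsub>S\<^esub> f y"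
    and "\<And>c x. c \<in> carrier K \<Longrightarrow> x \<in> A \<Longrightarrow> f (c \<odot>\<^bsub>M\<^esub> x) = c \<odot>\<^bsub>S\<^esub> f x"
    and "\<And>h x. h \<in> carrier H \<Longrightarrow> x \<in> A \<Longrightarrow> f (act M h x) = act S h (f x)"
    and "f ` A = carrier S"
    and "\<And>x. x \<in> A \<Longrightarrow> f x = \<zero>\<^bsub>S\<^esub> \<longleftrightarrow> x \<in> B"
    and "B \<subseteq> A"
    and "\<And>x. x \<in> A \<Longrightarrow> f x \<in> carrier S"
  using assms unfolding factor_map_def by blast+

section \<open>Submodules, quotients and the isomorphism theorems\<close>

context group_module
begin

lemma group_submoduleD:
  assumes "group_submodule K H M N"
  shows "N \<subseteq> carrier M" "\<And>x. x \<in> N \<Longrightarrow> x \<in> carrier M" "\<zero>\<^bsub>M\<^esub> \<in> N"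
    and "\<And>x y. x \<in> N \<Longrightarrow> y \<in> N \<Longrightarrow> x \<oplus>\<^bsub>M\<^esub> y \<in> N"
    and "\<And>x. x \<in> N \<Longrightarrow> \<ominus>\<^bsub>M\<^esub> x \<in> N"
    and "\<And>x y. x \<in> N \<Longrightarrow> y \<in> N \<Longrightarrow> x \<ominus>\<^bsub>M\<^esub> y \<in> N"
    and "\<And>c x. c \<in> carrier K \<Longrightarrow> x \<in> N \<Longrightarrow> c \<odot>\<^bsub>M\<^esub> x \<in> N"
    and "\<And>h x. h \<in> carrier H \<Longrightarrow> x \<in> N \<Longrightarrow> act M h x \<in> N"
    and "abelian_subgroup N M"
proof -
  have sm: "submodule N K M" using assms by (simp add: group_submodule_def)
  note E = submoduleE[OF sm]
  show 1: "N \<subseteq> carrier M" by (rule E(1))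
  show "\<And>x. x \<in> N \<Longrightarrow> x \<in> carrier M" using 1 by blast
  obtain x where x: "x \<in> N" using E(2) by blast
  have "x \<oplus>\<^bsub>M\<^esub> \<ominus>\<^bsub>M\<^esub> x \<in> N" using E(3,5) x by blast
  then show "\<zero>\<^bsub>M\<^esub> \<in> N" using x 1 by (simp add: M.r_neg subset_iff)
  show "\<And>x y. x \<in> N \<Longrightarrow> y \<in> N \<Longrightarrow> x \<oplus>\<^bsub>M\<^esub> y \<in> N" by (rule E(5))
  show "\<And>x. x \<in> N \<Longrightarrow> \<ominus>\<^bsub>M\<^esub> x \<in> N" by (rule E(3))
  show "\<And>x y. x \<in> N \<Longrightarrow> y \<in> N \<Longrightarrow> x \<ominus>\<^bsub>M\<^esub> y \<in> N" unfolding a_minus_def by (intro E(5) E(3))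
  show "\<And>c x. c \<in> carrier K \<Longrightarrow> x \<in> N \<Longrightarrow> c \<odot>\<^bsub>M\<^esub> x \<in> N" by (rule E(4))
  show "\<And>h x. h \<in> carrier H \<Longrightarrow> x \<in> N \<Longrightarrow> act M h x \<in> N"
    using assms by (simp add: group_submodule_def)
  show "abelian_subgroup N M"
    by (rule abelian_subgroupI3)
      (simp_all add: additive_subgroup_def submodule.axioms(1)[OF sm] M.abelian_group_axioms)
qed

lemma group_submoduleI:
  assumes "N \<subseteq> carrier M" "\<zero>\<^bsub>M\<^esub> \<in> N"
    and "\<And>x y. x \<in> N \<Longrightarrow> y \<in> N \<Longrightarrow> x \<oplus>\<^bsub>M\<^esub> y \<in> N"
    and "\<And>c x. c \<in> carrier K \<Longrightarrow> x \<in> N \<Longrightarrow> c \<odot>\<^bsub>M\<^esub> x \<in> N"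
    and "\<And>h x. h \<in> carrier H \<Longrightarrow> x \<in> N \<Longrightarrow> act M h x \<in> N"
  shows "group_submodule K H M N"
proof -
  have "\<ominus>\<^bsub>M\<^esub> x \<in> N" if "x \<in> N" for x
  proof -
    have "(\<ominus>\<^bsub>K\<^esub> \<one>\<^bsub>K\<^esub>) \<odot>\<^bsub>M\<^esub> x \<in> N" using assms(4) that by simp
    moreover have "(\<ominus>\<^bsub>K\<^esub> \<one>\<^bsub>K\<^esub>) \<odot>\<^bsub>M\<^esub> x = \<ominus>\<^bsub>M\<^esub> x"
      using assms(1) that by (subst M.smult_l_minus) auto
    ultimately show ?thesis by simp
  qed
  then show ?thesis unfolding group_submodule_def using assms by (auto intro!: M.submoduleI)
qed

lemma group_submodule_zero: "group_submodule K H M {\<zero>\<^bsub>M\<^esub>}"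
proof (rule group_submoduleI)
  fix h x assume h: "h \<in> carrier H" and "x \<in> {\<zero>\<^bsub>M\<^esub>}"
  have "act M h (\<zero>\<^bsub>K\<^esub> \<odot>\<^bsub>M\<^esub> \<zero>\<^bsub>M\<^esub>) = \<zero>\<^bsub>K\<^esub> \<odot>\<^bsub>M\<^esub> act M h \<zero>\<^bsub>M\<^esub>"
    by (rule act_smult) (use h in auto)
  then show "act M h x \<in> {\<zero>\<^bsub>M\<^esub>}" using h act_closed[of h "\<zero>\<^bsub>M\<^esub>"] \<open>x \<in> _\<close> by simp
qed auto

lemma group_submodule_carrier: "group_submodule K H M (carrier M)"
  by (rule group_submoduleI) (auto intro: act_closed)

lemma group_submodule_Int:
  assumes "group_submodule K H M A" "group_submodule K H M B"
  shows "group_submodule K H M (A \<inter> B)"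
  by (rule group_submoduleI)
    (use group_submoduleD[OF assms(1)] group_submoduleD[OF assms(2)] in auto)

lemma group_submodule_sum:
  assumes A: "group_submodule K H M A" and B: "group_submodule K H M B"
  shows "group_submodule K H M {a \<oplus>\<^bsub>M\<^esub> b | a b. a \<in> A \<and> b \<in> B}"
proof (rule group_submoduleI)
  note [simp] = group_submoduleD(2-4,7,8)[OF A] group_submoduleD(2-4,7,8)[OF B]
  show "{a \<oplus>\<^bsub>M\<^esub> b | a b. a \<in> A \<and> b \<in> B} \<subseteq> carrier M" by auto
  show "\<zero>\<^bsub>M\<^esub> \<in> {a \<oplus>\<^bsub>M\<^esub> b | a b. a \<in> A \<and> b \<in> B}"
    by (auto intro!: exI[of _ "\<zero>\<^bsub>M\<^esub>"])
next
  note [simp] = group_submoduleD(2-4,7,8)[OF A] group_submoduleD(2-4,7,8)[OF B]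
  fix x y assume "x \<in> {a \<oplus>\<^bsub>M\<^esub> b | a b. a \<in> A \<and> b \<in> B}" "y \<in> {a \<oplus>\<^bsub>M\<^esub> b | a b. a \<in> A \<and> b \<in> B}"
  then obtain a b a' b' where *: "x = a \<oplus>\<^bsub>M\<^esub> b" "a \<in> A" "b \<in> B" "y = a' \<oplus>\<^bsub>M\<^esub> b'" "a' \<in> A" "b' \<in> B"
    by blast
  have "x \<oplus>\<^bsub>M\<^esub> y = (a \<oplus>\<^bsub>M\<^esub> a') \<oplus>\<^bsub>M\<^esub> (b \<oplus>\<^bsub>M\<^esub> b')"
    using * by (simp add: M.a_ac)
  then show "x \<oplus>\<^bsub>M\<^esub> y \<in> {a \<oplus>\<^bsub>M\<^esub> b | a b. a \<in> A \<and> b \<in> B}" using * by (blast intro: group_submoduleD(4)[OF A] group_submoduleD(4)[OF B])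
next
  fix c x assume c: "c \<in> carrier K" and "x \<in> {a \<oplus>\<^bsub>M\<^esub> b | a b. a \<in> A \<and> b \<in> B}"
  then obtain a b where *: "x = a \<oplus>\<^bsub>M\<^esub> b" "a \<in> A" "b \<in> B" by blast
  have "c \<odot>\<^bsub>M\<^esub> x = c \<odot>\<^bsub>M\<^esub> a \<oplus>\<^bsub>M\<^esub> c \<odot>\<^bsub>M\<^esub> b"
    using * c group_submoduleD(2)[OF A] group_submoduleD(2)[OF B] by (simp add: M.smult_r_distr)
  then show "c \<odot>\<^bsub>M\<^esub> x \<in> {a \<oplus>\<^bsub>M\<^esub> b | a b. a \<in> A \<and> b \<in> B}"
    using * c group_submoduleD(7)[OF A] group_submoduleD(7)[OF B] by blast
next
  fix h x assume h: "h \<in> carrier H" and "x \<in> {a \<oplus>\<^bsub>M\<^esub> b | a b. a \<in> A \<and> b \<in> B}"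
  then obtain a b where *: "x = a \<oplus>\<^bsub>M\<^esub> b" "a \<in> A" "b \<in> B" by blast
  have "act M h x = act M h a \<oplus>\<^bsub>M\<^esub> act M h b"
    using * h group_submoduleD(2)[OF A] group_submoduleD(2)[OF B] by (simp add: act_add)
  then show "act M h x \<in> {a \<oplus>\<^bsub>M\<^esub> b | a b. a \<in> A \<and> b \<in> B}"
    using * h group_submoduleD(8)[OF A] group_submoduleD(8)[OF B] by blast
qed

lemma group_module_restrict:
  assumes "group_submodule K H M A"
  shows "group_module K H (M\<lparr>carrier := A\<rparr>)"
proof (rule group_moduleI)
  show "Ring.field K" "Group.group H" by (rule K.field_axioms, rule H.group_axioms)
  show "Module.module K (M\<lparr>carrier := A\<rparr>)"
    by (rule submodule.submodule_is_module)
      (use assms in \<open>auto simp: group_submodule_def M.module_axioms\<close>)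
qed (use group_submoduleD[OF assms] in \<open>auto simp: act_add act_smult act_one act_mult\<close>)

lemma group_submodule_restrict_iff:
  assumes A: "group_submodule K H M A"
  shows "group_submodule K H (M\<lparr>carrier := A\<rparr>) B \<longleftrightarrow> group_submodule K H M B \<and> B \<subseteq> A"
proof -
  interpret A: group_module K H "M\<lparr>carrier := A\<rparr>" by (rule group_module_restrict[OF A])
  show ?thesis
  proof (intro iffI conjI; (elim conjE)?)
    assume B: "group_submodule K H (M\<lparr>carrier := A\<rparr>) B"
    note BD = A.group_submoduleD[OF B]
    show "B \<subseteq> A" using BD(1) by simp
    show "group_submodule K H M B"
      by (rule group_submoduleI) (use BD group_submoduleD(1)[OF A] in auto)
  next
    assume B: "group_submodule K H M B" "B \<subseteq> A"
    show "group_submodule K H (M\<lparr>carrier := A\<rparr>) B"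
      by (rule A.group_submoduleI) (use group_submoduleD[OF B(1)] B(2) in auto)
  qed
qed

text \<open>Closure, identities and inverses all pass to the image of a map that respects the
  operations. Nothing about \<open>Q\<close> is assumed beforehand, so this replaces a direct
  verification of the module axioms on cosets.\<close>

lemma group_module_image:
  assumes closed: "\<And>x. x \<in> carrier M \<Longrightarrow> f x \<in> carrier Q" and surj: "f ` carrier M = carrier Q"
    and zero: "f \<zero>\<^bsub>M\<^esub> = \<zero>\<^bsub>Q\<^esub>"
    and add: "\<And>x y. x \<in> carrier M \<Longrightarrow> y \<in> carrier M \<Longrightarrow> f (x \<oplus>\<^bsub>M\<^esub> y) = f x \<oplus>\<^bsub>Q\<^esub> f y"
    and smult: "\<And>c x. c \<in> carrier K \<Longrightarrow> x \<in> carrier M \<Longrightarrow> f (c \<odot>\<^bsub>M\<^esub> x) = c \<odot>\<^bsub>Q\<^esub> f x"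
    and act: "\<And>h x. h \<in> carrier H \<Longrightarrow> x \<in> carrier M \<Longrightarrow> f (act M h x) = act Q h (f x)"
  shows "group_module K H Q"
proof -
  have ex: "\<exists>x\<in>carrier M. y = f x" if "y \<in> carrier Q" for y
    using that surj by blast
  note eqs = add[symmetric] smult[symmetric] act[symmetric] zero[symmetric]
  have "abelian_group Q"
  proof (rule abelian_groupI)
    fix x y assume "x \<in> carrier Q" "y \<in> carrier Q"
    then obtain a b where ab: "a \<in> carrier M" "b \<in> carrier M" "x = f a" "y = f b" using ex by meson
    then show "x \<oplus>\<^bsub>Q\<^esub> y \<in> carrier Q" by (simp add: eqs closed)
    show "x \<oplus>\<^bsub>Q\<^esub> y = y \<oplus>\<^bsub>Q\<^esub> x" using ab by (simp add: eqs M.a_comm)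
    fix z assume "z \<in> carrier Q"
    then obtain c where c: "c \<in> carrier M" "z = f c" using ex by meson
    then show "x \<oplus>\<^bsub>Q\<^esub> y \<oplus>\<^bsub>Q\<^esub> z = x \<oplus>\<^bsub>Q\<^esub> (y \<oplus>\<^bsub>Q\<^esub> z)"
      using ab by (simp add: eqs M.a_assoc)
  next
    show "\<zero>\<^bsub>Q\<^esub> \<in> carrier Q" by (simp add: eqs closed)
    fix x assume "x \<in> carrier Q"
    then obtain a where a: "a \<in> carrier M" "x = f a" using ex by meson
    then show "\<zero>\<^bsub>Q\<^esub> \<oplus>\<^bsub>Q\<^esub> x = x" by (simp add: eqs)
    have "f (\<ominus>\<^bsub>M\<^esub> a) \<in> carrier Q" "f (\<ominus>\<^bsub>M\<^esub> a) \<oplus>\<^bsub>Q\<^esub> x = \<zero>\<^bsub>Q\<^esub>"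
      using a by (auto simp: eqs closed M.l_neg)
    then show "\<exists>y\<in>carrier Q. y \<oplus>\<^bsub>Q\<^esub> x = \<zero>\<^bsub>Q\<^esub>" by blast
  qed
  moreover have "a \<odot>\<^bsub>Q\<^esub> x \<in> carrier Q \<and> (a \<oplus>\<^bsub>K\<^esub> b) \<odot>\<^bsub>Q\<^esub> x = a \<odot>\<^bsub>Q\<^esub> x \<oplus>\<^bsub>Q\<^esub> b \<odot>\<^bsub>Q\<^esub> x \<and>
      a \<odot>\<^bsub>Q\<^esub> (x \<oplus>\<^bsub>Q\<^esub> y) = a \<odot>\<^bsub>Q\<^esub> x \<oplus>\<^bsub>Q\<^esub> a \<odot>\<^bsub>Q\<^esub> y \<and> (a \<otimes>\<^bsub>K\<^esub> b) \<odot>\<^bsub>Q\<^esub> x = a \<odot>\<^bsub>Q\<^esub> (b \<odot>\<^bsub>Q\<^esub> x) \<and>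
      \<one>\<^bsub>K\<^esub> \<odot>\<^bsub>Q\<^esub> x = x"
    if "a \<in> carrier K" "b \<in> carrier K" "x \<in> carrier Q" "y \<in> carrier Q" for a b x y
  proof -
    obtain u v where uv: "u \<in> carrier M" "v \<in> carrier M" "x = f u" "y = f v"
      using ex[OF \<open>x \<in> carrier Q\<close>] ex[OF \<open>y \<in> carrier Q\<close>] by blast
    then show ?thesis
      using that by (simp add: eqs closed M.smult_l_distr M.smult_r_distr M.smult_assoc1)
  qed
  ultimately have Q: "Module.module K Q"
    by (intro moduleI K.is_cring) blast+
  show ?thesis
  proof (rule group_moduleI)
    show "Ring.field K" "Group.group H" by (rule K.field_axioms, rule H.group_axioms)
    show "Module.module K Q" by (rule Q)
  next
    fix h x y assume "h \<in> carrier H" "x \<in> carrier Q" "y \<in> carrier Q"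
    moreover from this obtain u v where "u \<in> carrier M" "v \<in> carrier M" "x = f u" "y = f v"
      using ex[of x] ex[of y] by blast
    ultimately show "act Q h (x \<oplus>\<^bsub>Q\<^esub> y) = act Q h x \<oplus>\<^bsub>Q\<^esub> act Q h y"
      by (simp add: eqs closed act_add act_closed)
  next
    fix h x assume h: "h \<in> carrier H" and "x \<in> carrier Q"
    then obtain u where u: "u \<in> carrier M" "x = f u" using ex by meson
    show "act Q h x \<in> carrier Q" using h u by (simp add: eqs closed act_closed)
    show "act Q h (c \<odot>\<^bsub>Q\<^esub> x) = c \<odot>\<^bsub>Q\<^esub> act Q h x" if "c \<in> carrier K" for c
      using that h u by (simp add: eqs act_smult act_closed)
    show "act Q (h \<otimes>\<^bsub>H\<^esub> g) x = act Q h (act Q g x)" if "g \<in> carrier H" for g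
      using that h u by (simp add: eqs act_mult act_closed)
  next
    fix x assume "x \<in> carrier Q"
    then obtain u where u: "u \<in> carrier M" "x = f u" using ex by meson
    then show "act Q \<one>\<^bsub>H\<^esub> x = x" by (simp add: eqs act_one)
  qed
qed

text \<open>In \<open>quotient_gmodule\<close> the scalar multiplication and the action are unions
  over all representatives of a coset. Two representatives differ by an element of \<open>N\<close>,
  so all cosets in such a union coincide and the union collapses to one of them.\<close>

lemma quotient_coset:
  assumes N: "group_submodule K H M N"
  defines "Q \<equiv> quotient_gmodule M N"
  shows "x \<in> carrier M \<Longrightarrow> N +>\<^bsub>M\<^esub> x \<in> carrier Q"
    and "(\<lambda>x. N +>\<^bsub>M\<^esub> x) ` carrier M = carrier Q"
    and "N +>\<^bsub>M\<^esub> \<zero>\<^bsub>M\<^esub> = \<zero>\<^bsub>Q\<^esub>"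
    and "x \<in> carrier M \<Longrightarrow> y \<in> carrier M \<Longrightarrow> N +>\<^bsub>M\<^esub> (x \<oplus>\<^bsub>M\<^esub> y) = (N +>\<^bsub>M\<^esub> x) \<oplus>\<^bsub>Q\<^esub> (N +>\<^bsub>M\<^esub> y)"
    and "c \<in> carrier K \<Longrightarrow> x \<in> carrier M \<Longrightarrow> N +>\<^bsub>M\<^esub> (c \<odot>\<^bsub>M\<^esub> x) = c \<odot>\<^bsub>Q\<^esub> (N +>\<^bsub>M\<^esub> x)"
    and "h \<in> carrier H \<Longrightarrow> x \<in> carrier M \<Longrightarrow> N +>\<^bsub>M\<^esub> act M h x = act Q h (N +>\<^bsub>M\<^esub> x)"
    and "x \<in> carrier M \<Longrightarrow> y \<in> carrier M \<Longrightarrow> N +>\<^bsub>M\<^esub> x = N +>\<^bsub>M\<^esub> y \<longleftrightarrow> x \<ominus>\<^bsub>M\<^esub> y \<in> N"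
    and "x \<in> carrier M \<Longrightarrow> N +>\<^bsub>M\<^esub> x = N \<longleftrightarrow> x \<in> N"
proof -
  note ND = group_submoduleD[OF N]
  interpret N: abelian_subgroup N M by (rule ND(9))
  have rep: "N +>\<^bsub>M\<^esub> x' = N +>\<^bsub>M\<^esub> x" if "x' \<in> N +>\<^bsub>M\<^esub> x" "x \<in> carrier M" for x x'
    using N.a_repr_independence'[OF that] by simp
  have self: "x \<in> N +>\<^bsub>M\<^esub> x" if "x \<in> carrier M" for x by (rule N.a_rcos_self[OF that])
  have car: "x' \<in> carrier M" if "x' \<in> N +>\<^bsub>M\<^esub> x" "x \<in> carrier M" for x x'
    using N.a_elemrcos_carrier that by blast
  have eq: "N +>\<^bsub>M\<^esub> x = N +>\<^bsub>M\<^esub> y \<longleftrightarrow> x \<ominus>\<^bsub>M\<^esub> y \<in> N" if "x \<in> carrier M" "y \<in> carrier M" for x y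
    using N.a_rcos_module[OF that(2,1)] rep[of x y] self[of x] that unfolding a_minus_def by auto
  have diff: "x' \<ominus>\<^bsub>M\<^esub> x \<in> N" if "x' \<in> N +>\<^bsub>M\<^esub> x" "x \<in> carrier M" for x x'
    using iffD1[OF eq[OF car[OF that] that(2)] rep[OF that]] .
  show "x \<in> carrier M \<Longrightarrow> y \<in> carrier M \<Longrightarrow> N +>\<^bsub>M\<^esub> x = N +>\<^bsub>M\<^esub> y \<longleftrightarrow> x \<ominus>\<^bsub>M\<^esub> y \<in> N"
    by (rule eq)
  show c: "N +>\<^bsub>M\<^esub> x \<in> carrier Q" if "x \<in> carrier M" for x
    using that by (auto simp: Q_def quotient_gmodule_def A_RCOSETS_def')
  show "(\<lambda>x. N +>\<^bsub>M\<^esub> x) ` carrier M = carrier Q"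
    by (auto simp: Q_def quotient_gmodule_def A_RCOSETS_def')
  have z: "N +>\<^bsub>M\<^esub> \<zero>\<^bsub>M\<^esub> = N" by (simp add: ND(1))
  then show "N +>\<^bsub>M\<^esub> \<zero>\<^bsub>M\<^esub> = \<zero>\<^bsub>Q\<^esub>" by (simp add: Q_def quotient_gmodule_def)
  show "x \<in> carrier M \<Longrightarrow> N +>\<^bsub>M\<^esub> x = N \<longleftrightarrow> x \<in> N"
    using eq[of x "\<zero>\<^bsub>M\<^esub>"] z M.add.inv_one by (simp add: a_minus_def a_inv_def)
  show "x \<in> carrier M \<Longrightarrow> y \<in> carrier M \<Longrightarrow> N +>\<^bsub>M\<^esub> (x \<oplus>\<^bsub>M\<^esub> y) = (N +>\<^bsub>M\<^esub> x) \<oplus>\<^bsub>Q\<^esub> (N +>\<^bsub>M\<^esub> y)"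
    by (simp add: Q_def quotient_gmodule_def N.a_rcos_sum)
  show "N +>\<^bsub>M\<^esub> (c \<odot>\<^bsub>M\<^esub> x) = c \<odot>\<^bsub>Q\<^esub> (N +>\<^bsub>M\<^esub> x)" if cx: "c \<in> carrier K" "x \<in> carrier M"
  proof -
    have "N +>\<^bsub>M\<^esub> (c \<odot>\<^bsub>M\<^esub> x') = N +>\<^bsub>M\<^esub> (c \<odot>\<^bsub>M\<^esub> x)" if x': "x' \<in> N +>\<^bsub>M\<^esub> x" for x'
    proof -
      have "c \<odot>\<^bsub>M\<^esub> (x' \<ominus>\<^bsub>M\<^esub> x) \<in> N" by (rule ND(7)[OF cx(1) diff[OF x' cx(2)]])
      moreover have "c \<odot>\<^bsub>M\<^esub> (x' \<ominus>\<^bsub>M\<^esub> x) = c \<odot>\<^bsub>M\<^esub> x' \<ominus>\<^bsub>M\<^esub> c \<odot>\<^bsub>M\<^esub> x"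
        using cx car[OF x' cx(2)] by (simp add: a_minus_def M.smult_r_distr M.smult_r_minus)
      ultimately show ?thesis
        using eq[of "c \<odot>\<^bsub>M\<^esub> x'" "c \<odot>\<^bsub>M\<^esub> x"] cx car[OF x' cx(2)] by simp
    qed
    then have "(\<Union>x'\<in>N +>\<^bsub>M\<^esub> x. N +>\<^bsub>M\<^esub> (c \<odot>\<^bsub>M\<^esub> x')) = N +>\<^bsub>M\<^esub> (c \<odot>\<^bsub>M\<^esub> x)"
      using self[OF cx(2)] by (intro SUP_eq_const) blast+
    then show ?thesis by (simp only: Q_def quotient_gmodule_def module.simps)
  qed
  show "N +>\<^bsub>M\<^esub> act M h x = act Q h (N +>\<^bsub>M\<^esub> x)" if hx: "h \<in> carrier H" "x \<in> carrier M"
  proof -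
    have "N +>\<^bsub>M\<^esub> act M h x' = N +>\<^bsub>M\<^esub> act M h x" if x': "x' \<in> N +>\<^bsub>M\<^esub> x" for x'
    proof -
      have "x' = (x' \<ominus>\<^bsub>M\<^esub> x) \<oplus>\<^bsub>M\<^esub> x"
        using hx car[OF x' hx(2)] by (simp add: a_minus_def M.a_assoc M.l_neg)
      then have "act M h x' = act M h (x' \<ominus>\<^bsub>M\<^esub> x) \<oplus>\<^bsub>M\<^esub> act M h x"
        using hx car[OF x' hx(2)] act_add[of h "x' \<ominus>\<^bsub>M\<^esub> x" x] by simp
      then have "act M h x' \<ominus>\<^bsub>M\<^esub> act M h x = act M h (x' \<ominus>\<^bsub>M\<^esub> x)"
        using hx car[OF x' hx(2)] by (simp add: a_minus_def M.a_assoc M.r_neg act_closed)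
      moreover have "act M h (x' \<ominus>\<^bsub>M\<^esub> x) \<in> N" by (rule ND(8)[OF hx(1) diff[OF x' hx(2)]])
      ultimately show ?thesis
        using eq[of "act M h x'" "act M h x"] hx car[OF x' hx(2)] act_closed by simp
    qed
    then have "(\<Union>x'\<in>N +>\<^bsub>M\<^esub> x. N +>\<^bsub>M\<^esub> act M h x') = N +>\<^bsub>M\<^esub> act M h x"
      using self[OF hx(2)] by (intro SUP_eq_const) blast+
    then show ?thesis by (simp only: Q_def quotient_gmodule_def gmodule.simps)
  qed
qed

lemma group_module_quotient:
  assumes N: "group_submodule K H M N"
  shows "group_module K H (quotient_gmodule M N)"
  by (rule group_module_image[where f = "\<lambda>x. N +>\<^bsub>M\<^esub> x"]) (use quotient_coset[OF N] in auto)

lemma group_module_hom_zero: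
  assumes "group_module K H S" "group_submodule K H M A"
    and "\<And>x. x \<in> A \<Longrightarrow> f x \<in> carrier S"
    and "\<And>x y. x \<in> A \<Longrightarrow> y \<in> A \<Longrightarrow> f (x \<oplus>\<^bsub>M\<^esub> y) = f x \<oplus>\<^bsub>S\<^esub> f y"
  shows "f \<zero>\<^bsub>M\<^esub> = \<zero>\<^bsub>S\<^esub>"
proof -
  interpret S: group_module K H S by fact
  have z: "\<zero>\<^bsub>M\<^esub> \<in> A" using group_submoduleD[OF assms(2)] by blast
  have "f (\<zero>\<^bsub>M\<^esub> \<oplus>\<^bsub>M\<^esub> \<zero>\<^bsub>M\<^esub>) = f \<zero>\<^bsub>M\<^esub> \<oplus>\<^bsub>S\<^esub> f \<zero>\<^bsub>M\<^esub>" by (rule assms(4)[OF z z])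
  then show ?thesis using assms(3)[OF z] by (simp add: S.M.add.r_cancel_one')
qed

lemma group_submodule_image:
  assumes S: "group_module K H S" and D: "group_submodule K H M D"
    and f: "\<And>x. x \<in> D \<Longrightarrow> f x \<in> carrier S"
      "\<And>x y. x \<in> D \<Longrightarrow> y \<in> D \<Longrightarrow> f (x \<oplus>\<^bsub>M\<^esub> y) = f x \<oplus>\<^bsub>S\<^esub> f y"
      "\<And>c x. c \<in> carrier K \<Longrightarrow> x \<in> D \<Longrightarrow> f (c \<odot>\<^bsub>M\<^esub> x) = c \<odot>\<^bsub>S\<^esub> f x"
      "\<And>h x. h \<in> carrier H \<Longrightarrow> x \<in> D \<Longrightarrow> f (act M h x) = act S h (f x)"
  shows "group_submodule K H S (f ` D)"
proof -
  interpret S: group_module K H S by (rule S)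
  note DD = group_submoduleD[OF D]
  show ?thesis
  proof (rule S.group_submoduleI)
    show "f ` D \<subseteq> carrier S" using f(1) by blast
    have "f \<zero>\<^bsub>M\<^esub> = \<zero>\<^bsub>S\<^esub>" by (rule group_module_hom_zero[OF S D f(1,2)])
    then show "\<zero>\<^bsub>S\<^esub> \<in> f ` D" using DD(3) by (metis imageI)
    show "x \<oplus>\<^bsub>S\<^esub> y \<in> f ` D" if "x \<in> f ` D" "y \<in> f ` D" for x y
      using that by (elim imageE) (simp only: f(2)[symmetric], intro imageI DD(4))
    show "c \<odot>\<^bsub>S\<^esub> x \<in> f ` D" if "c \<in> carrier K" "x \<in> f ` D" for c x
      using that by (elim imageE) (simp only: f(3)[symmetric], intro imageI DD(7))
    show "act S h x \<in> f ` D" if "h \<in> carrier H" "x \<in> f ` D" for h x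
      using that by (elim imageE) (simp only: f(4)[symmetric], intro imageI DD(8))
  qed
qed

text \<open>Hands out the projection \<open>A -> A/B\<close> with its properties stated in the
  operations of \<open>M\<close>, so that later proofs see neither cosets nor the structure with
  changed carrier.\<close>

lemma restricted_quotient:
  assumes A: "group_submodule K H M A" and B: "group_submodule K H M B" and "B \<subseteq> A"
  defines "Q \<equiv> quotient_gmodule (M\<lparr>carrier := A\<rparr>) B"
  obtains pr where "group_module K H Q" "pr ` A = carrier Q"
    "\<And>x y. x \<in> A \<Longrightarrow> y \<in> A \<Longrightarrow> pr (x \<oplus>\<^bsub>M\<^esub> y) = pr x \<oplus>\<^bsub>Q\<^esub> pr y"
    "\<And>c x. c \<in> carrier K \<Longrightarrow> x \<in> A \<Longrightarrow> pr (c \<odot>\<^bsub>M\<^esub> x) = c \<odot>\<^bsub>Q\<^esub> pr x"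
    "\<And>h x. h \<in> carrier H \<Longrightarrow> x \<in> A \<Longrightarrow> pr (act M h x) = act Q h (pr x)"
    "\<And>x y. x \<in> A \<Longrightarrow> y \<in> A \<Longrightarrow> pr x = pr y \<longleftrightarrow> x \<ominus>\<^bsub>M\<^esub> y \<in> B"
    "\<And>x. x \<in> A \<Longrightarrow> pr x = \<zero>\<^bsub>Q\<^esub> \<longleftrightarrow> x \<in> B"
proof -
  interpret A: group_module K H "M\<lparr>carrier := A\<rparr>" by (rule group_module_restrict[OF A])
  note AD = group_submoduleD[OF A]
  have BA: "group_submodule K H (M\<lparr>carrier := A\<rparr>) B"
    using group_submodule_restrict_iff A B \<open>B \<subseteq> A\<close> by blast
  \<comment> \<open>The inverse of a structure is defined through its carrier, so it has to be shown
    that shrinking the carrier does not change it.\<close>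
  have min: "x \<ominus>\<^bsub>M\<lparr>carrier := A\<rparr>\<^esub> y = x \<ominus>\<^bsub>M\<^esub> y" if "x \<in> A" "y \<in> A" for x y
  proof -
    have "\<ominus>\<^bsub>M\<lparr>carrier := A\<rparr>\<^esub> y = \<ominus>\<^bsub>M\<^esub> y"
      using that AD(2) AD(5)[OF that(2)] A.M.minus_equality[of "\<ominus>\<^bsub>M\<^esub> y" y]
      by (simp add: M.l_neg)
    then show ?thesis by (simp add: a_minus_def)
  qed
  have Bz: "B = \<zero>\<^bsub>Q\<^esub>" by (simp add: Q_def quotient_gmodule_def)
  note pr = A.quotient_coset[OF BA, folded Q_def, simplified]
  show ?thesis
  proof (rule that[of "\<lambda>x. B +>\<^bsub>M\<lparr>carrier := A\<rparr>\<^esub> x"])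
    show "group_module K H Q" unfolding Q_def by (rule A.group_module_quotient[OF BA])
  next
    fix x y assume "x \<in> A" "y \<in> A"
    then show "B +>\<^bsub>M\<lparr>carrier := A\<rparr>\<^esub> x = B +>\<^bsub>M\<lparr>carrier := A\<rparr>\<^esub> y \<longleftrightarrow> x \<ominus>\<^bsub>M\<^esub> y \<in> B"
      using pr(7)[of x y] min[of x y] by simp
  next
    fix x assume "x \<in> A"
    then show "B +>\<^bsub>M\<lparr>carrier := A\<rparr>\<^esub> x = \<zero>\<^bsub>Q\<^esub> \<longleftrightarrow> x \<in> B"
      unfolding Bz[symmetric] by (rule pr(8))
  qed (rule pr(2,4,5,6); assumption?)+
qed

text \<open>First isomorphism theorem: an isomorphism composed with the projection is a factor map,
  and a factor map is constant exactly on the cosets of its kernel, hence descends to an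
  injection.\<close>

lemma isomorphic_quotient_iff_has_factor:
  assumes S: "group_module K H S" and A: "group_submodule K H M A" and B: "group_submodule K H M B"
    and "B \<subseteq> A"
  shows "isomorphic_gmodule K H (quotient_gmodule (M\<lparr>carrier := A\<rparr>) B) S \<longleftrightarrow> has_factor K H M S B A"
proof -
  interpret S: group_module K H S by fact
  note AD = group_submoduleD[OF A]
  define Q where "Q = quotient_gmodule (M\<lparr>carrier := A\<rparr>) B"
  obtain pr where Q: "group_module K H Q" and pr: "pr ` A = carrier Q"
    "\<And>x y. x \<in> A \<Longrightarrow> y \<in> A \<Longrightarrow> pr (x \<oplus>\<^bsub>M\<^esub> y) = pr x \<oplus>\<^bsub>Q\<^esub> pr y"
    "\<And>c x. c \<in> carrier K \<Longrightarrow> x \<in> A \<Longrightarrow> pr (c \<odot>\<^bsub>M\<^esub> x) = c \<odot>\<^bsub>Q\<^esub> pr x"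
    "\<And>h x. h \<in> carrier H \<Longrightarrow> x \<in> A \<Longrightarrow> pr (act M h x) = act Q h (pr x)"
    and eq: "\<And>x y. x \<in> A \<Longrightarrow> y \<in> A \<Longrightarrow> pr x = pr y \<longleftrightarrow> x \<ominus>\<^bsub>M\<^esub> y \<in> B"
    and eq0: "\<And>x. x \<in> A \<Longrightarrow> pr x = \<zero>\<^bsub>Q\<^esub> \<longleftrightarrow> x \<in> B"
    by (rule restricted_quotient[OF A B \<open>B \<subseteq> A\<close>, folded Q_def]) (rule that)
  interpret Q: group_module K H Q by (rule Q)
  have closed: "pr x \<in> carrier Q" if "x \<in> A" for x using that pr(1) by blast
  show ?thesis
    unfolding Q_def[symmetric]
  proof
    assume "isomorphic_gmodule K H Q S"
    then obtain f where f: "bij_betw f (carrier Q) (carrier S)"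
      "\<forall>x\<in>carrier Q. \<forall>y\<in>carrier Q. f (x \<oplus>\<^bsub>Q\<^esub> y) = f x \<oplus>\<^bsub>S\<^esub> f y"
      "\<forall>c\<in>carrier K. \<forall>x\<in>carrier Q. f (c \<odot>\<^bsub>Q\<^esub> x) = c \<odot>\<^bsub>S\<^esub> f x"
      "\<forall>h\<in>carrier H. \<forall>x\<in>carrier Q. f (act Q h x) = act S h (f x)"
      unfolding isomorphic_gmodule_def by blast
    have f0: "f \<zero>\<^bsub>Q\<^esub> = \<zero>\<^bsub>S\<^esub>"
      by (rule Q.group_module_hom_zero[OF S Q.group_submodule_carrier])
        (use f bij_betwE in blast)+
    have ker: "f (pr x) = \<zero>\<^bsub>S\<^esub> \<longleftrightarrow> x \<in> B" if "x \<in> A" for x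
      unfolding f0[symmetric] eq0[OF that, symmetric]
      by (rule inj_on_eq_iff[OF bij_betw_imp_inj_on[OF f(1)] closed[OF that] Q.M.zero_closed])
    have "(f \<circ> pr) ` A = carrier S"
      using f(1) pr(1) by (metis bij_betw_imp_surj_on image_comp)
    then have "factor_map K H M S B A (f \<circ> pr)"
      unfolding factor_map_def using f(2-4) pr closed ker \<open>B \<subseteq> A\<close> by auto
    then show "has_factor K H M S B A" unfolding has_factor_def by blast
  next
    assume "has_factor K H M S B A"
    then obtain f where f: "factor_map K H M S B A f" unfolding has_factor_def by blast
    note fD = factor_mapD[OF f]
    have same: "f x = f y \<longleftrightarrow> pr x = pr y" if xy: "x \<in> A" "y \<in> A" for x y
    proof -
      have d: "x \<ominus>\<^bsub>M\<^esub> y \<in> A" using AD(6) xy by blast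
      have "f x = f ((x \<ominus>\<^bsub>M\<^esub> y) \<oplus>\<^bsub>M\<^esub> y)"
        using AD(2) xy by (simp add: a_minus_def M.a_assoc M.l_neg)
      also have "\<dots> = f (x \<ominus>\<^bsub>M\<^esub> y) \<oplus>\<^bsub>S\<^esub> f y" using fD(1) d xy by blast
      finally have "f x = f y \<longleftrightarrow> f (x \<ominus>\<^bsub>M\<^esub> y) = \<zero>\<^bsub>S\<^esub>"
        using fD(7) d xy by simp
      then show ?thesis using fD(5)[OF d] eq[OF xy] by simp
    qed
    \<comment> \<open>An arbitrary representative of the coset is chosen; by \<open>same\<close> the
      value does not depend on it.\<close>
    define g where "g = (\<lambda>Y. f (SOME x. x \<in> A \<and> pr x = Y))"
    have g: "g (pr x) = f x" if "x \<in> A" for x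
      unfolding g_def by (rule someI2[of _ x]) (use that same in auto)
    have "bij_betw g (carrier Q) (carrier S)"
      unfolding bij_betw_def pr(1)[symmetric] fD(4)[symmetric]
      using g same by (auto intro!: inj_onI simp: image_image)
    moreover have "\<forall>U\<in>carrier Q. \<forall>V\<in>carrier Q. g (U \<oplus>\<^bsub>Q\<^esub> V) = g U \<oplus>\<^bsub>S\<^esub> g V"
      unfolding pr(1)[symmetric] by (auto simp: pr(2)[symmetric] g fD(1) AD(4))
    moreover have "\<forall>c\<in>carrier K. \<forall>U\<in>carrier Q. g (c \<odot>\<^bsub>Q\<^esub> U) = c \<odot>\<^bsub>S\<^esub> g U"
      unfolding pr(1)[symmetric] by (auto simp: pr(3)[symmetric] g fD(2) AD(7))
    moreover have "\<forall>h\<in>carrier H. \<forall>U\<in>carrier Q. g (act Q h U) = act S h (g U)"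
      unfolding pr(1)[symmetric] by (auto simp: pr(4)[symmetric] g fD(3) AD(8))
    ultimately show "isomorphic_gmodule K H Q S" unfolding isomorphic_gmodule_def by blast
  qed
qed

text \<open>Correspondence theorem: images (\<open>up\<close>) and preimages (\<open>down\<close>)
  under the projection match the submodules of \<open>A/B\<close> with the submodules between
  \<open>B\<close> and \<open>A\<close>. Simplicity thus becomes maximality of \<open>B\<close> in
  \<open>A\<close>.\<close>

lemma simple_quotient_iff:
  assumes A: "group_submodule K H M A" and B: "group_submodule K H M B" and "B \<subseteq> A"
  shows "simple_gmodule K H (quotient_gmodule (M\<lparr>carrier := A\<rparr>) B) \<longleftrightarrow>
    B \<noteq> A \<and> (\<forall>C. group_submodule K H M C \<and> B \<subseteq> C \<and> C \<subseteq> A \<longrightarrow> C = B \<or> C = A)"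
proof -
  note AD = group_submoduleD[OF A] and BD = group_submoduleD[OF B]
  define Q where "Q = quotient_gmodule (M\<lparr>carrier := A\<rparr>) B"
  obtain pr where Q: "group_module K H Q" and pr: "pr ` A = carrier Q"
    "\<And>x y. x \<in> A \<Longrightarrow> y \<in> A \<Longrightarrow> pr (x \<oplus>\<^bsub>M\<^esub> y) = pr x \<oplus>\<^bsub>Q\<^esub> pr y"
    "\<And>c x. c \<in> carrier K \<Longrightarrow> x \<in> A \<Longrightarrow> pr (c \<odot>\<^bsub>M\<^esub> x) = c \<odot>\<^bsub>Q\<^esub> pr x"
    "\<And>h x. h \<in> carrier H \<Longrightarrow> x \<in> A \<Longrightarrow> pr (act M h x) = act Q h (pr x)"
    and eq: "\<And>x y. x \<in> A \<Longrightarrow> y \<in> A \<Longrightarrow> pr x = pr y \<longleftrightarrow> x \<ominus>\<^bsub>M\<^esub> y \<in> B"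
    and eq0: "\<And>x. x \<in> A \<Longrightarrow> pr x = \<zero>\<^bsub>Q\<^esub> \<longleftrightarrow> x \<in> B"
    by (rule restricted_quotient[OF A B \<open>B \<subseteq> A\<close>, folded Q_def]) (rule that)
  interpret Q: group_module K H Q by (rule Q)
  have closed: "pr x \<in> carrier Q" if "x \<in> A" for x using that pr(1) by blast
  have prB: "pr ` B = {\<zero>\<^bsub>Q\<^esub>}" using eq0 \<open>B \<subseteq> A\<close> BD(3) by force
  have sub: "C \<subseteq> B" if "C \<subseteq> A" "pr ` C \<subseteq> {\<zero>\<^bsub>Q\<^esub>}" for C
  proof
    fix x assume "x \<in> C"
    then have "x \<in> A" "pr x = \<zero>\<^bsub>Q\<^esub>" using that by blast+
    then show "x \<in> B" using eq0 by simp
  qed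
  have down: "group_submodule K H M {x \<in> A. pr x \<in> Y}" if Y: "group_submodule K H Q Y" for Y
  proof (rule group_submoduleI)
    note YD = Q.group_submoduleD[OF Y]
    show "{x \<in> A. pr x \<in> Y} \<subseteq> carrier M" using AD(1) by blast
    have "pr \<zero>\<^bsub>M\<^esub> = \<zero>\<^bsub>Q\<^esub>" using eq0[OF AD(3)] BD(3) by blast
    then show "\<zero>\<^bsub>M\<^esub> \<in> {x \<in> A. pr x \<in> Y}" using AD(3) YD(3) by simp
  qed (use AD(4,7,8) pr Q.group_submoduleD(4,7,8)[OF Y] in simp_all)
  have up: "group_submodule K H Q (pr ` C)" if C: "group_submodule K H M C" and "C \<subseteq> A" for C
    by (rule group_submodule_image[OF Q.group_module_axioms C])
      (simp_all add: pr closed subsetD[OF \<open>C \<subseteq> A\<close>])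
  show ?thesis
    unfolding Q_def[symmetric] simple_gmodule_def
  proof (intro iffI conjI allI impI; (elim conjE)?)
    assume "carrier Q \<noteq> {\<zero>\<^bsub>Q\<^esub>}"
    then show "B \<noteq> A" using prB pr(1) by (intro notI) simp
  next
    fix C assume si: "\<forall>N. group_submodule K H Q N \<longrightarrow> N = {\<zero>\<^bsub>Q\<^esub>} \<or> N = carrier Q"
      and C: "group_submodule K H M C" "B \<subseteq> C" "C \<subseteq> A"
    have "pr ` C = {\<zero>\<^bsub>Q\<^esub>} \<or> pr ` C = carrier Q" using si up C by blast
    then show "C = B \<or> C = A"
    proof
      assume "pr ` C = {\<zero>\<^bsub>Q\<^esub>}"
      then have "C \<subseteq> B" by (intro sub[OF C(3)]) simp
      then show ?thesis using C(2) by simp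
    next
      assume C': "pr ` C = carrier Q"
      have "x \<in> C" if x: "x \<in> A" for x
      proof -
        have "pr x \<in> pr ` C" unfolding C' by (rule closed[OF x])
        then obtain y where y: "y \<in> C" "pr x = pr y" by blast
        then have yA: "y \<in> A" using C(3) by blast
        then have "x \<ominus>\<^bsub>M\<^esub> y \<in> B" using eq[OF x yA] y(2) by simp
        then have "(x \<ominus>\<^bsub>M\<^esub> y) \<oplus>\<^bsub>M\<^esub> y \<in> C" by (intro group_submoduleD(4)[OF C(1)] subsetD[OF C(2)] y(1))
        then show ?thesis using AD(2)[OF x] AD(2)[OF yA] by (simp add: a_minus_def M.a_assoc M.l_neg)
      qed
      then show ?thesis using C(3) by blast
    qed
  next
    show "group_module K H Q" by (rule Q)
  next
    assume "B \<noteq> A"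
    then show "carrier Q \<noteq> {\<zero>\<^bsub>Q\<^esub>}" using sub[of A] pr(1) \<open>B \<subseteq> A\<close> by auto
  next
    fix Y assume si: "\<forall>C. group_submodule K H M C \<and> B \<subseteq> C \<and> C \<subseteq> A \<longrightarrow> C = B \<or> C = A"
      and Y: "group_submodule K H Q Y"
    note YD = Q.group_submoduleD[OF Y]
    define T where "T = {x \<in> A. pr x \<in> Y}"
    have "Y \<subseteq> pr ` A" using YD(1) pr(1) by simp
    then have Y': "Y = pr ` T" unfolding T_def by blast
    have "pr ` B \<subseteq> Y" unfolding prB using YD(3) by simp
    then have "B \<subseteq> T" unfolding T_def using \<open>B \<subseteq> A\<close> by blast
    moreover have "T \<subseteq> A" unfolding T_def by blast
    ultimately have "T = B \<or> T = A" using si down[OF Y, folded T_def] by blast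
    then show "Y = {\<zero>\<^bsub>Q\<^esub>} \<or> Y = carrier Q"
      unfolding Y' using prB pr(1) by (elim disjE) simp_all
  qed
qed

end

section \<open>Composition multiplicities\<close>

context group_module
begin

lemma composition_series_steps:
  assumes "composition_series K H M Ns" "Suc i < length Ns"
  shows "group_submodule K H M (Ns ! i)" "group_submodule K H M (Ns ! Suc i)"
    and "Ns ! i \<subseteq> Ns ! Suc i" "Ns ! i \<noteq> Ns ! Suc i"
    and "\<And>C. group_submodule K H M C \<Longrightarrow> Ns ! i \<subseteq> C \<Longrightarrow> C \<subseteq> Ns ! Suc i \<Longrightarrow> C = Ns ! i \<or> C = Ns ! Suc i"
proof -
  show 1: "group_submodule K H M (Ns ! i)" "group_submodule K H M (Ns ! Suc i)"
    using assms unfolding composition_series_def by (auto intro!: bspec[of "set Ns"])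
  show 2: "Ns ! i \<subseteq> Ns ! Suc i" using assms unfolding composition_series_def by blast
  have "simple_gmodule K H (series_factor M Ns i)"
    using assms unfolding composition_series_def by blast
  note * = this[unfolded series_factor_def simple_quotient_iff[OF 1(2,1) 2]]
  show "Ns ! i \<noteq> Ns ! Suc i"
    "\<And>C. group_submodule K H M C \<Longrightarrow> Ns ! i \<subseteq> C \<Longrightarrow> C \<subseteq> Ns ! Suc i \<Longrightarrow> C = Ns ! i \<or> C = Ns ! Suc i"
    using * by blast+
qed

lemma has_factor_nontrivial:
  assumes S: "simple_gmodule K H S" and "has_factor K H M S B A"
  shows "\<not> A \<subseteq> B"
proof
  assume "A \<subseteq> B"
  obtain f where f: "factor_map K H M S B A f" using assms(2) unfolding has_factor_def by blast
  have "f x = \<zero>\<^bsub>S\<^esub>" if "x \<in> A" for x using factor_mapD(5)[OF f that] that \<open>A \<subseteq> B\<close> by blast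
  then have "f ` A \<subseteq> {\<zero>\<^bsub>S\<^esub>}" by blast
  then have "carrier S \<subseteq> {\<zero>\<^bsub>S\<^esub>}" unfolding factor_mapD(4)[OF f] .
  interpret S: group_module K H S using S by (simp add: simple_gmodule_def)
  have "carrier S = {\<zero>\<^bsub>S\<^esub>}" using \<open>carrier S \<subseteq> _\<close> S.M.zero_closed by blast
  then show False using S unfolding simple_gmodule_def by simp
qed

text \<open>The image of \<open>D\<close> is a submodule of the simple module \<open>S\<close>, and
  it is nonzero because \<open>D\<close> is not inside the kernel.\<close>

lemma factor_map_surj_on_submodule:
  assumes S: "simple_gmodule K H S" and f: "factor_map K H M S B A f"
    and D: "group_submodule K H M D" "D \<subseteq> A" "\<not> D \<subseteq> B"
  shows "f ` D = carrier S"
proof -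
  interpret S: group_module K H S using S by (simp add: simple_gmodule_def)
  note fD = factor_mapD[OF f] and DD = group_submoduleD[OF D(1)]
  have "group_submodule K H S (f ` D)"
    by (rule group_submodule_image[OF S.group_module_axioms D(1)])
      (simp_all add: fD(1,2,3,7) subsetD[OF D(2)])
  then have "f ` D = {\<zero>\<^bsub>S\<^esub>} \<or> f ` D = carrier S" using S unfolding simple_gmodule_def by blast
  moreover have "f ` D \<noteq> {\<zero>\<^bsub>S\<^esub>}"
  proof
    assume *: "f ` D = {\<zero>\<^bsub>S\<^esub>}"
    have "x \<in> B" if "x \<in> D" for x
    proof -
      have "f x = \<zero>\<^bsub>S\<^esub>" using * that by blast
      then show ?thesis using fD(5)[of x] that D(2) by blast
    qed
    then show False using D(3) by blast
  qed
  ultimately show ?thesis by blast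
qed

text \<open>
  The Zassenhaus isomorphism: a maximal step \<open>A \<subset> A'\<close> and a step \<open>B \<subset> B'\<close> with factor \<open>S\<close>,
  of two chains, that meet in the sense below have isomorphic factors.
\<close>

lemma has_factor_transfer:
  assumes S: "simple_gmodule K H S"
    and sub: "group_submodule K H M A" "group_submodule K H M A'" "group_submodule K H M B'"
      "group_submodule K H M B"
    and max: "A \<subseteq> A'" "\<And>C. group_submodule K H M C \<Longrightarrow> A \<subseteq> C \<Longrightarrow> C \<subseteq> A' \<Longrightarrow> C = A \<or> C = A'"
    and fac: "has_factor K H M S B B'"
    and meet: "\<not> A' \<inter> B' \<subseteq> B" "A \<inter> B' \<subseteq> B"
  shows "has_factor K H M S A A'" and "A' = {a \<oplus>\<^bsub>M\<^esub> d | a d. a \<in> A \<and> d \<in> A' \<inter> B'}"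
proof -
  obtain f where f: "factor_map K H M S B B' f" using fac unfolding has_factor_def by blast
  note fD = factor_mapD[OF f]
  interpret S: group_module K H S using S by (simp add: simple_gmodule_def)
  note AD = group_submoduleD[OF sub(1)]
  define D where "D = A' \<inter> B'"
  have D: "group_submodule K H M D" unfolding D_def by (intro group_submodule_Int sub)
  note DD = group_submoduleD[OF D]
  have DB: "group_submodule K H M (D \<inter> B)" by (intro group_submodule_Int D sub)
  note A'D = group_submoduleD[OF sub(2)]
  have cl: "C \<subseteq> A' \<Longrightarrow> {a \<oplus>\<^bsub>M\<^esub> d | a d. a \<in> A \<and> d \<in> C} \<subseteq> A'" for C
    using A'D(4) max(1) by blast
  have geA: "A \<subseteq> {a \<oplus>\<^bsub>M\<^esub> d | a d. a \<in> A \<and> d \<in> C}" if "\<zero>\<^bsub>M\<^esub> \<in> C" for C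
  proof
    fix a assume "a \<in> A"
    then have "a = a \<oplus>\<^bsub>M\<^esub> \<zero>\<^bsub>M\<^esub>" using AD(2) by simp
    then show "a \<in> {a \<oplus>\<^bsub>M\<^esub> d | a d. a \<in> A \<and> d \<in> C}" using that \<open>a \<in> A\<close> by blast
  qed
  have geC: "C \<subseteq> {a \<oplus>\<^bsub>M\<^esub> d | a d. a \<in> A \<and> d \<in> C}" if "C \<subseteq> carrier M" for C
  proof
    fix d assume "d \<in> C"
    then have "d = \<zero>\<^bsub>M\<^esub> \<oplus>\<^bsub>M\<^esub> d" using that by auto
    then show "d \<in> {a \<oplus>\<^bsub>M\<^esub> d | a d. a \<in> A \<and> d \<in> C}" using AD(3) \<open>d \<in> C\<close> by blast
  qed
  obtain d where d: "d \<in> D" "d \<notin> B" using meet(1) unfolding D_def by blast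
  \<comment> \<open>If \<open>d = a + b\<close> with \<open>b\<close> in \<open>B\<close>, then
    \<open>a\<close> lies in both \<open>A\<close> and \<open>D\<close>, hence in \<open>B\<close>
    by the second meeting condition, and so does \<open>d\<close>.\<close>
  have split: "d \<in> B" if "d = a \<oplus>\<^bsub>M\<^esub> b" "d \<in> D" "a \<in> A" "b \<in> D" "b \<in> B" for a b d
  proof -
    have "a = d \<ominus>\<^bsub>M\<^esub> b"
      using that AD(2)[of a] DD(2)[of b] by (simp add: a_minus_def M.a_assoc M.r_neg)
    then have "a \<in> D" using DD(6) that by blast
    then have "a \<in> B" using meet(2) that unfolding D_def by blast
    then show ?thesis using group_submoduleD(4)[OF sub(4)] that by blast
  qed
  \<comment> \<open>By maximality of the step, \<open>A + D\<close> is \<open>A\<close> or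
    \<open>A'\<close>; an element of \<open>D\<close> outside \<open>B\<close> is not in
    \<open>A\<close>.\<close>
  have A': "A' = {a \<oplus>\<^bsub>M\<^esub> d | a d. a \<in> A \<and> d \<in> D}"
  proof -
    have "d \<notin> A" using d meet(2) unfolding D_def by blast
    moreover have "d \<in> {a \<oplus>\<^bsub>M\<^esub> d | a d. a \<in> A \<and> d \<in> D}" using geC[OF DD(1)] d by blast
    ultimately have ne: "{a \<oplus>\<^bsub>M\<^esub> d | a d. a \<in> A \<and> d \<in> D} \<noteq> A" by metis
    have "{a \<oplus>\<^bsub>M\<^esub> d | a d. a \<in> A \<and> d \<in> D} = A \<or> {a \<oplus>\<^bsub>M\<^esub> d | a d. a \<in> A \<and> d \<in> D} = A'"
      by (rule max(2)[OF group_submodule_sum[OF sub(1) D] geA[OF DD(3)] cl]) (simp add: D_def)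
    then show ?thesis using ne by metis
  qed
  then show "A' = {a \<oplus>\<^bsub>M\<^esub> d | a d. a \<in> A \<and> d \<in> A' \<inter> B'}" unfolding D_def .
  \<comment> \<open>Again by maximality, \<open>A + (D \<inter> B)\<close> is \<open>A\<close> or
    \<open>A'\<close>. It cannot be \<open>A'\<close>, since then \<open>split\<close> would put all
    of \<open>D\<close> into \<open>B\<close>. So it is \<open>A\<close>, which gives that
    \<open>D \<inter> B\<close> lies in \<open>A\<close>.\<close>
  have kerD: "x \<in> A" if "x \<in> D" "x \<in> B" for x
  proof -
    have dj: "{a \<oplus>\<^bsub>M\<^esub> d | a d. a \<in> A \<and> d \<in> D \<inter> B} = A \<or> {a \<oplus>\<^bsub>M\<^esub> d | a d. a \<in> A \<and> d \<in> D \<inter> B} = A'"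
      by (rule max(2)[OF group_submodule_sum[OF sub(1) DB] geA[OF group_submoduleD(3)[OF DB]] cl])
        (auto simp add: D_def)
    have ne: "{a \<oplus>\<^bsub>M\<^esub> d | a d. a \<in> A \<and> d \<in> D \<inter> B} \<noteq> A'"
    proof
      assume eq: "{a \<oplus>\<^bsub>M\<^esub> d | a d. a \<in> A \<and> d \<in> D \<inter> B} = A'"
      have "d \<in> A'" using d D_def by blast
      then show False unfolding eq[symmetric] using split d by blast
    qed
    have eq: "{a \<oplus>\<^bsub>M\<^esub> d | a d. a \<in> A \<and> d \<in> D \<inter> B} = A" by (rule disjE[OF dj], assumption, rule notE[OF ne])
    have "x \<in> D \<inter> B" "D \<inter> B \<subseteq> carrier M" using that DD(1) by blast+
    from subsetD[OF geC[OF this(2)] this(1)] show ?thesis unfolding eq .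
  qed
  have AB: "x \<in> B" if "x \<in> A" "x \<in> D" for x using that meet(2) unfolding D_def by blast
  \<comment> \<open>The map \<open>a + d |-> f d\<close> on \<open>A' = A + D\<close>. It is well
    defined (\<open>f_cong\<close>) because two choices of \<open>d\<close> differ by an element of
    \<open>A \<inter> D\<close>, on which \<open>f\<close> vanishes.\<close>
  define g where "g x = f (SOME d. d \<in> D \<and> (\<exists>a\<in>A. x = a \<oplus>\<^bsub>M\<^esub> d))" for x
  have DB': "D \<subseteq> B'" unfolding D_def by blast
  have f_cong: "f d = f d'" if "a \<oplus>\<^bsub>M\<^esub> d = a' \<oplus>\<^bsub>M\<^esub> d'" "a \<in> A" "a' \<in> A" "d \<in> D" "d' \<in> D" for a a' d d'
  proof -
    note c = AD(2)[OF that(2)] AD(2)[OF that(3)] DD(2)[OF that(4)] DD(2)[OF that(5)]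
    have "d \<ominus>\<^bsub>M\<^esub> d' = \<ominus>\<^bsub>M\<^esub> a \<oplus>\<^bsub>M\<^esub> (a \<oplus>\<^bsub>M\<^esub> d) \<ominus>\<^bsub>M\<^esub> d'"
      using c by (simp add: M.a_assoc[symmetric] M.l_neg)
    also have "\<dots> = a' \<ominus>\<^bsub>M\<^esub> a"
      unfolding that(1) using c
      by (simp add: a_minus_def M.a_assoc M.r_neg) (simp add: M.a_comm)
    finally have "d \<ominus>\<^bsub>M\<^esub> d' \<in> A" using AD(6) that by simp
    moreover have dd: "d \<ominus>\<^bsub>M\<^esub> d' \<in> D" using DD(6) that by blast
    ultimately have "f (d \<ominus>\<^bsub>M\<^esub> d') = \<zero>\<^bsub>S\<^esub>" using AB fD(5)[of "d \<ominus>\<^bsub>M\<^esub> d'"] DB' by blast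
    moreover have "f ((d \<ominus>\<^bsub>M\<^esub> d') \<oplus>\<^bsub>M\<^esub> d') = f (d \<ominus>\<^bsub>M\<^esub> d') \<oplus>\<^bsub>S\<^esub> f d'"
      using fD(1) dd that(5) DB' by blast
    moreover have "(d \<ominus>\<^bsub>M\<^esub> d') \<oplus>\<^bsub>M\<^esub> d' = d" using c by (simp add: a_minus_def M.a_assoc M.l_neg)
    moreover have "f d' \<in> carrier S" using fD(7) that(5) DB' by blast
    ultimately show ?thesis by simp
  qed
  have g: "g (a \<oplus>\<^bsub>M\<^esub> d) = f d" if "a \<in> A" "d \<in> D" for a d
  proof -
    define e where "e = (SOME d'. d' \<in> D \<and> (\<exists>a'\<in>A. a \<oplus>\<^bsub>M\<^esub> d = a' \<oplus>\<^bsub>M\<^esub> d'))"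
    have "\<exists>d'. d' \<in> D \<and> (\<exists>a'\<in>A. a \<oplus>\<^bsub>M\<^esub> d = a' \<oplus>\<^bsub>M\<^esub> d')" using that by blast
    from someI_ex[OF this, folded e_def]
    obtain a' where a': "a' \<in> A" "e \<in> D" "a \<oplus>\<^bsub>M\<^esub> d = a' \<oplus>\<^bsub>M\<^esub> e" by blast
    have "f d = f e" by (rule f_cong[OF a'(3) that(1) a'(1) that(2) a'(2)])
    then show ?thesis unfolding g_def e_def[symmetric] by (rule sym)
  qed
  have elim: "\<exists>a d. a \<in> A \<and> d \<in> D \<and> x = a \<oplus>\<^bsub>M\<^esub> d" if "x \<in> A'" for x
    using that unfolding A' by blast
  have intr: "a \<oplus>\<^bsub>M\<^esub> d \<in> A'" if "a \<in> A" "d \<in> D" for a d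
    using that unfolding A' by blast
  have "factor_map K H M S A A' g"
    unfolding factor_map_def
  proof (intro conjI ballI)
    fix x y assume "x \<in> A'" "y \<in> A'"
    then obtain a d a' d' where *: "a \<in> A" "d \<in> D" "x = a \<oplus>\<^bsub>M\<^esub> d" "a' \<in> A" "d' \<in> D" "y = a' \<oplus>\<^bsub>M\<^esub> d'"
      using elim by meson
    then have "x \<oplus>\<^bsub>M\<^esub> y = (a \<oplus>\<^bsub>M\<^esub> a') \<oplus>\<^bsub>M\<^esub> (d \<oplus>\<^bsub>M\<^esub> d')"
      using AD(2)[of a] AD(2)[of a'] DD(2)[of d] DD(2)[of d'] by (simp add: M.a_ac)
    then have "g (x \<oplus>\<^bsub>M\<^esub> y) = f (d \<oplus>\<^bsub>M\<^esub> d')" using g AD(4) DD(4) * by simp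
    then show "g (x \<oplus>\<^bsub>M\<^esub> y) = g x \<oplus>\<^bsub>S\<^esub> g y" using * g fD(1)[of d d'] DB' by auto
  next
    fix c x assume c: "c \<in> carrier K" and "x \<in> A'"
    then obtain a d where *: "a \<in> A" "d \<in> D" "x = a \<oplus>\<^bsub>M\<^esub> d" using elim by meson
    then have "c \<odot>\<^bsub>M\<^esub> x = c \<odot>\<^bsub>M\<^esub> a \<oplus>\<^bsub>M\<^esub> c \<odot>\<^bsub>M\<^esub> d"
      using AD(2)[of a] DD(2)[of d] c by (simp add: M.smult_r_distr)
    then have "g (c \<odot>\<^bsub>M\<^esub> x) = f (c \<odot>\<^bsub>M\<^esub> d)" using g AD(7) DD(7) * c by simp
    then show "g (c \<odot>\<^bsub>M\<^esub> x) = c \<odot>\<^bsub>S\<^esub> g x" using * g fD(2)[of c d] DB' c by auto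
  next
    fix h x assume h: "h \<in> carrier H" and "x \<in> A'"
    then obtain a d where *: "a \<in> A" "d \<in> D" "x = a \<oplus>\<^bsub>M\<^esub> d" using elim by meson
    then have "act M h x = act M h a \<oplus>\<^bsub>M\<^esub> act M h d"
      using AD(2)[of a] DD(2)[of d] h by (simp add: act_add)
    then have "g (act M h x) = f (act M h d)" using g AD(8) DD(8) * h by simp
    then show "g (act M h x) = act S h (g x)" using * g fD(3)[of h d] DB' h by auto
  next
    have "f ` D = carrier S"
      by (rule factor_map_surj_on_submodule[OF S f D DB']) (use meet D_def in blast)
    moreover have "g ` A' = f ` D"
    proof
      show "g ` A' \<subseteq> f ` D" using elim g by fastforce
      show "f ` D \<subseteq> g ` A'"
      proof
        fix z assume "z \<in> f ` D"
        then obtain d where "d \<in> D" "z = f d" by blast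
        then have "z = g (\<zero>\<^bsub>M\<^esub> \<oplus>\<^bsub>M\<^esub> d)" "\<zero>\<^bsub>M\<^esub> \<oplus>\<^bsub>M\<^esub> d \<in> A'"
            using g[OF AD(3)] intr[OF AD(3)] by auto
        then show "z \<in> g ` A'" by blast
      qed
    qed
    ultimately show "g ` A' = carrier S" by simp
  next
    show "{x \<in> A'. g x = \<zero>\<^bsub>S\<^esub>} = A"
    proof
      show "{x \<in> A'. g x = \<zero>\<^bsub>S\<^esub>} \<subseteq> A"
      proof clarify
        fix x assume "x \<in> A'" "g x = \<zero>\<^bsub>S\<^esub>"
        then obtain a d where *: "a \<in> A" "d \<in> D" "x = a \<oplus>\<^bsub>M\<^esub> d" using elim by meson
        then have "f d = \<zero>\<^bsub>S\<^esub>" using g \<open>g x = \<zero>\<^bsub>S\<^esub>\<close> by simp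
        then have "d \<in> A" using kerD fD(5)[of d] DB' * by blast
        then show "x \<in> A" using * AD(4) by blast
      qed
      show "A \<subseteq> {x \<in> A'. g x = \<zero>\<^bsub>S\<^esub>}"
      proof
        fix a assume a: "a \<in> A"
        have "f \<zero>\<^bsub>M\<^esub> = \<zero>\<^bsub>S\<^esub>"
          using fD(5)[of "\<zero>\<^bsub>M\<^esub>"] DD(3) DB' group_submoduleD(3)[OF sub(4)] by blast
        then have "g (a \<oplus>\<^bsub>M\<^esub> \<zero>\<^bsub>M\<^esub>) = \<zero>\<^bsub>S\<^esub>" using g a DD(3) by simp
        then show "a \<in> {x \<in> A'. g x = \<zero>\<^bsub>S\<^esub>}" using a AD(2)[OF a] max(1) by auto
      qed
    qed
  qed
  then show "has_factor K H M S A A'" unfolding has_factor_def by blast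
qed

text \<open>A layer \<open>B j \<subseteq> B' j\<close> first becomes visible at one step of the
  series, and the Zassenhaus isomorphism shows that this step has factor \<open>S\<close>. Layers
  that do not overlap become visible at different steps, so \<open>S\<close> occurs at least
  \<open>card J\<close> times. The layers need not form a full chain.\<close>

lemma card_layers_le:
  assumes Ns: "composition_series K H M Ns" and S: "simple_gmodule K H S" and "finite J"
    and sub: "\<And>j. j \<in> J \<Longrightarrow> group_submodule K H M (B j)" "\<And>j. j \<in> J \<Longrightarrow> group_submodule K H M (B' j)"
    and fac: "\<And>j. j \<in> J \<Longrightarrow> has_factor K H M S (B j) (B' j)"
    and ord: "\<And>i j. i \<in> J \<Longrightarrow> j \<in> J \<Longrightarrow> i \<noteq> j \<Longrightarrow> B' i \<subseteq> B j \<or> B' j \<subseteq> B i"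
  shows "card J \<le> card {i. Suc i < length Ns \<and> has_factor K H M S (Ns ! i) (Ns ! Suc i)}"
proof -
  have "\<exists>i. Suc i < length Ns \<and> \<not> Ns ! Suc i \<inter> B' j \<subseteq> B j \<and> Ns ! i \<inter> B' j \<subseteq> B j" if j: "j \<in> J" for j
  proof -
    \<comment> \<open>\<open>P\<close> fails at the bottom of the series and holds at its top, so
      its least index is a successor \<open>Suc i\<close>; the step from \<open>i\<close> to
      \<open>Suc i\<close> is the one wanted.\<close>
    define P where "P i \<longleftrightarrow> i < length Ns \<and> \<not> Ns ! i \<inter> B' j \<subseteq> B j" for i
    have len: "Ns \<noteq> []" "Ns ! 0 = {\<zero>\<^bsub>M\<^esub>}" "Ns ! (length Ns - 1) = carrier M"
      using Ns unfolding composition_series_def by (auto simp: hd_conv_nth last_conv_nth)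
    have "\<not> B' j \<subseteq> B j" using has_factor_nontrivial[OF S fac[OF j]] .
    then have ex: "P (length Ns - 1)"
      unfolding P_def using len group_submoduleD(1)[OF sub(2)[OF j]] by (auto simp: Int_absorb1)
    have "\<not> P 0" unfolding P_def using len group_submoduleD(3)[OF sub(1)[OF j]] by auto
    moreover have P: "P (Least P)" using ex by (rule LeastI)
    ultimately obtain i where i: "Least P = Suc i" by (metis not0_implies_Suc)
    then have "\<not> P i" using not_less_Least[of i P] by simp
    then show ?thesis using P i unfolding P_def by auto
  qed
  then obtain \<phi> where \<phi>: "\<And>j. j \<in> J \<Longrightarrow> Suc (\<phi> j) < length Ns \<and>
      \<not> Ns ! Suc (\<phi> j) \<inter> B' j \<subseteq> B j \<and> Ns ! \<phi> j \<inter> B' j \<subseteq> B j" by metis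
  have st: "has_factor K H M S (Ns ! \<phi> j) (Ns ! Suc (\<phi> j)) \<and>
      Ns ! Suc (\<phi> j) = {a \<oplus>\<^bsub>M\<^esub> d | a d. a \<in> Ns ! \<phi> j \<and> d \<in> Ns ! Suc (\<phi> j) \<inter> B' j}" if j: "j \<in> J" for j
  proof -
    have len: "Suc (\<phi> j) < length Ns" and meet: "\<not> Ns ! Suc (\<phi> j) \<inter> B' j \<subseteq> B j" "Ns ! \<phi> j \<inter> B' j \<subseteq> B j"
      using \<phi>[OF j] by auto
    note st = composition_series_steps[OF Ns len]
    show ?thesis
      by (rule conjI; rule has_factor_transfer[OF S st(1,2) sub(2)[OF j] sub(1)[OF j] st(3,5) fac[OF j] meet])
  qed
  \<comment> \<open>Suppose both layers use the same step. An element \<open>x\<close> of it in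
    \<open>B' j\<close> outside \<open>B j\<close> splits as \<open>a + d\<close> with
    \<open>a\<close> from the bottom of the step and \<open>d\<close> in \<open>B' i\<close>, hence
    in \<open>B j\<close>. Then \<open>a\<close> lies in \<open>B' j\<close>, so in
    \<open>B j\<close> by the choice of the step, and \<open>x\<close> would be in
    \<open>B j\<close>.\<close>
  have neq: "\<phi> i \<noteq> \<phi> j" if ij: "i \<in> J" "j \<in> J" and le: "B' i \<subseteq> B j" for i j
  proof
    assume eq: "\<phi> i = \<phi> j"
    have len: "Suc (\<phi> j) < length Ns" using \<phi>[OF ij(2)] by blast
    note st' = composition_series_steps[OF Ns len]
    obtain x where x: "x \<in> Ns ! Suc (\<phi> j)" "x \<in> B' j" "x \<notin> B j" using \<phi>[OF ij(2)] by blast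
    then obtain a d where ad: "x = a \<oplus>\<^bsub>M\<^esub> d" "a \<in> Ns ! \<phi> j" "d \<in> B' i"
      using st[OF ij(1)] unfolding eq by blast
    have d: "d \<in> B j" using ad le by blast
    have dB': "d \<in> B' j"
      using d fac[OF ij(2)] unfolding has_factor_def factor_map_def by blast
    have "a = x \<ominus>\<^bsub>M\<^esub> d"
      using ad group_submoduleD(2)[OF st'(1), of a] group_submoduleD(2)[OF sub(1)[OF ij(2)] d]
      by (simp add: a_minus_def M.a_assoc M.r_neg)
    then have "a \<in> B' j" using group_submoduleD(6)[OF sub(2)[OF ij(2)]] x(2) dB' by blast
    then have "a \<in> B j" using \<phi>[OF ij(2)] ad by blast
    then show False using x ad d group_submoduleD(4)[OF sub(1)[OF ij(2)]] by blast
  qed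
  have "inj_on \<phi> J"
    by (rule inj_onI) (use neq ord in metis)
  moreover have "\<phi> ` J \<subseteq> {i. Suc i < length Ns \<and> has_factor K H M S (Ns ! i) (Ns ! Suc i)}"
    using \<phi> st by blast
  moreover have "finite {i. Suc i < length Ns \<and> has_factor K H M S (Ns ! i) (Ns ! Suc i)}"
    by (rule finite_subset[of _ "{..<length Ns}"]) auto
  ultimately show ?thesis using card_inj_on_le by blast
qed

text \<open>Induction on a strictly monotone measure \<open>d\<close> of submodules, for which the
  dimension will be taken: a proper submodule of greatest measure is maximal and can be extended by
  one step.\<close>

lemma composition_series_exists:
  fixes d :: "'v set \<Rightarrow> nat"
  assumes mono: "\<And>A B. group_submodule K H M A \<Longrightarrow> group_submodule K H M B \<Longrightarrow> A \<subset> B \<Longrightarrow> d A < d B"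
  shows "\<exists>Ns. composition_series K H M Ns"
proof -
  have "\<exists>Ns. Ns \<noteq> [] \<and> hd Ns = {\<zero>\<^bsub>M\<^esub>} \<and> last Ns = A \<and> (\<forall>N\<in>set Ns. group_submodule K H M N) \<and>
     (\<forall>i. Suc i < length Ns \<longrightarrow>
        Ns ! i \<subseteq> Ns ! Suc i \<and> simple_gmodule K H (series_factor M Ns i))"
    if "group_submodule K H M A" for A
    using that
  proof (induction "d A" arbitrary: A rule: less_induct)
    case less
    show ?case
    proof (cases "A = {\<zero>\<^bsub>M\<^esub>}")
      case True
      then show ?thesis using less.prems by (intro exI[of _ "[A]"]) auto
    next
      case False
      define P where "P B \<longleftrightarrow> group_submodule K H M B \<and> B \<subset> A" for B
      have P0: "P {\<zero>\<^bsub>M\<^esub>}"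
        using False group_submodule_zero group_submoduleD(3)[OF less.prems] unfolding P_def by blast
      have "\<forall>B. P B \<longrightarrow> d B < Suc (d A)" using mono less.prems unfolding P_def by (meson less_SucI)
      from ex_has_greatest_nat[of P, OF P0 this]
      obtain B where B: "P B" "\<And>C. P C \<Longrightarrow> d C \<le> d B" by auto
      have sB: "group_submodule K H M B" "B \<subset> A" using B(1) unfolding P_def by auto
      obtain Ns where Ns: "Ns \<noteq> []" "hd Ns = {\<zero>\<^bsub>M\<^esub>}" "last Ns = B" "\<forall>N\<in>set Ns. group_submodule K H M N"
        "\<And>i. Suc i < length Ns \<Longrightarrow> Ns ! i \<subseteq> Ns ! Suc i \<and> simple_gmodule K H (series_factor M Ns i)"
        using less.hyps[OF mono[OF sB(1) less.prems sB(2)] sB(1)] by blast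
      have simp: "simple_gmodule K H (quotient_gmodule (M\<lparr>carrier := A\<rparr>) B)"
      proof (subst simple_quotient_iff[OF less.prems sB(1)], use sB in blast, intro conjI allI impI)
        show "B \<noteq> A" using sB by blast
        fix C assume C: "group_submodule K H M C \<and> B \<subseteq> C \<and> C \<subseteq> A"
        show "C = B \<or> C = A"
        proof (rule ccontr)
          assume "\<not> (C = B \<or> C = A)"
          then have "P C" "B \<subset> C" using C unfolding P_def by blast+
          then show False using B(2)[of C] mono[OF sB(1), of C] C by fastforce
        qed
      qed
      have "(Ns @ [A]) ! i \<subseteq> (Ns @ [A]) ! Suc i \<and> simple_gmodule K H (series_factor M (Ns @ [A]) i)"
        if "Suc i < length (Ns @ [A])" for i
      proof (cases "Suc i < length Ns")
        case True
        then show ?thesis using Ns(5)[OF True] by (simp add: series_factor_def nth_append)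
      next
        case False
        then have "Suc i = length Ns" using that by simp
        then have "(Ns @ [A]) ! Suc i = A" "(Ns @ [A]) ! i = B"
          using Ns(1,3) by (auto simp: nth_append last_conv_nth simp flip: \<open>Suc i = _\<close>)
        then show ?thesis using simp sB unfolding series_factor_def by auto
      qed
      then show ?thesis
        using Ns(1,2,4) less.prems by (intro exI[of _ "Ns @ [A]"]) auto
    qed
  qed
  from this[OF group_submodule_carrier] show ?thesis unfolding composition_series_def .
qed

text \<open>The definition picks a series by \<open>SOME\<close>. That series is handed out together
  with the count, and the bound \<open>card_layers_le\<close>, valid for every series, is applied to
  it.\<close>

lemma composition_multiplicity_eq:
  assumes S: "group_module K H S" and ex: "\<exists>Ns. composition_series K H M Ns"
  obtains Ns where "composition_series K H M Ns"
    "composition_multiplicity K H S M =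
      card {i. Suc i < length Ns \<and> has_factor K H M S (Ns ! i) (Ns ! Suc i)}"
proof -
  define Ns where "Ns = (SOME Ns. composition_series K H M Ns)"
  have Ns: "composition_series K H M Ns" unfolding Ns_def using ex by (rule someI_ex)
  have "{i. Suc i < length Ns \<and> isomorphic_gmodule K H (series_factor M Ns i) S} =
      {i. Suc i < length Ns \<and> has_factor K H M S (Ns ! i) (Ns ! Suc i)}"
    using isomorphic_quotient_iff_has_factor[OF S composition_series_steps(2,1,3)[OF Ns]]
    unfolding series_factor_def by blast
  then have "composition_multiplicity K H S M =
      card {i. Suc i < length Ns \<and> has_factor K H M S (Ns ! i) (Ns ! Suc i)}"
    unfolding composition_multiplicity_def Ns_def[symmetric] Let_def by simp
  with Ns show ?thesis by (rule that)
qed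

end

text \<open>Frees \<open>$\<close> for the components of vectors.\<close>

unbundle no Formal_Power_Series.fps_syntax

section \<open>Modules with triangular actions\<close>

definition basis_map :: "('k::field, 'v, 'h) gmodule \<Rightarrow> ('k ^ 'e::finite \<Rightarrow> 'v) \<Rightarrow> bool" where
  "basis_map M \<Phi> \<longleftrightarrow> bij_betw \<Phi> UNIV (carrier M) \<and>
     (\<forall>c d. \<Phi> (c + d) = \<Phi> c \<oplus>\<^bsub>M\<^esub> \<Phi> d) \<and> (\<forall>a c. \<Phi> (a *s c) = a \<odot>\<^bsub>M\<^esub> \<Phi> c)"

lemma basis_mapD:
  assumes "basis_map M \<Phi>"
  shows "\<And>c. \<Phi> c \<in> carrier M" "inj \<Phi>" "range \<Phi> = carrier M"
    and "\<And>c d. \<Phi> (c + d) = \<Phi> c \<oplus>\<^bsub>M\<^esub> \<Phi> d" "\<And>a c. \<Phi> (a *s c) = a \<odot>\<^bsub>M\<^esub> \<Phi> c"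
  using assms unfolding basis_map_def bij_betw_def by auto

lemma carrier_ring_of_type_algebra [simp]: "carrier ring_of_type_algebra = UNIV"
  by (simp add: ring_of_type_algebra_def)

lemma basis_map_zero:
  assumes "group_module (ring_of_type_algebra :: 'k::field ring) H M" "basis_map M \<Phi>"
  shows "\<Phi> 0 = \<zero>\<^bsub>M\<^esub>"
proof -
  interpret group_module "ring_of_type_algebra :: 'k ring" H M by fact
  have "\<Phi> 0 \<oplus>\<^bsub>M\<^esub> \<Phi> 0 = \<Phi> 0" using basis_mapD(4)[OF assms(2), of 0 0] by simp
  then show ?thesis using basis_mapD(1)[OF assms(2), of 0] by (simp add: M.add.r_cancel_one)
qed

text \<open>Pulled back along the coordinate map, submodules become subspaces of \<open>k^e\<close>,
  whose dimension is the strictly monotone measure.\<close>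

lemma composition_series_exists_basis_map:
  fixes \<Phi> :: "'k::field ^ 'e::finite \<Rightarrow> 'v"
  assumes M: "group_module (ring_of_type_algebra :: 'k ring) H M" and \<Phi>: "basis_map M \<Phi>"
  shows "\<exists>Ns. composition_series (ring_of_type_algebra :: 'k ring) H M Ns"
proof -
  interpret group_module "ring_of_type_algebra :: 'k ring" H M by fact
  note \<Phi>D = basis_mapD[OF \<Phi>]
  have sub: "vec.subspace (\<Phi> -` A)" if A: "group_submodule ring_of_type_algebra H M A" for A
    by (rule vec.subspaceI)
      (use group_submoduleD(3,4,7)[OF A] basis_map_zero[OF M \<Phi>] in \<open>auto simp: \<Phi>D\<close>)
  show ?thesis
  proof (rule composition_series_exists[where d = "\<lambda>A. vec.dim (\<Phi> -` A)"])
    fix A B assume AB: "group_submodule ring_of_type_algebra H M A"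
      "group_submodule ring_of_type_algebra H M B" "A \<subset> B"
    have "\<Phi> -` A \<noteq> \<Phi> -` B"
    proof
      assume eq: "\<Phi> -` A = \<Phi> -` B"
      have "\<Phi> ` (\<Phi> -` C) = C" if "C \<subseteq> carrier M" for C using that \<Phi>D(3) by (simp add: image_vimage_eq Int_absorb2)
      then have "A = B" using eq group_submoduleD(1)[OF AB(1)] group_submoduleD(1)[OF AB(2)] by metis
      then show False using AB by blast
    qed
    then have "\<Phi> -` A \<subset> \<Phi> -` B" using AB by blast
    then show "vec.dim (\<Phi> -` A) < vec.dim (\<Phi> -` B)"
      using sub AB by (intro vec.dim_psubset) (simp add: vec.span_eq_iff[THEN iffD2])
  qed
qed

lemma finite_dimensional_basis_map:
  fixes \<Phi> :: "'k::field ^ 'e::finite \<Rightarrow> 'v"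
  assumes M: "group_module (ring_of_type_algebra :: 'k ring) H M" and \<Phi>: "basis_map M \<Phi>"
  shows "finite_dimensional (ring_of_type_algebra :: 'k ring) M"
proof -
  interpret group_module "ring_of_type_algebra :: 'k ring" H M by fact
  note \<Phi>D = basis_mapD[OF \<Phi>]
  define b where "b i = \<Phi> (axis i 1)" for i
  have b: "b i \<in> carrier M" for i unfolding b_def by (rule \<Phi>D(1))
  have inj: "inj b" unfolding b_def by (rule injI) (simp add: inj_eq[OF \<Phi>D(2)] axis_eq_axis)
  have sum: "\<Phi> (\<Sum>i\<in>I. (c $ i) *s axis i 1) = (\<Oplus>\<^bsub>M\<^esub>i\<in>I. (c $ i) \<odot>\<^bsub>M\<^esub> b i)" if "finite I" for I c
    using that
  proof induction
    case empty
    then show ?case by (simp add: basis_map_zero[OF M \<Phi>])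
  next
    case (insert i I)
    then show ?case by (simp add: \<Phi>D b_def)
  qed
  have "\<exists>a\<in>range b \<rightarrow> UNIV. x = (\<Oplus>\<^bsub>M\<^esub>y\<in>range b. a y \<odot>\<^bsub>M\<^esub> y)" if "x \<in> carrier M" for x
  proof -
    obtain c where c: "x = \<Phi> c"
      using \<open>x \<in> carrier M\<close> unfolding \<Phi>D(3)[symmetric] by blast
    have "x = \<Phi> (\<Sum>i\<in>UNIV. (c $ i) *s axis i 1)" unfolding c by (simp add: basis_expansion)
    also have "\<dots> = (\<Oplus>\<^bsub>M\<^esub>i\<in>UNIV. (c $ i) \<odot>\<^bsub>M\<^esub> b i)" by (rule sum) simp
    \<comment> \<open>\<open>finite_dimensional\<close> wants coefficients as a function of the
      basis vector, so the index is recovered from the vector.\<close>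
    also have "\<dots> = (\<Oplus>\<^bsub>M\<^esub>i\<in>UNIV. (c $ the_inv b (b i)) \<odot>\<^bsub>M\<^esub> b i)"
      by (simp add: the_inv_f_f[OF inj])
    also have "\<dots> = (\<Oplus>\<^bsub>M\<^esub>y\<in>range b. (c $ the_inv b y) \<odot>\<^bsub>M\<^esub> y)"
      by (rule finsum_reindex[symmetric]) (use inj b in auto)
    finally show ?thesis by (intro bexI[of _ "\<lambda>y. c $ the_inv b y"]) simp_all
  qed
  then show ?thesis
    unfolding finite_dimensional_def by (intro exI[of _ "range b"]) (auto simp: b_def \<Phi>D)
qed

text \<open>Column \<open>e\<close> of a matrix is the image of the basis vector \<open>e\<close>.
  On \<open>M\<close> the action never raises the weight \<open>w\<close>, on \<open>N\<close> it
  never lowers it, and the blocks of equal weight coincide. So the associated graded modules agree,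
  although \<open>M\<close> and \<open>N\<close> carry filtrations of opposite direction.\<close>

locale triangular_pair =
  M: group_module "ring_of_type_algebra :: 'k::field ring" H M +
  N: group_module "ring_of_type_algebra :: 'k::field ring" H N
  for H :: "'h monoid" and M :: "('k::field, 'v, 'h) gmodule" and N :: "('k::field, 'w, 'h) gmodule" +
  fixes \<Phi> :: "'k::field ^ 'e::finite \<Rightarrow> 'v" and \<Psi> :: "'k::field ^ 'e::finite \<Rightarrow> 'w" and w :: "'e::finite \<Rightarrow> int"
  assumes \<Phi>: "basis_map M \<Phi>" and \<Psi>: "basis_map N \<Psi>"
    and triangular: "\<And>h. h \<in> carrier H \<Longrightarrow> \<exists>A B. \<forall>c. act M h (\<Phi> c) = \<Phi> (A *v c) \<and>
      act N h (\<Psi> c) = \<Psi> (B *v c) \<and>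
      (\<forall>f e. (w e < w f \<longrightarrow> A $ f $ e = 0) \<and> (w f < w e \<longrightarrow> B $ f $ e = 0) \<and>
        (w f = w e \<longrightarrow> A $ f $ e = B $ f $ e))"
begin

abbreviation K where "K \<equiv> (ring_of_type_algebra :: 'k ring)"

lemmas \<Phi>D = basis_mapD[OF \<Phi>] and \<Psi>D = basis_mapD[OF \<Psi>]

text \<open>The isomorphism between the weight-\<open>s\<close> pieces, written as a relation:
  \<open>c\<close> has weights at least \<open>s\<close> and represents an element of
  \<open>N\<close>, \<open>d\<close> has weights at most \<open>s\<close> and represents an element
  of \<open>M\<close>, and their parts of weight \<open>s\<close> are equal.\<close>

definition graded_eq :: "int \<Rightarrow> 'k ^ 'e \<Rightarrow> 'k ^ 'e \<Rightarrow> bool" where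
  "graded_eq s c d \<longleftrightarrow> (\<forall>e. w e < s \<longrightarrow> c $ e = 0) \<and> (\<forall>e. s < w e \<longrightarrow> d $ e = 0) \<and>
     (\<forall>e. w e = s \<longrightarrow> c $ e = d $ e)"

lemma graded_eq_zero: "graded_eq s 0 0"
  by (simp add: graded_eq_def)

lemma graded_eq_add: "graded_eq s c d \<Longrightarrow> graded_eq s c' d' \<Longrightarrow> graded_eq s (c + c') (d + d')"
  by (simp add: graded_eq_def)

lemma graded_eq_smult: "graded_eq s c d \<Longrightarrow> graded_eq s (a *s c) (a *s d)"
  by (simp add: graded_eq_def)

text \<open>Weight \<open>s\<close> of the image comes from weight \<open>s\<close> alone. On
  \<open>N\<close>, \<open>c\<close> has no lower weights and higher ones cannot come down; on
  \<open>M\<close>, \<open>d\<close> has no higher weights and lower ones cannot go up. There the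
  two matrices agree.\<close>

lemma graded_eq_act:
  assumes "h \<in> carrier H"
  obtains h1 h2 where "\<And>d. act M h (\<Phi> d) = \<Phi> (h2 d)" "\<And>c. act N h (\<Psi> c) = \<Psi> (h1 c)"
    "\<And>s c d. graded_eq s c d \<Longrightarrow> graded_eq s (h1 c) (h2 d)"
proof -
  obtain A B where AB: "\<And>c. act M h (\<Phi> c) = \<Phi> (A *v c)" "\<And>c. act N h (\<Psi> c) = \<Psi> (B *v c)"
    "\<And>f e. w e < w f \<Longrightarrow> A $ f $ e = 0" "\<And>f e. w f < w e \<Longrightarrow> B $ f $ e = 0"
    "\<And>f e. w f = w e \<Longrightarrow> A $ f $ e = B $ f $ e"
    using triangular[OF assms] by blast
  have "graded_eq s (B *v c) (A *v d)" if "graded_eq s c d" for s c d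
  proof -
    have cd: "\<And>e. w e < s \<Longrightarrow> c $ e = 0" "\<And>e. s < w e \<Longrightarrow> d $ e = 0" "\<And>e. w e = s \<Longrightarrow> c $ e = d $ e"
      using that unfolding graded_eq_def by auto
    have "B $ f $ e * c $ e = 0" if "w f < s" for f e
      using that AB(4)[of f e] cd(1)[of e] by (cases "w f < w e") auto
    moreover have "A $ f $ e * d $ e = 0" if "s < w f" for f e
      using that AB(3)[of e f] cd(2)[of e] by (cases "w e < w f") auto
    moreover have "B $ f $ e * c $ e = A $ f $ e * d $ e" if "w f = s" for f e
      using that AB(3)[of e f] AB(4)[of f e] AB(5)[of f e] cd(1,2,3)[of e]
      by (cases "w e < w f"; cases "w f < w e") auto
    ultimately show ?thesis
      unfolding graded_eq_def matrix_vector_mult_def by (auto intro!: sum.neutral sum.cong)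
  qed
  with AB(1,2) show ?thesis by (rule that)
qed

text \<open>Transports a submodule along the isomorphism between the graded pieces of weight \<open>s\<close>.\<close>

definition layer :: "int \<Rightarrow> 'v set \<Rightarrow> 'w set" where
  "layer s A = {\<Psi> c | c d. graded_eq s c d \<and> \<Phi> d \<in> A}"

lemma layerI: "graded_eq s c d \<Longrightarrow> \<Phi> d \<in> A \<Longrightarrow> \<Psi> c \<in> layer s A"
  unfolding layer_def by blast

lemma layerE:
  assumes "y \<in> layer s A"
  obtains c d where "y = \<Psi> c" "graded_eq s c d" "\<Phi> d \<in> A"
  using assms unfolding layer_def by blast

lemma layer_mono: "A \<subseteq> B \<Longrightarrow> layer s A \<subseteq> layer s B"
  unfolding layer_def by blast

text \<open>A vector \<open>c\<close> with all weights at least \<open>s\<close>, hence above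
  \<open>s'\<close>, is a partner of \<open>0\<close> at weight \<open>s'\<close>, and
  \<open>0\<close> belongs to every submodule.\<close>

lemma layer_less:
  assumes "s' < s" and B: "group_submodule K H M B"
  shows "layer s A \<subseteq> layer s' B"
proof
  fix y assume "y \<in> layer s A"
  then obtain c d where *: "y = \<Psi> c" "graded_eq s c d" by (rule layerE)
  then have "graded_eq s' c 0" using assms(1) unfolding graded_eq_def by auto
  moreover have "\<Phi> 0 \<in> B"
    using M.group_submoduleD(3)[OF B] basis_map_zero[OF M.group_module_axioms \<Phi>] by simp
  ultimately show "y \<in> layer s' B" unfolding * by (rule layerI)
qed

lemma group_submodule_layer:
  assumes A: "group_submodule K H M A"
  shows "group_submodule K H N (layer s A)"
proof (rule N.group_submoduleI)
  note AD = M.group_submoduleD[OF A]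
  show "layer s A \<subseteq> carrier N" unfolding layer_def by (auto simp: \<Psi>D)
  have "\<Psi> 0 \<in> layer s A"
    by (rule layerI[OF graded_eq_zero])
      (simp add: AD(3) basis_map_zero[OF M.group_module_axioms \<Phi>])
  then show "\<zero>\<^bsub>N\<^esub> \<in> layer s A" by (simp add: basis_map_zero[OF N.group_module_axioms \<Psi>])
  show "x \<oplus>\<^bsub>N\<^esub> y \<in> layer s A" if x: "x \<in> layer s A" and y: "y \<in> layer s A" for x y
  proof -
    from x obtain c d where 1: "x = \<Psi> c" "graded_eq s c d" "\<Phi> d \<in> A" by (rule layerE)
    from y obtain c' d' where 2: "y = \<Psi> c'" "graded_eq s c' d'" "\<Phi> d' \<in> A" by (rule layerE)
    have "\<Psi> (c + c') \<in> layer s A"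
      by (rule layerI[OF graded_eq_add[OF 1(2) 2(2)]]) (simp add: \<Phi>D AD(4) 1 2)
    then show ?thesis by (simp add: 1 2 \<Psi>D)
  qed
  show "a \<odot>\<^bsub>N\<^esub> x \<in> layer s A" if x: "x \<in> layer s A" for a x
  proof -
    from x obtain c d where 1: "x = \<Psi> c" "graded_eq s c d" "\<Phi> d \<in> A" by (rule layerE)
    have "\<Psi> (a *s c) \<in> layer s A"
      by (rule layerI[OF graded_eq_smult[OF 1(2)]]) (simp add: \<Phi>D AD(7) 1)
    then show ?thesis by (simp add: 1 \<Psi>D)
  qed
  show "act N h x \<in> layer s A" if h: "h \<in> carrier H" and x: "x \<in> layer s A" for h x
  proof -
    from x obtain c d where 1: "x = \<Psi> c" "graded_eq s c d" "\<Phi> d \<in> A" by (rule layerE)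
    obtain h1 h2 where 2: "\<And>d. act M h (\<Phi> d) = \<Phi> (h2 d)"
      "\<And>c. act N h (\<Psi> c) = \<Psi> (h1 c)" "\<And>s c d. graded_eq s c d \<Longrightarrow> graded_eq s (h1 c) (h2 d)"
      by (rule graded_eq_act[OF h]) (rule that)
    have "\<Psi> (h1 c) \<in> layer s A"
      by (rule layerI[OF 2(3)[OF 1(2)]]) (use AD(8)[OF h 1(3)] in \<open>simp add: 2\<close>)
    then show ?thesis by (simp add: 1 2)
  qed
qed

text \<open>Negated weights exchange the two roles, so each inequality between \<open>M\<close> and
  \<open>N\<close> comes with its reverse.\<close>

lemma swap: "triangular_pair H N M \<Psi> \<Phi> (\<lambda>e. - w e)"
proof (rule triangular_pair.intro[OF N.group_module_axioms M.group_module_axioms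
      triangular_pair_axioms.intro[OF \<Psi> \<Phi>]])
  fix h assume "h \<in> carrier H"
  from triangular[OF this] obtain A B where "\<forall>c. act M h (\<Phi> c) = \<Phi> (A *v c) \<and>
    act N h (\<Psi> c) = \<Psi> (B *v c) \<and>
    (\<forall>f e. (w e < w f \<longrightarrow> A $ f $ e = 0) \<and> (w f < w e \<longrightarrow> B $ f $ e = 0) \<and>
      (w f = w e \<longrightarrow> A $ f $ e = B $ f $ e))" by blast
  then show "\<exists>A B. \<forall>c. act N h (\<Psi> c) = \<Psi> (A *v c) \<and> act M h (\<Phi> c) = \<Phi> (B *v c) \<and>
    (\<forall>f e. (- w e < - w f \<longrightarrow> A $ f $ e = 0) \<and> (- w f < - w e \<longrightarrow> B $ f $ e = 0) \<and>
      (- w f = - w e \<longrightarrow> A $ f $ e = B $ f $ e))"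
    by (intro exI[of _ B] exI[of _ A]) auto
qed

text \<open>This filtration step of \<open>M\<close> is the layer of all of \<open>N\<close> for the
  swapped pair, and layers are already known to be submodules.\<close>

lemma group_submodule_filtration:
  "group_submodule K H M {\<Phi> d | d. \<forall>e. s < w e \<longrightarrow> d $ e = 0}"
proof -
  interpret NM: triangular_pair H N M \<Psi> \<Phi> "\<lambda>e. - w e" by (rule swap)
  have eq: "NM.layer (- s) (carrier N) = {\<Phi> d | d. \<forall>e. s < w e \<longrightarrow> d $ e = 0}"
  proof (intro subset_antisym subsetI)
    fix x assume "x \<in> {\<Phi> d | d. \<forall>e. s < w e \<longrightarrow> d $ e = 0}"
    then obtain d where d: "x = \<Phi> d" "\<forall>e. s < w e \<longrightarrow> d $ e = 0" by blast
    have "NM.graded_eq (- s) d (\<chi> e. if w e = s then d $ e else 0)"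
      using d(2) by (simp add: NM.graded_eq_def)
    then show "x \<in> NM.layer (- s) (carrier N)" unfolding d(1) by (rule NM.layerI) (rule \<Psi>D(1))
  qed (auto simp: NM.layer_def NM.graded_eq_def)
  show ?thesis using NM.group_submodule_layer[OF N.group_submodule_carrier, of "- s"] unfolding eq .
qed

text \<open>The simple factor lives in a single weight: \<open>s\<close> is the least top weight of
  an element of \<open>A'\<close> outside \<open>A\<close>. Elements of \<open>A'\<close> below
  weight \<open>s\<close> lie in the kernel of \<open>f\<close>, so on elements of \<open>A'\<close>
  of weight at most \<open>s\<close> the value of \<open>f\<close> is determined by the part of
  weight \<open>s\<close>. These elements already fill \<open>S\<close>, because \<open>S\<close> is
  simple.\<close>

lemma has_factor_layer:
  assumes S: "simple_gmodule K H S" and fac: "has_factor K H M S A A'"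
    and A: "group_submodule K H M A" and A': "group_submodule K H M A'"
  obtains s where "has_factor K H N S (layer s A) (layer s A')"
proof -
  interpret S: group_module K H S using S by (simp add: simple_gmodule_def)
  obtain f where f: "factor_map K H M S A A' f" using fac unfolding has_factor_def by blast
  note fD = factor_mapD[OF f] and AD = M.group_submoduleD[OF A] and A'D = M.group_submoduleD[OF A']
  \<comment> \<open>The top weight, shifted by the least weight so that it is a natural number and a
    minimum can be taken.\<close>
  define deg where "deg c = nat (Max (w ` {e. c $ e \<noteq> 0}) - Min (range w))" for c :: "'k ^ 'e"
  have "\<not> A' \<subseteq> A" by (rule M.has_factor_nontrivial[OF S fac])
  then obtain x where x: "x \<in> A'" "x \<notin> A" by blast
  have "x \<in> range \<Phi>" unfolding \<Phi>D(3) using A'D(1) x(1) by blast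
  with x obtain c0 where "\<Phi> c0 \<in> A'" "\<Phi> c0 \<notin> A" by blast
  then obtain c where c: "\<Phi> c \<in> A'" "\<Phi> c \<notin> A"
    and least: "\<And>d. \<Phi> d \<in> A' \<Longrightarrow> \<Phi> d \<notin> A \<Longrightarrow> deg c \<le> deg d"
    using ex_has_least_nat[of "\<lambda>c. \<Phi> c \<in> A' \<and> \<Phi> c \<notin> A" c0 deg] by blast
  have supp: "{e. d $ e \<noteq> 0} \<noteq> {}" if "\<Phi> d \<notin> A" for d :: "'k ^ 'e"
  proof
    assume "{e. d $ e \<noteq> 0} = {}"
    then have "d = 0" by (simp add: vec_eq_iff)
    then show False using that AD(3) basis_map_zero[OF M.group_module_axioms \<Phi>] by simp
  qed
  define s where "s = Max (w ` {e. c $ e \<noteq> 0})"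
  have c_le: "c $ e = 0" if "s < w e" for e
  proof (rule ccontr)
    assume "c $ e \<noteq> 0"
    then have "w e \<le> s" unfolding s_def by (intro Max_ge) auto
    then show False using that by simp
  qed
  have below: "\<Phi> d \<in> A" if d: "\<Phi> d \<in> A'" "\<And>e. s \<le> w e \<Longrightarrow> d $ e = 0" for d
  proof (rule ccontr)
    assume *: "\<Phi> d \<notin> A"
    have "Max (w ` {e. d $ e \<noteq> 0}) \<in> w ` {e. d $ e \<noteq> 0}" using supp[OF *] by (intro Max_in) auto
    then have "Max (w ` {e. d $ e \<noteq> 0}) < s" "Max (w ` {e. d $ e \<noteq> 0}) \<ge> Min (range w)"
      using d(2) by (auto simp: not_le[symmetric])
    then have "deg d < deg c" unfolding deg_def s_def[symmetric] by simp
    then show False using least[OF d(1) *] by simp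
  qed
  \<comment> \<open>Any partner \<open>d\<close> of the coordinates of \<open>y\<close> with
    \<open>\<Phi> d\<close> in \<open>A'\<close> may be used: two partners differ by a vector of
    weights below \<open>s\<close>, whose image is in \<open>A\<close> by
    \<open>below\<close>.\<close>
  define g where "g y = f (\<Phi> (SOME d. graded_eq s (the_inv \<Psi> y) d \<and> \<Phi> d \<in> A'))" for y
  have f_cong: "f (\<Phi> d) = f (\<Phi> d')"
    if d: "graded_eq s c d" "graded_eq s c d'" "\<Phi> d \<in> A'" "\<Phi> d' \<in> A'" for c d d'
  proof -
    have eq: "d - d' = d + (- 1) *s d'" by (simp add: vec_eq_iff)
    have m: "\<Phi> (d - d') \<in> A'" unfolding eq \<Phi>D using d(3,4) A'D(4,7) by simp
    have "\<Phi> (d - d') \<in> A"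
    proof (rule below[OF m])
      show "(d - d') $ e = 0" if "s \<le> w e" for e
        using d(1,2) that unfolding graded_eq_def by (cases "w e = s") auto
    qed
    then have "f (\<Phi> (d - d')) = \<zero>\<^bsub>S\<^esub>" using fD(5)[OF m] by blast
    moreover have "f (\<Phi> (d - d' + d')) = f (\<Phi> (d - d')) \<oplus>\<^bsub>S\<^esub> f (\<Phi> d')"
      unfolding \<Phi>D(4)[of "d - d'"] by (rule fD(1)[OF m d(4)])
    ultimately show ?thesis using fD(7)[OF d(4)] by simp
  qed
  have g: "g (\<Psi> c) = f (\<Phi> d)" if "graded_eq s c d" "\<Phi> d \<in> A'" for c d
  proof -
    define e where "e = (SOME d. graded_eq s c d \<and> \<Phi> d \<in> A')"
    have "graded_eq s c e \<and> \<Phi> e \<in> A'" unfolding e_def by (rule someI[of _ d]) (use that in blast)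
    then have "f (\<Phi> e) = f (\<Phi> d)" using f_cong that by blast
    then show ?thesis unfolding g_def the_inv_f_f[OF \<Psi>D(2)] e_def .
  qed
  have "factor_map K H N S (layer s A) (layer s A') g"
    unfolding factor_map_def
  proof (intro conjI ballI)
    fix x y assume x: "x \<in> layer s A'" and y: "y \<in> layer s A'"
    from x obtain c d where 1: "x = \<Psi> c" "graded_eq s c d" "\<Phi> d \<in> A'" by (rule layerE)
    from y obtain c' d' where 2: "y = \<Psi> c'" "graded_eq s c' d'" "\<Phi> d' \<in> A'" by (rule layerE)
    have "g (\<Psi> (c + c')) = f (\<Phi> (d + d'))"
      by (rule g[OF graded_eq_add[OF 1(2) 2(2)]]) (simp add: \<Phi>D A'D(4) 1 2)
    also have "\<dots> = f (\<Phi> d) \<oplus>\<^bsub>S\<^esub> f (\<Phi> d')" unfolding \<Phi>D by (rule fD(1)[OF 1(3) 2(3)])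
    finally show "g (x \<oplus>\<^bsub>N\<^esub> y) = g x \<oplus>\<^bsub>S\<^esub> g y"
      unfolding 1(1) 2(1) \<Psi>D g[OF 1(2,3)] g[OF 2(2,3)] .
  next
    fix a x assume x: "x \<in> layer s A'"
    from x obtain c d where 1: "x = \<Psi> c" "graded_eq s c d" "\<Phi> d \<in> A'" by (rule layerE)
    have "g (\<Psi> (a *s c)) = f (\<Phi> (a *s d))"
      by (rule g[OF graded_eq_smult[OF 1(2)]]) (simp add: \<Phi>D A'D(7) 1)
    also have "\<dots> = a \<odot>\<^bsub>S\<^esub> f (\<Phi> d)" unfolding \<Phi>D by (rule fD(2)[OF _ 1(3)]) simp
    finally show "g (a \<odot>\<^bsub>N\<^esub> x) = a \<odot>\<^bsub>S\<^esub> g x"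
      unfolding 1(1) \<Psi>D g[OF 1(2,3)] .
  next
    fix h x assume h: "h \<in> carrier H" and x: "x \<in> layer s A'"
    from x obtain c d where 1: "x = \<Psi> c" "graded_eq s c d" "\<Phi> d \<in> A'" by (rule layerE)
    obtain h1 h2 where 2: "\<And>d. act M h (\<Phi> d) = \<Phi> (h2 d)"
      "\<And>c. act N h (\<Psi> c) = \<Psi> (h1 c)" "\<And>s c d. graded_eq s c d \<Longrightarrow> graded_eq s (h1 c) (h2 d)"
      by (rule graded_eq_act[OF h]) (rule that)
    have "g (\<Psi> (h1 c)) = f (\<Phi> (h2 d))"
      by (rule g[OF 2(3)[OF 1(2)]]) (use A'D(8)[OF h 1(3)] in \<open>simp add: 2\<close>)
    also have "\<dots> = act S h (f (\<Phi> d))" unfolding 2(1)[symmetric] by (rule fD(3)[OF h 1(3)])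
    finally show "g (act N h x) = act S h (g x)"
      unfolding 1(1) 2(2) g[OF 1(2,3)] .
  next
    define F where "F = {\<Phi> d | d. \<forall>e. s < w e \<longrightarrow> d $ e = 0}"
    have F: "group_submodule K H M F" unfolding F_def by (rule group_submodule_filtration)
    have "\<Phi> c \<in> F" unfolding F_def using c_le by blast
    \<comment> \<open>\<open>\<Phi> c\<close> witnesses that \<open>F \<inter> A'\<close> is not
      contained in the kernel \<open>A\<close>.\<close>
    then have "f ` (F \<inter> A') = carrier S"
      using c by (intro M.factor_map_surj_on_submodule[OF S f] M.group_submodule_Int F A') auto
    moreover have "g ` layer s A' = f ` (F \<inter> A')"
    proof (intro subset_antisym subsetI)
      fix z assume "z \<in> g ` layer s A'"
      then obtain y where y: "y \<in> layer s A'" "z = g y" by blast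
      from y(1) obtain c d where 1: "y = \<Psi> c" "graded_eq s c d" "\<Phi> d \<in> A'" by (rule layerE)
      then have "\<Phi> d \<in> F" unfolding F_def graded_eq_def by blast
      then show "z \<in> f ` (F \<inter> A')" using y 1 g by blast
    next
      fix z assume "z \<in> f ` (F \<inter> A')"
      then obtain d where d: "\<forall>e. s < w e \<longrightarrow> d $ e = 0" "\<Phi> d \<in> A'" "z = f (\<Phi> d)"
        unfolding F_def by blast
      \<comment> \<open>A partner of \<open>d\<close> on the other side: its part of weight
        \<open>s\<close>.\<close>
      have "graded_eq s (\<chi> e. if w e = s then d $ e else 0) d" using d(1) by (simp add: graded_eq_def)
      note ge = this
      have "z = g (\<Psi> (\<chi> e. if w e = s then d $ e else 0))" unfolding d(3) by (rule g[OF ge d(2), symmetric])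
      then show "z \<in> g ` layer s A'" using layerI[OF ge d(2)] by (rule image_eqI)
    qed
    ultimately show "g ` layer s A' = carrier S" by simp
  next
    show "{x \<in> layer s A'. g x = \<zero>\<^bsub>S\<^esub>} = layer s A"
    proof (intro subset_antisym subsetI)
      fix x assume "x \<in> {x \<in> layer s A'. g x = \<zero>\<^bsub>S\<^esub>}"
      then have x: "x \<in> layer s A'" "g x = \<zero>\<^bsub>S\<^esub>" by auto
      from x(1) obtain c d where 1: "x = \<Psi> c" "graded_eq s c d" "\<Phi> d \<in> A'" by (rule layerE)
      have "f (\<Phi> d) = \<zero>\<^bsub>S\<^esub>" using x(2) unfolding 1(1) g[OF 1(2,3)] .
      then have "\<Phi> d \<in> A" using fD(5)[OF 1(3)] by blast
      then show "x \<in> layer s A" unfolding 1(1) by (rule layerI[OF 1(2)])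
    next
      fix x assume "x \<in> layer s A"
      then obtain c d where 1: "x = \<Psi> c" "graded_eq s c d" "\<Phi> d \<in> A" by (rule layerE)
      then have d: "\<Phi> d \<in> A'" using fD(6) by blast
      have "g x = \<zero>\<^bsub>S\<^esub>" unfolding 1(1) g[OF 1(2) d] using fD(5)[OF d] 1(3) by blast
      then show "x \<in> {x \<in> layer s A'. g x = \<zero>\<^bsub>S\<^esub>}"
        using layerI[OF 1(2) d] 1(1) by blast
    qed
  qed
  then show ?thesis using that unfolding has_factor_def by blast
qed

text \<open>Each occurrence of \<open>S\<close> in a series of \<open>M\<close> becomes a layer of
  \<open>N\<close> with factor \<open>S\<close>. Two such layers do not overlap: at equal weight
  they are ordered by their position in the series, at different weights by
  \<open>layer_less\<close>. Hence the counting lemma applies to them.\<close>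

lemma composition_multiplicity_le:
  assumes S: "simple_gmodule K H S"
  shows "composition_multiplicity K H S M \<le> composition_multiplicity K H S N"
proof -
  have S': "group_module K H S" using S by (simp add: simple_gmodule_def)
  obtain Ms where Ms: "composition_series K H M Ms" "composition_multiplicity K H S M =
      card {i. Suc i < length Ms \<and> has_factor K H M S (Ms ! i) (Ms ! Suc i)}"
    by (rule M.composition_multiplicity_eq[OF S'
          composition_series_exists_basis_map[OF M.group_module_axioms \<Phi>]])
  obtain Ns where Ns: "composition_series K H N Ns" "composition_multiplicity K H S N =
      card {i. Suc i < length Ns \<and> has_factor K H N S (Ns ! i) (Ns ! Suc i)}"
    by (rule N.composition_multiplicity_eq[OF S'
          composition_series_exists_basis_map[OF N.group_module_axioms \<Psi>]])
  define J where "J = {i. Suc i < length Ms \<and> has_factor K H M S (Ms ! i) (Ms ! Suc i)}"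
  have J: "Suc i < length Ms" "has_factor K H M S (Ms ! i) (Ms ! Suc i)" if "i \<in> J" for i
    using that unfolding J_def by auto
  have "finite J" unfolding J_def by (rule finite_subset[of _ "{..<length Ms}"]) auto
  have "\<exists>s. has_factor K H N S (layer s (Ms ! i)) (layer s (Ms ! Suc i))" if "i \<in> J" for i
    by (rule has_factor_layer[OF S J(2)[OF that] M.composition_series_steps(1,2)[OF Ms(1) J(1)[OF that]]])
      blast
  then obtain s where s: "\<And>i. i \<in> J \<Longrightarrow> has_factor K H N S (layer (s i) (Ms ! i)) (layer (s i) (Ms ! Suc i))"
    by metis
  have inc: "Ms ! i \<subseteq> Ms ! j" if "i \<le> j" "j < length Ms" for i j
    using that
  proof (induction j rule: dec_induct)
    case (step n)
    then show ?case using M.composition_series_steps(3)[OF Ms(1), of n] by auto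
  qed simp
  have ord: "layer (s i) (Ms ! Suc i) \<subseteq> layer (s j) (Ms ! j) \<or>
      layer (s j) (Ms ! Suc j) \<subseteq> layer (s i) (Ms ! i)" if ij: "i \<in> J" "j \<in> J" "i < j" for i j
  proof -
    note steps = M.composition_series_steps[OF Ms(1)]
    consider "s i = s j" | "s i < s j" | "s j < s i" by linarith
    then show ?thesis
    proof cases
      case 1
      then show ?thesis using layer_mono[OF inc[of "Suc i" j]] J(1)[OF ij(2)] ij(3) 1 by auto
    next
      case 2
      then show ?thesis using layer_less[OF 2 steps(1)] J ij by blast
    next
      case 3
      then show ?thesis using layer_less[OF 3 steps(1)] J ij by blast
    qed
  qed
  have "card J \<le> card {i. Suc i < length Ns \<and> has_factor K H N S (Ns ! i) (Ns ! Suc i)}"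
  proof (rule N.card_layers_le[OF Ns(1) S \<open>finite J\<close> _ _ s])
    fix i j assume "i \<in> J" "j \<in> J" "i \<noteq> j"
    then show "layer (s i) (Ms ! Suc i) \<subseteq> layer (s j) (Ms ! j) \<or>
        layer (s j) (Ms ! Suc j) \<subseteq> layer (s i) (Ms ! i)"
      using ord[of i j] ord[of j i] by (meson linorder_neqE_nat)
  qed (use M.composition_series_steps[OF Ms(1)] J in \<open>auto intro!: group_submodule_layer\<close>)
  then show ?thesis unfolding Ms(2) Ns(2) J_def .
qed

end

lemma brauer_isomorphic_triangular:
  assumes "triangular_pair H M N \<Phi> \<Psi> w"
  shows "brauer_isomorphic TYPE('s) (ring_of_type_algebra :: 'k::field ring) H M N"
proof -
  interpret MN: triangular_pair H M N \<Phi> \<Psi> w by fact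
  interpret NM: triangular_pair H N M \<Psi> \<Phi> "\<lambda>e. - w e" by (rule MN.swap)
  show ?thesis
    unfolding brauer_isomorphic_def
    using MN.composition_multiplicity_le NM.composition_multiplicity_le
      finite_dimensional_basis_map[OF MN.M.group_module_axioms MN.\<Phi>]
      finite_dimensional_basis_map[OF MN.N.group_module_axioms MN.\<Psi>]
      MN.M.group_module_axioms MN.N.group_module_axioms
    by (auto intro!: antisym)
qed

section \<open>Filtrations by monomials\<close>

definition pscale :: "'k::field \<Rightarrow> ('m::comm_monoid_add \<Rightarrow>\<^sub>0 'k) \<Rightarrow> ('m \<Rightarrow>\<^sub>0 'k)" where
  "pscale a p = Poly_Mapping.single 0 a * p"

lemma pscale_mult [simp]: "pscale a p * q = pscale a (p * q)" "p * pscale a q = pscale a (p * q)"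
  by (simp_all add: pscale_def mult_ac)

text \<open>One vector space structure for both sides: polynomials are the monoid algebra of
  exponent vectors, and the permutation module is the group algebra of the additive group of
  vectors.\<close>

interpretation pm: vector_space "pscale :: 'k::field \<Rightarrow> ('m::comm_monoid_add \<Rightarrow>\<^sub>0 'k) \<Rightarrow> _"
proof
  fix a b :: 'k and x y :: "'m \<Rightarrow>\<^sub>0 'k"
  show "pscale a (x + y) = pscale a x + pscale a y" by (simp add: pscale_def algebra_simps)
  show "pscale (a + b) x = pscale a x + pscale b x" by (simp add: pscale_def single_add algebra_simps)
  show "pscale a (pscale b x) = pscale (a * b) x"
    by (simp add: pscale_def mult.assoc[symmetric] mult_single)
  show "pscale 1 x = x" by (simp add: pscale_def single_one)
qed

lemma lookup_pscale: "Poly_Mapping.lookup (pscale a x) v = a * Poly_Mapping.lookup x v"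
  by (simp add: pscale_def mult_map_scale_conv_mult[symmetric] Poly_Mapping.map.rep_eq when_def)

lemma pscale_power: "pscale a x ^ n = pscale (a ^ n) (x ^ n)"
  by (induction n) (simp_all add: pm.scale_scale mult_ac)

lemma prod_pscale: "(\<Prod>i\<in>I. pscale (a i) (x i)) = pscale (\<Prod>i\<in>I. a i) (\<Prod>i\<in>I. x i)"
  by (induction I rule: infinite_finite_induct) (simp_all add: pm.scale_scale mult_ac)

lemma span_mult:
  assumes x: "x \<in> pm.span X'" and y: "y \<in> pm.span Y"
    and XY: "\<And>a b. a \<in> X' \<Longrightarrow> b \<in> Y \<Longrightarrow> a * b \<in> pm.span Z"
  shows "x * y \<in> pm.span Z"
  using x
proof (induction rule: pm.span_induct_alt)
  case base
  then show ?case by (simp add: pm.span_zero)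
next
  case (step c a x)
  have "a * y \<in> pm.span Z"
    using y
  proof (induction rule: pm.span_induct_alt)
    case base
    then show ?case by (simp add: pm.span_zero)
  next
    case (step c' b y)
    then show ?case using XY[OF \<open>a \<in> X'\<close>]
      by (simp add: distrib_left pm.span_add pm.span_scale)
  qed
  then show ?case using step by (simp add: distrib_right pm.span_add pm.span_scale)
qed

text \<open>Replacing the factors \<open>x i\<close> by \<open>y i\<close> one at a time changes the
  product by terms that contain a difference \<open>x i - y i\<close>, and one factor from
  \<open>L\<close> puts the whole term into \<open>L\<close>.\<close>

lemma prod_diff_mem:
  assumes sub: "\<And>s. pm.subspace (U s)" "\<And>s. pm.subspace (L s)" "\<And>s. L s \<subseteq> U s"
    and mult: "\<And>s t x y. x \<in> U s \<Longrightarrow> y \<in> U t \<Longrightarrow> x * y \<in> U (s + t)"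
      "\<And>s t x y. x \<in> L s \<Longrightarrow> y \<in> U t \<Longrightarrow> x * y \<in> L (s + t)"
    and one: "1 \<in> U (0 :: nat)" and "finite I"
    and y: "\<And>i. i \<in> I \<Longrightarrow> y i \<in> U 1" and xy: "\<And>i. i \<in> I \<Longrightarrow> x i - y i \<in> L 1"
  shows "(\<Prod>i\<in>I. y i) \<in> U (card I) \<and> (\<Prod>i\<in>I. x i) - (\<Prod>i\<in>I. y i) \<in> L (card I)"
  using \<open>finite I\<close> y xy
proof (induction I)
  case empty
  then show ?case using one pm.subspace_0[OF sub(2)] by simp
next
  case (insert i I)
  let ?x = "\<Prod>i\<in>I. x i" and ?y = "\<Prod>i\<in>I. y i"
  have IH: "?y \<in> U (card I)" "?x - ?y \<in> L (card I)" using insert by auto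
  have i: "y i \<in> U 1" "x i - y i \<in> L 1" using insert by auto
  have "x i * ?x - y i * ?y = (?x - ?y) * y i + (x i - y i) * ((?x - ?y) + ?y)"
    by (simp add: algebra_simps)
  moreover have "(?x - ?y) * y i \<in> L (Suc (card I))" using mult(2)[OF IH(2) i(1)] by simp
  moreover have "(?x - ?y) + ?y \<in> U (card I)"
    using IH sub(3) by (intro pm.subspace_add[OF sub(1)]) auto
  then have "(x i - y i) * ((?x - ?y) + ?y) \<in> L (Suc (card I))" using mult(2)[OF i(2)] by fastforce
  moreover have "y i * ?y \<in> U (Suc (card I))" using mult(1)[OF i(1) IH(1)] by simp
  ultimately show ?case using insert.hyps pm.subspace_add[OF sub(2)] by simp
qed

definition gmon :: "'b set \<Rightarrow> ('b \<Rightarrow> 'a::comm_monoid_mult) \<Rightarrow> ('b \<Rightarrow> nat) \<Rightarrow> 'a" where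
  "gmon B z f = (\<Prod>b\<in>B. z b ^ f b)"

lemma gmon_add: "gmon B z f * gmon B z g = gmon B z (\<lambda>b. f b + g b)"
  by (simp add: gmon_def power_add prod.distrib)

lemma gmon_cong: "(\<And>b. b \<in> B \<Longrightarrow> f b = g b) \<Longrightarrow> gmon B z f = gmon B z g"
  by (simp add: gmon_def)

lemma gmon_single: "finite B \<Longrightarrow> b \<in> B \<Longrightarrow> gmon B z (\<lambda>c. if c = b then k else 0) = z b ^ k"
  by (simp add: gmon_def if_distrib prod.delta cong: if_cong)

text \<open>One slot for each factor of the monomial with exponents \<open>e\<close>, repetitions
  included. Expanding a product of linear forms means choosing one variable for every slot.\<close>

definition slots :: "'b set \<Rightarrow> ('b \<Rightarrow> nat) \<Rightarrow> ('b \<times> nat) set" where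
  "slots B e = (SIGMA b:B. {..<e b})"

text \<open>The exponents of the monomial resulting from the choice \<open>\<phi>\<close>. The
  restriction to \<open>B\<close> makes them extensional, so they can be compared with members of
  \<open>B \<rightarrow>\<^sub>E {..<p}\<close> by equality of functions.\<close>

definition occurrences :: "'b set \<Rightarrow> ('b \<Rightarrow> nat) \<Rightarrow> ('b \<times> nat \<Rightarrow> 'b) \<Rightarrow> 'b \<Rightarrow> nat" where
  "occurrences B e \<phi> = (\<lambda>b\<in>B. card {t \<in> slots B e. \<phi> t = b})"

text \<open>The coefficient of the monomial \<open>z^f\<close> in the expansion of the product of the powers
  \<open>(\<Sum>\<^sub>c G b c z\<^sub>c)^(e b)\<close>.\<close>

definition expansion_coeff :: "'b set \<Rightarrow> ('b \<Rightarrow> 'b \<Rightarrow> 'k::field) \<Rightarrow> ('b \<Rightarrow> nat) \<Rightarrow> ('b \<Rightarrow> nat) \<Rightarrow> 'k" where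
  "expansion_coeff B G e f =
     (\<Sum>\<phi>\<in>{\<phi> \<in> slots B e \<rightarrow>\<^sub>E B. occurrences B e \<phi> = f}. \<Prod>t\<in>slots B e. G (fst t) (\<phi> t))"

text \<open>What the matrices on both sides share: blocks of equal total degree that depend on
  \<open>G\<close> only. Outside these blocks, the relation \<open>lt\<close>, which is
  \<open><\<close> on one side and \<open>>\<close> on the other, says in which direction errors may
  go.\<close>

definition leading_matrix ::
  "'b set \<Rightarrow> ('b \<Rightarrow> 'b \<Rightarrow> 'k::field) \<Rightarrow> ('e::finite \<Rightarrow> 'b \<Rightarrow> nat) \<Rightarrow> (nat \<Rightarrow> nat \<Rightarrow> bool) \<Rightarrow> 'k ^ 'e ^ 'e \<Rightarrow> bool"
  where "leading_matrix B G \<eta> lt A \<longleftrightarrow>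
    (\<forall>f e. sum (\<eta> f) B = sum (\<eta> e) B \<longrightarrow> A $ f $ e = expansion_coeff B G (\<eta> e) (\<eta> f)) \<and>
    (\<forall>f e. sum (\<eta> f) B \<noteq> sum (\<eta> e) B \<longrightarrow> \<not> lt (sum (\<eta> f) B) (sum (\<eta> e) B) \<longrightarrow> A $ f $ e = 0)"

lemma finite_slots: "finite B \<Longrightarrow> finite (slots B e)"
  by (simp add: slots_def)

lemma card_slots: "finite B \<Longrightarrow> card (slots B e) = sum e B"
  by (simp add: slots_def card_SigmaI)

lemma gmon_slots: "finite B \<Longrightarrow> gmon B z e = (\<Prod>t\<in>slots B e. z (fst t))"
  unfolding gmon_def slots_def
  using prod.Sigma[of B "\<lambda>b. {..<e b}" "\<lambda>b _. z b"] by (simp add: case_prod_unfold)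

lemma gmon_occurrences:
  assumes "finite B" "\<phi> \<in> slots B e \<rightarrow>\<^sub>E B"
  shows "(\<Prod>t\<in>slots B e. z (\<phi> t)) = gmon B z (occurrences B e \<phi>)"
    and "sum (occurrences B e \<phi>) B = sum e B"
proof -
  have im: "\<phi> ` slots B e \<subseteq> B" using assms(2) by auto
  have "(\<Prod>t\<in>slots B e. z (\<phi> t)) = (\<Prod>b\<in>B. \<Prod>t\<in>{t \<in> slots B e. \<phi> t = b}. z (\<phi> t))"
    by (rule prod.group[symmetric, OF finite_slots[OF assms(1)] assms(1) im])
  also have "\<dots> = gmon B z (occurrences B e \<phi>)"
    unfolding gmon_def occurrences_def by (rule prod.cong) auto
  finally show "(\<Prod>t\<in>slots B e. z (\<phi> t)) = gmon B z (occurrences B e \<phi>)" .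
  have "card (slots B e) = (\<Sum>b\<in>B. \<Sum>t\<in>{t \<in> slots B e. \<phi> t = b}. 1)"
    by (subst sum.group[OF finite_slots[OF assms(1)] assms(1) im]) simp
  also have "\<dots> = sum (occurrences B e \<phi>) B"
    unfolding occurrences_def by (rule sum.cong) auto
  finally show "sum (occurrences B e \<phi>) B = sum e B" using card_slots[OF assms(1)] by simp
qed

text \<open>
  The relation \<open>le\<close> is \<open>\<le>\<close> for the graded and \<open>\<ge>\<close> for the ungraded parking space, so that
  a carry lowers, respectively raises the degree.
\<close>

locale monomial_filtration =
  fixes B :: "'b set" and p :: nat and z :: "'b \<Rightarrow> ('m::comm_monoid_add \<Rightarrow>\<^sub>0 'k::field)"
    and J :: "('m \<Rightarrow>\<^sub>0 'k) set" and le lt :: "nat \<Rightarrow> nat \<Rightarrow> bool"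
  assumes finite_B: "finite B"
    and J: "pm.subspace J" "\<And>x y. x \<in> J \<Longrightarrow> x * y \<in> J"
    and le_refl: "\<And>a. le a a" and le_add: "\<And>a b c d. le a b \<Longrightarrow> le c d \<Longrightarrow> le (a + c) (b + d)"
    and lt_add: "\<And>a b c d. lt a b \<Longrightarrow> le c d \<Longrightarrow> lt (a + c) (b + d)"
    and lt_le: "\<And>a b. lt a b \<Longrightarrow> le a b" and le_lt_trans: "\<And>a b c. le a b \<Longrightarrow> lt b c \<Longrightarrow> lt a c"
    and lt_irrefl: "\<And>a. \<not> lt a a"
    and carry: "\<And>b. b \<in> B \<Longrightarrow> z b ^ p \<in> pm.span ({gmon B z f | f. lt (sum f B) p} \<union> J)"
    and reduce: "\<And>f. gmon B z f \<in>
      pm.span ({gmon B z e | e. e \<in> B \<rightarrow>\<^sub>E {..<p} \<and> le (sum e B) (sum f B)} \<union> J)"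
begin

definition U where "U s = pm.span ({gmon B z f | f. le (sum f B) s} \<union> J)"
definition L where "L s = pm.span ({gmon B z f | f. lt (sum f B) s} \<union> J)"

lemma subspace_U: "pm.subspace (U s)" and subspace_L: "pm.subspace (L s)"
  unfolding U_def L_def by (rule pm.subspace_span)+

lemma L_subset_U: "L s \<subseteq> U s"
  unfolding L_def U_def by (rule pm.span_mono) (use lt_le in blast)

lemma gmon_span_mult:
  assumes "x \<in> pm.span ({gmon B z f | f. P (sum f B)} \<union> J)"
    and "y \<in> pm.span ({gmon B z f | f. Q (sum f B)} \<union> J)"
    and PQ: "\<And>a b. P a \<Longrightarrow> Q b \<Longrightarrow> R (a + b)"
  shows "x * y \<in> pm.span ({gmon B z f | f. R (sum f B)} \<union> J)"
proof (rule span_mult[OF assms(1,2)])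
  fix a b assume a: "a \<in> {gmon B z f | f. P (sum f B)} \<union> J" and b: "b \<in> {gmon B z f | f. Q (sum f B)} \<union> J"
  show "a * b \<in> pm.span ({gmon B z f | f. R (sum f B)} \<union> J)"
  proof (cases "a \<in> J \<or> b \<in> J")
    case True
    then have "a * b \<in> J" using J(2) by (metis mult.commute)
    then show ?thesis by (intro pm.span_base) blast
  next
    case False
    then obtain f g where fg: "a = gmon B z f" "b = gmon B z g" "P (sum f B)" "Q (sum g B)"
      using a b by blast
    then have "R (sum (\<lambda>b. f b + g b) B)" by (simp add: sum.distrib PQ)
    then show ?thesis unfolding fg gmon_add by (intro pm.span_base) blast
  qed
qed

lemma mult_U: "x \<in> U s \<Longrightarrow> y \<in> U t \<Longrightarrow> x * y \<in> U (s + t)"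
  unfolding U_def
  by (rule gmon_span_mult[where P = "\<lambda>a. le a s" and Q = "\<lambda>a. le a t"]) (auto intro: le_add)

lemma mult_L: "x \<in> L s \<Longrightarrow> y \<in> U t \<Longrightarrow> x * y \<in> L (s + t)"
  unfolding U_def L_def
  by (rule gmon_span_mult[where P = "\<lambda>a. lt a s" and Q = "\<lambda>a. le a t"]) (auto intro: lt_add)

lemma gmon_mem_U: "gmon B z f \<in> U (sum f B)"
  unfolding U_def by (intro pm.span_base) (use le_refl in blast)

text \<open>Split off \<open>z b ^ p\<close>: the carry puts it into \<open>L p\<close>, and
  multiplication by the remaining monomial preserves strictness of the degree.\<close>

lemma gmon_mem_L:
  assumes "b \<in> B" "p \<le> f b"
  shows "gmon B z f \<in> L (sum f B)"
proof -
  define g where "g = (\<lambda>c. if c = b then p else 0)"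
  have f: "f = (\<lambda>c. g c + (f c - g c))" using assms by (auto simp: g_def fun_eq_iff)
  have "gmon B z g = z b ^ p" unfolding g_def using finite_B assms(1) by (rule gmon_single)
  then have "gmon B z g \<in> L p" using carry[OF assms(1)] unfolding L_def by simp
  from mult_L[OF this gmon_mem_U[of "\<lambda>c. f c - g c"]]
  have "gmon B z f \<in> L (p + sum (\<lambda>c. f c - g c) B)" unfolding gmon_add f[symmetric] .
  moreover have "sum g B = p" unfolding g_def using finite_B assms(1) by simp
  then have "sum f B = p + sum (\<lambda>c. f c - g c) B" using arg_cong[OF f, of "\<lambda>f. sum f B"] by (simp add: sum.distrib)
  ultimately show ?thesis by simp
qed

lemma L_eq_span_reduced: "L s = pm.span ({gmon B z e | e. e \<in> B \<rightarrow>\<^sub>E {..<p} \<and> lt (sum e B) s} \<union> J)"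
proof
  show "L s \<subseteq> pm.span ({gmon B z e | e. e \<in> B \<rightarrow>\<^sub>E {..<p} \<and> lt (sum e B) s} \<union> J)"
    unfolding L_def
  proof (rule pm.span_minimal[OF _ pm.subspace_span], clarsimp, intro conjI allI impI subsetI; (clarify)?)
    fix x f assume "lt (sum f B) s"
    have "pm.span ({gmon B z e | e. e \<in> B \<rightarrow>\<^sub>E {..<p} \<and> le (sum e B) (sum f B)} \<union> J) \<subseteq>
        pm.span ({gmon B z e | e. e \<in> B \<rightarrow>\<^sub>E {..<p} \<and> lt (sum e B) s} \<union> J)"
      by (rule pm.span_mono) (use le_lt_trans[OF _ \<open>lt _ s\<close>] in blast)
    then show "gmon B z f \<in> pm.span ({gmon B z e | e. e \<in> B \<rightarrow>\<^sub>E {..<p} \<and> lt (sum e B) s} \<union> J)"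
      using reduce by blast
  next
    fix x assume "x \<in> J"
    then show "x \<in> pm.span ({gmon B z e | e. e \<in> B \<rightarrow>\<^sub>E {..<p} \<and> lt (sum e B) s} \<union> J)"
      by (intro pm.span_base) blast
  qed
  show "pm.span ({gmon B z e | e. e \<in> B \<rightarrow>\<^sub>E {..<p} \<and> lt (sum e B) s} \<union> J) \<subseteq> L s"
    unfolding L_def by (rule pm.span_mono) blast
qed

lemma finite_exponents: "finite (B \<rightarrow>\<^sub>E {..<p})"
  using finite_B by (intro finite_PiE) auto

lemma span_combination:
  assumes "x \<in> pm.span ({gmon B z e | e. e \<in> B \<rightarrow>\<^sub>E {..<p} \<and> P e} \<union> J)"
  shows "\<exists>d. (\<forall>e. \<not> P e \<longrightarrow> d e = 0) \<and> x - (\<Sum>e\<in>B \<rightarrow>\<^sub>E {..<p}. pscale (d e) (gmon B z e)) \<in> J"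
  using assms
proof (induction rule: pm.span_induct_alt)
  case base
  then show ?case using pm.subspace_0[OF J(1)] by (intro exI[of _ "\<lambda>_. 0"]) simp
next
  case (step c a x)
  let ?S = "\<lambda>d. \<Sum>e\<in>B \<rightarrow>\<^sub>E {..<p}. pscale (d e) (gmon B z e)"
  from step obtain d where d: "\<forall>e. \<not> P e \<longrightarrow> d e = 0" "x - ?S d \<in> J" by blast
  show ?case
  proof (cases "a \<in> J")
    case True
    have "pscale c a + (x - ?S d) \<in> J"
      using True d(2) by (intro pm.subspace_add[OF J(1)] pm.subspace_scale[OF J(1)])
    then show ?thesis using d(1) by (intro exI[of _ d]) (simp add: algebra_simps)
  next
    case False
    then obtain e where e: "a = gmon B z e" "e \<in> B \<rightarrow>\<^sub>E {..<p}" "P e" using step.hyps by blast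
    have "?S (\<lambda>f. d f + (if f = e then c else 0)) =
        (\<Sum>f\<in>B \<rightarrow>\<^sub>E {..<p}. pscale (d f) (gmon B z f) + (if f = e then pscale c (gmon B z e) else 0))"
      by (rule sum.cong) (simp_all add: pm.scale_left_distrib)
    also have "\<dots> = ?S d + pscale c a"
      using e finite_exponents by (simp add: sum.distrib)
    finally have "pscale c a + x - ?S (\<lambda>f. d f + (if f = e then c else 0)) = x - ?S d" by simp
    then have "pscale c a + x - ?S (\<lambda>f. d f + (if f = e then c else 0)) \<in> J" using d(2) by (simp only:)
    moreover have "\<forall>f. \<not> P f \<longrightarrow> d f + (if f = e then c else 0) = 0" using d(1) e(3) by auto
    ultimately show ?thesis by (intro exI[of _ "\<lambda>f. d f + (if f = e then c else 0)"] conjI)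
  qed
qed

text \<open>The leading part of the action depends on \<open>G\<close> only, not on the ring or the filtration.\<close>

lemma action_leading_term:
  assumes \<rho>: "\<rho> 1 = 1" "\<And>x y. \<rho> (x * y) = \<rho> x * \<rho> y"
    and gen: "\<And>b. b \<in> B \<Longrightarrow> \<rho> (z b) - (\<Sum>c\<in>B. pscale (G b c) (z c)) \<in> L 1"
  shows "\<rho> (gmon B z e) - (\<Sum>f\<in>{f \<in> B \<rightarrow>\<^sub>E {..<p}. sum f B = sum e B}.
    pscale (expansion_coeff B G e f) (gmon B z f)) \<in> L (sum e B)"
proof -
  let ?T = "slots B e" and ?g = "\<lambda>\<phi>. \<Prod>t\<in>slots B e. G (fst t) (\<phi> t)"
  let ?E = "{f \<in> B \<rightarrow>\<^sub>E {..<p}. sum f B = sum e B}" and ?o = "occurrences B e"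
  have \<rho>_prod: "\<rho> (\<Prod>i\<in>I. x i) = (\<Prod>i\<in>I. \<rho> (x i))" if "finite I" for I :: "('b \<times> nat) set" and x
    using that by (induction I) (simp_all add: \<rho>)
  note fin = finite_slots[OF finite_B, of e]
  have z1: "z b \<in> U 1" if "b \<in> B" for b
    using gmon_mem_U[of "\<lambda>c. if c = b then 1 else 0"] gmon_single[OF finite_B that, of z 1] finite_B that
    by simp
  have fst: "fst t \<in> B" if "t \<in> ?T" for t using that by (auto simp: slots_def)
  \<comment> \<open>Slot by slot, \<open>\<rho> (z b)\<close> is replaced by its linear
    part.\<close>
  have "\<rho> (gmon B z e) - (\<Prod>t\<in>?T. \<Sum>c\<in>B. pscale (G (fst t) c) (z c)) \<in> L (card ?T)"
    unfolding gmon_slots[OF finite_B] \<rho>_prod[OF fin]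
    by (rule prod_diff_mem[where U = U, THEN conjunct2])
      (use subspace_U subspace_L L_subset_U mult_U mult_L gmon_mem_U[of "\<lambda>_. 0"] fin z1 gen fst
        in \<open>auto simp: gmon_def intro!: pm.subspace_sum pm.subspace_scale\<close>)
  then have 1: "\<rho> (gmon B z e) - (\<Prod>t\<in>?T. \<Sum>c\<in>B. pscale (G (fst t) c) (z c)) \<in> L (sum e B)"
    by (simp add: card_slots finite_B)
  have finPi: "finite (?T \<rightarrow>\<^sub>E B)" using fin finite_B by (intro finite_PiE) auto
  have "(\<Prod>t\<in>?T. \<Sum>c\<in>B. pscale (G (fst t) c) (z c)) =
      (\<Sum>\<phi>\<in>?T \<rightarrow>\<^sub>E B. \<Prod>t\<in>?T. pscale (G (fst t) (\<phi> t)) (z (\<phi> t)))"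
    by (rule prod_sum_PiE) (use fin finite_B in auto)
  also have "\<dots> = (\<Sum>\<phi>\<in>?T \<rightarrow>\<^sub>E B. pscale (?g \<phi>) (gmon B z (?o \<phi>)))"
    by (rule sum.cong) (simp_all add: prod_pscale gmon_occurrences(1)[OF finite_B])
  \<comment> \<open>Choices whose monomial is reduced are separated from those with an exponent of
    at least \<open>p\<close>. The former give the leading term, the latter fall into
    \<open>L\<close> although their degree is right.\<close>
  also have "\<dots> = (\<Sum>\<phi>\<in>{\<phi> \<in> ?T \<rightarrow>\<^sub>E B. ?o \<phi> \<in> ?E}. pscale (?g \<phi>) (gmon B z (?o \<phi>))) +
      (\<Sum>\<phi>\<in>{\<phi> \<in> ?T \<rightarrow>\<^sub>E B. ?o \<phi> \<notin> ?E}. pscale (?g \<phi>) (gmon B z (?o \<phi>)))"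
    by (subst sum.union_disjoint[symmetric]) (auto simp: finPi intro!: sum.cong)
  also have "(\<Sum>\<phi>\<in>{\<phi> \<in> ?T \<rightarrow>\<^sub>E B. ?o \<phi> \<in> ?E}. pscale (?g \<phi>) (gmon B z (?o \<phi>))) =
      (\<Sum>f\<in>?E. \<Sum>\<phi>\<in>{\<phi> \<in> {\<phi> \<in> ?T \<rightarrow>\<^sub>E B. ?o \<phi> \<in> ?E}. ?o \<phi> = f}. pscale (?g \<phi>) (gmon B z (?o \<phi>)))"
    by (rule sum.group[symmetric]) (auto simp: finPi finite_exponents)
  also have "\<dots> = (\<Sum>f\<in>?E. pscale (expansion_coeff B G e f) (gmon B z f))"
  proof (rule sum.cong[OF refl])
    fix f assume f: "f \<in> ?E"
    have "{\<phi> \<in> {\<phi> \<in> ?T \<rightarrow>\<^sub>E B. ?o \<phi> \<in> ?E}. ?o \<phi> = f} = {\<phi> \<in> ?T \<rightarrow>\<^sub>E B. ?o \<phi> = f}" using f by blast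
    then show "(\<Sum>\<phi>\<in>{\<phi> \<in> {\<phi> \<in> ?T \<rightarrow>\<^sub>E B. ?o \<phi> \<in> ?E}. ?o \<phi> = f}. pscale (?g \<phi>) (gmon B z (?o \<phi>))) =
        pscale (expansion_coeff B G e f) (gmon B z f)"
      by (simp add: expansion_coeff_def pm.scale_sum_left)
  qed
  finally have 2: "(\<Prod>t\<in>?T. \<Sum>c\<in>B. pscale (G (fst t) c) (z c)) =
      (\<Sum>f\<in>?E. pscale (expansion_coeff B G e f) (gmon B z f)) +
      (\<Sum>\<phi>\<in>{\<phi> \<in> ?T \<rightarrow>\<^sub>E B. ?o \<phi> \<notin> ?E}. pscale (?g \<phi>) (gmon B z (?o \<phi>)))" .
  have 3: "(\<Sum>\<phi>\<in>{\<phi> \<in> ?T \<rightarrow>\<^sub>E B. ?o \<phi> \<notin> ?E}. pscale (?g \<phi>) (gmon B z (?o \<phi>))) \<in> L (sum e B)"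
  proof (intro pm.subspace_sum[OF subspace_L] pm.subspace_scale[OF subspace_L])
    fix \<phi> assume "\<phi> \<in> {\<phi> \<in> ?T \<rightarrow>\<^sub>E B. ?o \<phi> \<notin> ?E}"
    then have \<phi>: "\<phi> \<in> ?T \<rightarrow>\<^sub>E B" "?o \<phi> \<notin> ?E" by auto
    note deg = gmon_occurrences(2)[OF finite_B \<phi>(1)]
    have "?o \<phi> \<notin> B \<rightarrow>\<^sub>E {..<p}" using \<phi>(2) deg by simp
    then obtain b where "b \<in> B" "p \<le> ?o \<phi> b" unfolding occurrences_def by (auto simp: PiE_def Pi_def not_less)
    then show "gmon B z (?o \<phi>) \<in> L (sum e B)" using gmon_mem_L[of b "?o \<phi>"] deg by simp
  qed
  have 4: "\<rho> (gmon B z e) - (\<Sum>f\<in>?E. pscale (expansion_coeff B G e f) (gmon B z f)) =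
      (\<rho> (gmon B z e) - (\<Prod>t\<in>?T. \<Sum>c\<in>B. pscale (G (fst t) c) (z c))) +
      (\<Sum>\<phi>\<in>{\<phi> \<in> ?T \<rightarrow>\<^sub>E B. ?o \<phi> \<notin> ?E}. pscale (?g \<phi>) (gmon B z (?o \<phi>)))"
    unfolding 2 by simp
  show ?thesis unfolding 4 by (rule pm.subspace_add[OF subspace_L 1 3])
qed

definition lift :: "('e::finite \<Rightarrow> 'b \<Rightarrow> nat) \<Rightarrow> 'k ^ 'e \<Rightarrow> ('m \<Rightarrow>\<^sub>0 'k)" where
  "lift \<eta> c = (\<Sum>e\<in>UNIV. pscale (c $ e) (gmon B z (\<eta> e)))"

lemma action_matrix:
  fixes \<eta> :: "'e::finite \<Rightarrow> 'b \<Rightarrow> nat"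
  assumes \<eta>: "bij_betw \<eta> UNIV (B \<rightarrow>\<^sub>E {..<p})"
    and \<rho>: "\<rho> 1 = 1" "\<And>x y. \<rho> (x * y) = \<rho> x * \<rho> y" "\<And>x y. \<rho> (x + y) = \<rho> x + \<rho> y"
      "\<And>a x. \<rho> (pscale a x) = pscale a (\<rho> x)"
    and gen: "\<And>b. b \<in> B \<Longrightarrow> \<rho> (z b) - (\<Sum>c\<in>B. pscale (G b c) (z c)) \<in> L 1"
  shows "\<exists>A. leading_matrix B G \<eta> lt A \<and> (\<forall>c. \<rho> (lift \<eta> c) - lift \<eta> (A *v c) \<in> J)"
proof -
  let ?E = "B \<rightarrow>\<^sub>E {..<p}"
  have "\<exists>a. (\<forall>f. sum f B = sum e B \<longrightarrow> a f = expansion_coeff B G e f) \<and>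
      (\<forall>f. sum f B \<noteq> sum e B \<longrightarrow> \<not> lt (sum f B) (sum e B) \<longrightarrow> a f = 0) \<and>
      \<rho> (gmon B z e) - (\<Sum>f\<in>?E. pscale (a f) (gmon B z f)) \<in> J" for e
  proof -
    let ?F = "{f \<in> ?E. sum f B = sum e B}"
    from span_combination[OF action_leading_term[OF \<rho>(1,2) gen, of e, unfolded L_eq_span_reduced]]
    obtain d where d: "\<And>f. \<not> lt (sum f B) (sum e B) \<Longrightarrow> d f = 0"
      "\<rho> (gmon B z e) - (\<Sum>f\<in>?F. pscale (expansion_coeff B G e f) (gmon B z f)) -
        (\<Sum>f\<in>?E. pscale (d f) (gmon B z f)) \<in> J"
      by blast
    \<comment> \<open>The prescribed block plus the error. The error coefficients \<open>d\<close>
      vanish in equal degree because \<open>lt\<close> is irreflexive, so the block is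
      exact.\<close>
    define a where "a f = (if sum f B = sum e B then expansion_coeff B G e f else 0) + d f" for f
    have "(\<Sum>f\<in>?E. pscale (if sum f B = sum e B then expansion_coeff B G e f else 0) (gmon B z f)) =
        (\<Sum>f\<in>?F. pscale (expansion_coeff B G e f) (gmon B z f))"
      by (rule sum.mono_neutral_cong_right) (use finite_exponents in auto)
    then have "(\<Sum>f\<in>?E. pscale (a f) (gmon B z f)) =
        (\<Sum>f\<in>?F. pscale (expansion_coeff B G e f) (gmon B z f)) + (\<Sum>f\<in>?E. pscale (d f) (gmon B z f))"
      unfolding a_def by (simp add: pm.scale_left_distrib sum.distrib)
    then have "\<rho> (gmon B z e) - (\<Sum>f\<in>?E. pscale (a f) (gmon B z f)) \<in> J"
      using d(2) by (simp add: algebra_simps)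
    moreover have "a f = expansion_coeff B G e f" if "sum f B = sum e B" for f
      unfolding a_def using that d(1)[of f] lt_irrefl by simp
    moreover have "a f = 0" if "sum f B \<noteq> sum e B" "\<not> lt (sum f B) (sum e B)" for f
      unfolding a_def using that d(1)[of f] by simp
    ultimately show ?thesis by blast
  qed
  then obtain a where "\<forall>e. (\<forall>f. sum f B = sum e B \<longrightarrow> a e f = expansion_coeff B G e f) \<and>
      (\<forall>f. sum f B \<noteq> sum e B \<longrightarrow> \<not> lt (sum f B) (sum e B) \<longrightarrow> a e f = 0) \<and>
      \<rho> (gmon B z e) - (\<Sum>f\<in>?E. pscale (a e f) (gmon B z f)) \<in> J"
    using choice[where Q = "\<lambda>e a. (\<forall>f. sum f B = sum e B \<longrightarrow> a f = expansion_coeff B G e f) \<and>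
      (\<forall>f. sum f B \<noteq> sum e B \<longrightarrow> \<not> lt (sum f B) (sum e B) \<longrightarrow> a f = 0) \<and>
      \<rho> (gmon B z e) - (\<Sum>f\<in>?E. pscale (a f) (gmon B z f)) \<in> J"] by blast
  then have a: "\<And>e f. sum f B = sum e B \<Longrightarrow> a e f = expansion_coeff B G e f"
    "\<And>e f. sum f B \<noteq> sum e B \<Longrightarrow> \<not> lt (sum f B) (sum e B) \<Longrightarrow> a e f = 0"
    "\<And>e. \<rho> (gmon B z e) - (\<Sum>f\<in>?E. pscale (a e f) (gmon B z f)) \<in> J" by blast+
  define A :: "'k ^ 'e ^ 'e" where "A = (\<chi> f e. a (\<eta> e) (\<eta> f))"
  have \<rho>_sum: "\<rho> (\<Sum>i\<in>I. x i) = (\<Sum>i\<in>I. \<rho> (x i))" for I :: "'e set" and x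
  proof -
    have "\<rho> 0 = 0" using \<rho>(3)[of 0 0] by simp
    then show ?thesis by (induction I rule: infinite_finite_induct) (simp_all add: \<rho>(3))
  qed
  have "\<rho> (lift \<eta> c) - lift \<eta> (A *v c) \<in> J" for c
  proof -
    have "lift \<eta> (A *v c) =
        (\<Sum>f\<in>UNIV. \<Sum>e\<in>UNIV. pscale (c $ e) (pscale (a (\<eta> e) (\<eta> f)) (gmon B z (\<eta> f))))"
      unfolding lift_def by (simp add: matrix_vector_mult_def A_def pm.scale_sum_left mult.commute)
    also have "\<dots> = (\<Sum>e\<in>UNIV. pscale (c $ e) (\<Sum>f\<in>UNIV. pscale (a (\<eta> e) (\<eta> f)) (gmon B z (\<eta> f))))"
      unfolding pm.scale_sum_right by (rule sum.swap)
    also have "\<dots> = (\<Sum>e\<in>UNIV. pscale (c $ e) (\<Sum>f\<in>?E. pscale (a (\<eta> e) f) (gmon B z f)))"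
      by (simp add: sum.reindex_bij_betw[OF \<eta>, of "\<lambda>f. pscale (a _ f) (gmon B z f)"])
    finally have eq: "\<rho> (lift \<eta> c) - lift \<eta> (A *v c) = (\<Sum>e\<in>UNIV. pscale (c $ e)
        (\<rho> (gmon B z (\<eta> e)) - (\<Sum>f\<in>?E. pscale (a (\<eta> e) f) (gmon B z f))))"
      unfolding lift_def by (simp add: \<rho>_sum \<rho>(4) pm.scale_right_diff_distrib sum_subtractf)
    show ?thesis
      unfolding eq by (intro pm.subspace_sum[OF J(1)] pm.subspace_scale[OF J(1)] a(3))
  qed
  then show ?thesis using a(1,2) by (intro exI[of _ A]) (simp add: A_def leading_matrix_def)
qed

end

section \<open>The graded parking space\<close>

subsection \<open>Extensions from monomials\<close>

text \<open>Common form of the substitution \<open>msubst\<close> and of the action on a permutation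
  module. When \<open>F v 0 = 0\<close> and \<open>F v\<close> is additive, the sum over the support
  behaves additively although supports can shrink.\<close>

definition linear_extension ::
  "('m \<Rightarrow> 'c::zero \<Rightarrow> 'r::comm_monoid_add) \<Rightarrow> ('m \<Rightarrow>\<^sub>0 'c) \<Rightarrow> 'r" where
  "linear_extension F p = (\<Sum>v\<in>Poly_Mapping.keys p. F v (Poly_Mapping.lookup p v))"

lemma linear_extension_add:
  assumes "\<And>v. F v 0 = 0" "\<And>v x y. F v (x + y) = F v x + F v y"
  shows "linear_extension F (p + q) = linear_extension F p + linear_extension F q"
  unfolding linear_extension_def by (rule setsum_keys_plus_distrib) (use assms in auto)

lemma linear_extension_single:
  assumes "\<And>v. F v 0 = 0"
  shows "linear_extension F (Poly_Mapping.single v x) = F v x"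
  using assms by (cases "x = 0") (simp_all add: linear_extension_def)

lemma poly_mapping_sum_single:
  "p = (\<Sum>v\<in>Poly_Mapping.keys p. Poly_Mapping.single v (Poly_Mapping.lookup p v))"
  by (rule poly_mapping_eqI)
    (simp add: lookup_sum lookup_single when_def in_keys_iff)

lemma linear_extension_sum:
  assumes "\<And>v. F v 0 = 0" "\<And>v x y. F v (x + y) = F v x + F v y"
  shows "linear_extension F (\<Sum>i\<in>I. p i) = (\<Sum>i\<in>I. linear_extension F (p i))"
proof -
  have "linear_extension F 0 = 0" by (simp add: linear_extension_def)
  then show ?thesis
    by (induction I rule: infinite_finite_induct) (simp_all add: linear_extension_add assms)
qed

lemma linear_extension_mult:
  fixes F :: "'m::comm_monoid_add \<Rightarrow> 'c::semiring_0 \<Rightarrow> 'r::semiring_0"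
  assumes F: "\<And>v. F v 0 = 0" "\<And>v x y. F v (x + y) = F v x + F v y"
    and mult: "\<And>u v x y. F (u + v) (x * y) = F u x * F v y"
  shows "linear_extension F (p * q) = linear_extension F p * linear_extension F q"
proof -
  have "p * q = (\<Sum>u\<in>Poly_Mapping.keys p. \<Sum>v\<in>Poly_Mapping.keys q.
      Poly_Mapping.single (u + v) (Poly_Mapping.lookup p u * Poly_Mapping.lookup q v))"
    by (subst poly_mapping_sum_single[of p], subst poly_mapping_sum_single[of q])
      (simp add: sum_product mult_single)
  then have "linear_extension F (p * q) = (\<Sum>u\<in>Poly_Mapping.keys p. \<Sum>v\<in>Poly_Mapping.keys q.
      F u (Poly_Mapping.lookup p u) * F v (Poly_Mapping.lookup q v))"
    by (simp add: linear_extension_sum F linear_extension_single mult)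
  then show ?thesis by (simp add: linear_extension_def sum_product)
qed

lemma CHAR_poly_mapping: "CHAR('m::comm_monoid_add \<Rightarrow>\<^sub>0 'k::field) = CHAR('k)"
proof (rule CHAR_eqI)
  have *: "of_nat n = (0 :: 'm \<Rightarrow>\<^sub>0 'k) \<longleftrightarrow> of_nat n = (0 :: 'k)" for n
  proof
    assume "of_nat n = (0 :: 'm \<Rightarrow>\<^sub>0 'k)"
    then have "Poly_Mapping.lookup (of_nat n :: 'm \<Rightarrow>\<^sub>0 'k) 0 = 0" by simp
    then show "of_nat n = (0 :: 'k)" by (simp add: lookup_of_nat)
  next
    assume "of_nat n = (0 :: 'k)"
    then have "Poly_Mapping.single (0 :: 'm) (of_nat n :: 'k) = 0" by simp
    then show "of_nat n = (0 :: 'm \<Rightarrow>\<^sub>0 'k)" by simp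
  qed
  show "of_nat CHAR('k) = (0 :: 'm \<Rightarrow>\<^sub>0 'k)" unfolding * by simp
  show "CHAR('k) dvd n" if "of_nat n = (0 :: 'm \<Rightarrow>\<^sub>0 'k)" for n
    using that unfolding * by (simp add: of_nat_eq_0_iff_char_dvd)
qed

subsection \<open>Substitution homomorphisms\<close>

lemma mconst_mult: "mconst (a * b) = mconst a * mconst b"
  by (simp add: mconst_def mult_single)

lemma mconst_add: "mconst (a + b) = mconst a + mconst b"
  by (simp add: mconst_def single_add)

lemma mconst_0 [simp]: "mconst 0 = 0" and mconst_1 [simp]: "mconst 1 = 1"
  by (simp_all add: mconst_def)

lemma mconst_mult_eq_pscale: "mconst a * q = pscale a q"
  by (simp add: mconst_def pscale_def)

lemma mconst_sum: "mconst (\<Sum>i\<in>I. a i) = (\<Sum>i\<in>I. mconst (a i))"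
  by (induction I rule: infinite_finite_induct) (simp_all add: mconst_add)

context
  fixes \<sigma> :: "'n::finite \<Rightarrow> ('n, 'k::field) mpoly"
begin

private definition F where "F \<alpha> c = mconst c * (\<Prod>i\<in>UNIV. \<sigma> i ^ Poly_Mapping.lookup \<alpha> i)"

private lemma F: "F v 0 = 0" "F v (x + y) = F v x + F v y" "F (u + v) (x * y) = F u x * F v y"
  by (simp_all add: F_def mconst_add mconst_mult lookup_add power_add prod.distrib algebra_simps)

private lemma msubst_eq: "msubst \<sigma> = linear_extension F"
  by (simp add: fun_eq_iff msubst_def linear_extension_def F_def)

lemma msubst_add: "msubst \<sigma> (p + q) = msubst \<sigma> p + msubst \<sigma> q"
  unfolding msubst_eq by (rule linear_extension_add) (rule F)+

lemma msubst_mult: "msubst \<sigma> (p * q) = msubst \<sigma> p * msubst \<sigma> q"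
  unfolding msubst_eq by (rule linear_extension_mult) (rule F)+

lemma msubst_single:
  "msubst \<sigma> (Poly_Mapping.single \<alpha> c) = mconst c * (\<Prod>i\<in>UNIV. \<sigma> i ^ Poly_Mapping.lookup \<alpha> i)"
  unfolding msubst_eq by (subst linear_extension_single) (auto simp: F F_def)

lemma msubst_const [simp]: "msubst \<sigma> (mconst c) = mconst c"
  using msubst_single[of 0 c] by (simp add: mconst_def)

lemma msubst_1 [simp]: "msubst \<sigma> 1 = 1"
  using msubst_const[of 1] by simp

lemma msubst_var [simp]: "msubst \<sigma> (mvar i) = \<sigma> i"
  unfolding mvar_def
  by (simp add: msubst_single lookup_single when_def if_distrib[of "\<lambda>k. _ ^ k"] prod.delta' cong: if_cong)

end

lemma msubst_pscale: "msubst \<sigma> (pscale a q) = pscale a (msubst \<sigma> q)"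
  unfolding mconst_mult_eq_pscale[symmetric] by (simp add: msubst_mult)

lemma single_power: "Poly_Mapping.single \<alpha> (1::'k::field) ^ k = Poly_Mapping.single (\<Sum>i<k. \<alpha>) 1"
  by (induction k) (simp_all add: mult_single add.commute)

lemma mvar_power: "mvar i ^ k = (Poly_Mapping.single (Poly_Mapping.single i k) 1 :: ('n, 'k::field) mpoly)"
proof (induction k)
  case (Suc k)
  then show ?case by (simp add: mvar_def mult_single single_add[symmetric])
qed simp

lemma prod_single_1:
  "(\<Prod>i\<in>I. Poly_Mapping.single (\<alpha> i) (1::'k::field)) = Poly_Mapping.single (\<Sum>i\<in>I. \<alpha> i) 1"
  by (induction I rule: infinite_finite_induct) (simp_all add: mult_single)

lemma sum_single_lookup:
  fixes \<alpha> :: "'n::finite \<Rightarrow>\<^sub>0 nat"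
  shows "(\<Sum>i\<in>UNIV. Poly_Mapping.single i (Poly_Mapping.lookup \<alpha> i)) = \<alpha>"
  by (rule poly_mapping_eqI) (simp add: lookup_sum lookup_single when_def)

text \<open>Universal property of the polynomial ring. It yields the composition law of
  substitutions by comparing values on variables.\<close>

lemma hom_eq_msubst:
  fixes f :: "('n::finite, 'k::field) mpoly \<Rightarrow> ('n, 'k) mpoly"
  assumes add: "\<And>p q. f (p + q) = f p + f q" and mult: "\<And>p q. f (p * q) = f p * f q"
    and const: "\<And>c. f (mconst c) = mconst c"
  shows "f p = msubst (\<lambda>i. f (mvar i)) p"
proof -
  have f1: "f 1 = 1" using const[of 1] by simp
  have f0: "f 0 = 0" using const[of 0] by simp
  have power: "f (x ^ k) = f x ^ k" for x k by (induction k) (simp_all add: mult f1)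
  have prod: "f (\<Prod>i\<in>I. x i) = (\<Prod>i\<in>I. f (x i))" for I :: "'n set" and x
    by (induction I rule: infinite_finite_induct) (simp_all add: mult f1)
  have sum: "f (\<Sum>i\<in>I. x i) = (\<Sum>i\<in>I. f (x i))" for I :: "('n \<Rightarrow>\<^sub>0 nat) set" and x
    by (induction I rule: infinite_finite_induct) (simp_all add: add f0)
  have mono: "Poly_Mapping.single \<alpha> c = mconst c * (\<Prod>i\<in>UNIV. mvar i ^ Poly_Mapping.lookup \<alpha> i)"
    for \<alpha> :: "'n \<Rightarrow>\<^sub>0 nat" and c :: 'k
    by (simp add: mvar_power prod_single_1 sum_single_lookup mconst_def mult_single)
  have "f p = (\<Sum>\<alpha>\<in>Poly_Mapping.keys p. f (Poly_Mapping.single \<alpha> (Poly_Mapping.lookup p \<alpha>)))"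
    by (subst poly_mapping_sum_single[of p]) (simp add: sum)
  also have "\<dots> = msubst (\<lambda>i. f (mvar i)) p"
    unfolding msubst_def mono mult const prod power ..
  finally show ?thesis .
qed

lemma msubst_msubst: "msubst \<sigma> (msubst \<tau> p) = msubst (\<lambda>i. msubst \<sigma> (\<tau> i)) p"
  by (rule trans[OF hom_eq_msubst]) (simp_all add: msubst_add msubst_mult)

lemma msubst_mvar: "msubst mvar p = p"
  by (rule hom_eq_msubst[where f = "\<lambda>p. p", symmetric]) simp_all

lemma msubst_sum: "msubst \<sigma> (\<Sum>i\<in>I. x i) = (\<Sum>i\<in>I. msubst \<sigma> (x i))"
proof -
  have "msubst \<sigma> 0 = 0" using msubst_const[of \<sigma> 0] by simp
  then show ?thesis by (induction I rule: infinite_finite_induct) (simp_all add: msubst_add)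
qed

lemma msubst_power: "msubst \<sigma> (x ^ k) = msubst \<sigma> x ^ k"
  by (induction k) (simp_all add: msubst_mult)

lemma ring_hom_type_algebraD:
  assumes "j \<in> ring_hom ring_of_type_algebra ring_of_type_algebra"
  shows "j (x + y) = j x + j y" "j (x * y) = j x * j y" "j 1 = 1" "j 0 = 0"
proof -
  show "j (x + y) = j x + j y" "j (x * y) = j x * j y" "j 1 = 1" for x y
    using assms by (auto simp: ring_hom_def ring_of_type_algebra_def)
  from this(1)[of 0 0] show "j 0 = 0" by simp
qed

lemma hom_sum:
  assumes "\<And>x y. j (x + y) = j x + j y" "j 0 = 0"
  shows "j (\<Sum>i\<in>I. x i) = (\<Sum>i\<in>I. j (x i))"
  by (induction I rule: infinite_finite_induct) (simp_all add: assms)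

lemma GL_poly_act_mat_1:
  fixes j :: "'a::field \<Rightarrow> 'k::field" and p :: "('n::finite, 'k) mpoly"
  assumes "j \<in> ring_hom ring_of_type_algebra ring_of_type_algebra"
  shows "GL_poly_act j (mat 1) p = p"
proof -
  have "(\<Sum>i\<in>UNIV. mconst (j (mat 1 $ i $ l)) * mvar i) = (mvar l :: ('n, 'k) mpoly)" for l :: 'n
  proof -
    have "(\<Sum>i\<in>UNIV. mconst (j (mat 1 $ i $ l)) * mvar i) =
        (\<Sum>i\<in>UNIV. if i = l then mvar l else (0 :: ('n, 'k) mpoly))"
      by (rule sum.cong) (auto simp: mat_def ring_hom_type_algebraD[OF assms])
    then show ?thesis by simp
  qed
  then show ?thesis by (simp add: GL_poly_act_def msubst_mvar)
qed

lemma GL_poly_act_mult: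
  assumes "j \<in> ring_hom ring_of_type_algebra ring_of_type_algebra"
  shows "GL_poly_act j (g ** h) p = GL_poly_act j g (GL_poly_act j h p)"
proof -
  note j = ring_hom_type_algebraD[OF assms]
  have "(\<Sum>i\<in>UNIV. mconst (j ((g ** h) $ i $ l)) * mvar i) =
      msubst (\<lambda>l. \<Sum>i\<in>UNIV. mconst (j (g $ i $ l)) * mvar i)
        (\<Sum>t\<in>UNIV. mconst (j (h $ t $ l)) * mvar t)" for l
  proof -
    have "msubst (\<lambda>l. \<Sum>i\<in>UNIV. mconst (j (g $ i $ l)) * mvar i)
        (\<Sum>t\<in>UNIV. mconst (j (h $ t $ l)) * mvar t) =
      (\<Sum>t\<in>UNIV. \<Sum>i\<in>UNIV. mconst (j (g $ i $ t) * j (h $ t $ l)) * mvar i)"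
      by (simp add: msubst_sum msubst_mult sum_distrib_left mconst_mult mult_ac)
    also have "\<dots> = (\<Sum>i\<in>UNIV. \<Sum>t\<in>UNIV. mconst (j (g $ i $ t) * j (h $ t $ l)) * mvar i)"
      by (rule sum.swap)
    also have "\<dots> = (\<Sum>i\<in>UNIV. mconst (j ((g ** h) $ i $ l)) * mvar i)"
      by (simp add: matrix_matrix_mult_def hom_sum[OF j(1,4)] j(2) mconst_sum sum_distrib_right)
    finally show ?thesis by simp
  qed
  then show ?thesis unfolding GL_poly_act_def msubst_msubst by simp
qed

subsection \<open>The truncation ideal\<close>

lemma ring_type_algebra_simps [simp]:
  "\<zero>\<^bsub>ring_of_type_algebra\<^esub> = 0" "\<one>\<^bsub>ring_of_type_algebra\<^esub> = 1"
  "x \<oplus>\<^bsub>ring_of_type_algebra\<^esub> y = x + y" "x \<otimes>\<^bsub>ring_of_type_algebra\<^esub> y = x * y"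
  by (simp_all add: ring_of_type_algebra_def)

lemma a_inv_type_algebra: "\<ominus>\<^bsub>ring_of_type_algebra\<^esub> x = - (x :: 'a::comm_ring_1)"
proof -
  interpret cring "ring_of_type_algebra :: 'a ring" by (rule cring_from_type_algebra)
  show ?thesis by (rule minus_equality) simp_all
qed

lemma ideal_type_algebra_iff:
  "ideal I (ring_of_type_algebra :: 'a::comm_ring_1 ring) \<longleftrightarrow>
    0 \<in> I \<and> (\<forall>x\<in>I. \<forall>y\<in>I. x + y \<in> I) \<and> (\<forall>x\<in>I. \<forall>y. x * y \<in> I)"
  (is "?L \<longleftrightarrow> ?R")
proof
  interpret cring "ring_of_type_algebra :: 'a ring" by (rule cring_from_type_algebra)
  show ?R if ?L
  proof -
    interpret I: ideal I "ring_of_type_algebra :: 'a ring" by fact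
    show ?R using I.zero_closed I.a_closed I.I_r_closed by simp
  qed
  show ?L if R: ?R
  proof (rule idealI)
    show "ring (ring_of_type_algebra :: 'a ring)" by (rule ring_axioms)
    have "- x \<in> I" if "x \<in> I" for x
      using R that by (metis mult.right_neutral mult_minus_right)
    then show "subgroup I (add_monoid (ring_of_type_algebra :: 'a ring))"
      using R by (intro add.subgroupI) (auto simp: a_inv_type_algebra simp flip: a_inv_def)
  qed (use R in \<open>auto simp: mult.commute\<close>)
qed

definition truncation_ideal :: "nat \<Rightarrow> ('n, 'k::field) mpoly set" where
  "truncation_ideal N = Idl\<^bsub>ring_of_type_algebra\<^esub> (\<Union>i. {mvar i ^ N})"

lemma truncation_ideal:
  fixes x y u :: "('n, 'k::field) mpoly"
  shows "0 \<in> (truncation_ideal N :: ('n, 'k) mpoly set)" "x \<in> truncation_ideal N \<Longrightarrow> y \<in> truncation_ideal N \<Longrightarrow> x + y \<in> truncation_ideal N"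
    and "x \<in> truncation_ideal N \<Longrightarrow> x * u \<in> truncation_ideal N"
    and "mvar i ^ N \<in> (truncation_ideal N :: ('n, 'k) mpoly set)"
proof -
  interpret cring "ring_of_type_algebra :: ('n, 'k) mpoly ring" by (rule cring_from_type_algebra)
  have "ideal (truncation_ideal N :: ('n, 'k) mpoly set) ring_of_type_algebra"
    unfolding truncation_ideal_def by (rule genideal_ideal) simp
  note I = this[unfolded ideal_type_algebra_iff]
  show "0 \<in> (truncation_ideal N :: ('n, 'k) mpoly set)" "x \<in> truncation_ideal N \<Longrightarrow> y \<in> truncation_ideal N \<Longrightarrow> x + y \<in> truncation_ideal N"
    "x \<in> truncation_ideal N \<Longrightarrow> x * u \<in> truncation_ideal N"
    using I by auto
  have "(\<Union>i. {mvar i ^ N}) \<subseteq> (truncation_ideal N :: ('n, 'k) mpoly set)"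
    unfolding truncation_ideal_def by (rule genideal_self) simp
  then show "mvar i ^ N \<in> (truncation_ideal N :: ('n, 'k) mpoly set)" by auto
qed

lemma truncation_ideal_minimal:
  assumes "0 \<in> I" "\<And>x y. x \<in> I \<Longrightarrow> y \<in> I \<Longrightarrow> x + y \<in> I" "\<And>x y. x \<in> I \<Longrightarrow> x * y \<in> I"
    and "\<And>i. mvar i ^ N \<in> I"
  shows "truncation_ideal N \<subseteq> (I :: ('n, 'k::field) mpoly set)"
proof -
  interpret cring "ring_of_type_algebra :: ('n, 'k) mpoly ring" by (rule cring_from_type_algebra)
  show ?thesis
    unfolding truncation_ideal_def
    by (rule genideal_minimal) (use assms in \<open>auto simp: ideal_type_algebra_iff\<close>)
qed

lemma subspace_truncation_ideal: "pm.subspace (truncation_ideal N)"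
  using truncation_ideal by (intro pm.subspaceI) (auto simp: pscale_def mult.commute)

text \<open>The polynomials whose monomials all have an exponent of at least \<open>N\<close> form
  an ideal that contains the generators.\<close>

lemma truncation_ideal_keys:
  fixes P :: "('n, 'k::field) mpoly"
  assumes "P \<in> truncation_ideal N" "\<alpha> \<in> Poly_Mapping.keys P"
  shows "\<exists>l. N \<le> Poly_Mapping.lookup \<alpha> l"
proof -
  define I :: "('n, 'k) mpoly set"
    where "I = {P. \<forall>\<alpha>\<in>Poly_Mapping.keys P. \<exists>l. N \<le> Poly_Mapping.lookup \<alpha> l}"
  have "truncation_ideal N \<subseteq> I"
  proof (rule truncation_ideal_minimal)
    show "0 \<in> I" by (simp add: I_def)
    show "x + y \<in> I" if "x \<in> I" "y \<in> I" for x y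
      using that Poly_Mapping.keys_add[of x y] unfolding I_def by blast
    show "x * y \<in> I" if "x \<in> I" for x y
      unfolding I_def
    proof clarify
      fix \<alpha> assume \<alpha>: "\<alpha> \<in> Poly_Mapping.keys (x * y)"
      obtain a b where ab: "\<alpha> = a + b" "a \<in> Poly_Mapping.keys x" using subsetD[OF keys_mult \<alpha>] by blast
      then obtain l where "N \<le> Poly_Mapping.lookup a l" using \<open>x \<in> I\<close> unfolding I_def by blast
      then show "\<exists>l. N \<le> Poly_Mapping.lookup \<alpha> l"
        unfolding ab by (intro exI[of _ l]) (simp add: lookup_add)
    qed
    show "mvar i ^ N \<in> I" for i
      unfolding I_def mvar_power by (auto intro!: exI[of _ i])
  qed
  then show ?thesis using assms unfolding I_def by blast
qed

subsection \<open>Digits\<close>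

lemma digit_sum_less:
  assumes "\<And>i. i < r \<Longrightarrow> d i < (p::nat)"
  shows "(\<Sum>i<r. p ^ i * d i) < p ^ r"
  using assms
proof (induction r)
  case (Suc r)
  then have "(\<Sum>i<r. p ^ i * d i) < p ^ r" by simp
  moreover have "p ^ r * d r + p ^ r \<le> p ^ r * p"
    using Suc.prems[of r] by (metis Suc_leI add.commute lessI mult_Suc_right mult_le_mono2)
  ultimately show ?case by (simp add: mult.commute)
qed simp

lemma digit_sum_inj:
  assumes "\<And>i. i < r \<Longrightarrow> d i < (p::nat)" "\<And>i. i < r \<Longrightarrow> d' i < p"
    and "(\<Sum>i<r. p ^ i * d i) = (\<Sum>i<r. p ^ i * d' i)" "i < r"
  shows "d i = d' i"
  using assms
proof (induction r arbitrary: i)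
  case (Suc r)
  have less: "(\<Sum>i<r. p ^ i * d i) < p ^ r" "(\<Sum>i<r. p ^ i * d' i) < p ^ r"
    using Suc.prems(1,2) by (auto intro!: digit_sum_less)
  have eq: "(\<Sum>i<r. p ^ i * d i) + p ^ r * d r = (\<Sum>i<r. p ^ i * d' i) + p ^ r * d' r"
    using Suc.prems(3) by simp
  have "((\<Sum>i<r. p ^ i * d i) + p ^ r * d r) mod p ^ r = (\<Sum>i<r. p ^ i * d i)"
    "((\<Sum>i<r. p ^ i * d' i) + p ^ r * d' r) mod p ^ r = (\<Sum>i<r. p ^ i * d' i)"
    using less by simp_all
  then have low: "(\<Sum>i<r. p ^ i * d i) = (\<Sum>i<r. p ^ i * d' i)" using eq by metis
  then have "p ^ r * d r = p ^ r * d' r" using eq by simp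
  moreover have "0 < p" using Suc.prems(1)[of r] by simp
  ultimately have "d r = d' r" by simp
  moreover have "d i = d' i" if "i < r" using Suc.IH[OF _ _ low that] Suc.prems(1,2) by simp
  ultimately show ?case using Suc.prems(4) by (cases "i = r") auto
qed simp

subsection \<open>Polynomial and permutation modules\<close>

lemma group_module_poly:
  assumes H: "Group.group H"
    and \<rho>: "\<And>h x y. h \<in> carrier H \<Longrightarrow> \<rho> h (x + y) = \<rho> h x + \<rho> h y"
      "\<And>h c x. h \<in> carrier H \<Longrightarrow> \<rho> h (pscale c x) = pscale c (\<rho> h x)"
      "\<And>x. \<rho> \<one>\<^bsub>H\<^esub> x = x" "\<And>g h x. g \<in> carrier H \<Longrightarrow> h \<in> carrier H \<Longrightarrow> \<rho> (g \<otimes>\<^bsub>H\<^esub> h) x = \<rho> g (\<rho> h x)"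
  shows "group_module (ring_of_type_algebra :: 'k::field ring) H (poly_gmodule \<rho> :: ('k, ('n, 'k) mpoly, 'h) gmodule)"
proof (rule group_moduleI)
  let ?M = "poly_gmodule \<rho> :: ('k, ('n, 'k) mpoly, 'h) gmodule"
  show "Ring.field (ring_of_type_algebra :: 'k ring)" by (rule field_from_type_algebra)
  show "Group.group H" by (rule H)
  have "abelian_group ?M"
    by (rule abelian_groupI) (auto simp: poly_gmodule_def algebra_simps intro: exI[of _ "- _"] add.right_inverse)
  then show "Module.module (ring_of_type_algebra :: 'k ring) ?M"
    by (intro moduleI cring_from_type_algebra)
      (auto simp: poly_gmodule_def mconst_add mconst_mult algebra_simps)
qed (auto simp: poly_gmodule_def \<rho> mconst_mult_eq_pscale)

lemma group_module_permutation:
  assumes H: "Group.group H" and \<pi>: "\<And>v. \<pi> \<one>\<^bsub>H\<^esub> v = v"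
    "\<And>g h v. g \<in> carrier H \<Longrightarrow> h \<in> carrier H \<Longrightarrow> \<pi> (g \<otimes>\<^bsub>H\<^esub> h) v = \<pi> g (\<pi> h v)"
  shows "group_module (ring_of_type_algebra :: 'k::field ring) H
    (permutation_gmodule \<pi> :: ('k, 'v::comm_monoid_add \<Rightarrow>\<^sub>0 'k, 'h) gmodule)"
proof (rule group_moduleI)
  let ?M = "permutation_gmodule \<pi> :: ('k, 'v \<Rightarrow>\<^sub>0 'k, 'h) gmodule"
  define F where "F h v c = Poly_Mapping.single (\<pi> h v) c" for h v and c :: 'k
  have F: "F h v 0 = 0" "F h v (x + y) = F h v x + F h v y" for h v x y
    by (simp_all add: F_def single_add)
  have act: "act ?M h = linear_extension (F h)" for h
    by (simp add: permutation_gmodule_def fun_eq_iff linear_extension_def F_def)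
  have smult: "smult ?M = pscale"
    by (simp add: fun_eq_iff permutation_gmodule_def pscale_def mult_map_scale_conv_mult)
  have other: "carrier ?M = UNIV" "add ?M = (+)" "\<zero>\<^bsub>?M\<^esub> = 0" by (simp_all add: permutation_gmodule_def)
  note all = act smult other
  have ext: "linear_extension (F h) x = x" if "h = \<one>\<^bsub>H\<^esub>" for h x
    using that unfolding linear_extension_def F_def by (simp add: \<pi> poly_mapping_sum_single[symmetric])
  show "Ring.field (ring_of_type_algebra :: 'k ring)" by (rule field_from_type_algebra)
  show "Group.group H" by (rule H)
  have "abelian_group ?M"
    by (rule abelian_groupI) (auto simp: other algebra_simps intro: exI[of _ "- _"] add.right_inverse)
  then show "Module.module (ring_of_type_algebra :: 'k ring) ?M"
    by (intro moduleI cring_from_type_algebra)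
      (auto simp: all pm.scale_left_distrib pm.scale_right_distrib)
  fix h x
  show "act ?M h (x \<oplus>\<^bsub>?M\<^esub> y) = act ?M h x \<oplus>\<^bsub>?M\<^esub> act ?M h y" for y
    unfolding all by (rule linear_extension_add) (rule F)+
  show "act ?M h (c \<odot>\<^bsub>?M\<^esub> x) = c \<odot>\<^bsub>?M\<^esub> act ?M h x" for c
  proof -
    have "pscale c x = (\<Sum>v\<in>Poly_Mapping.keys x. Poly_Mapping.single v (c * Poly_Mapping.lookup x v))"
      unfolding pscale_def
      by (subst poly_mapping_sum_single[of x]) (simp add: sum_distrib_left mult_single)
    then have "linear_extension (F h) (pscale c x) =
        (\<Sum>v\<in>Poly_Mapping.keys x. F h v (c * Poly_Mapping.lookup x v))"
      by (simp add: linear_extension_sum F linear_extension_single)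
    also have "\<dots> = pscale c (linear_extension (F h) x)"
      by (simp add: linear_extension_def F_def pscale_def sum_distrib_left mult_single)
    finally show ?thesis unfolding all .
  qed
  show "act ?M (g \<otimes>\<^bsub>H\<^esub> h) x = act ?M g (act ?M h x)" if "g \<in> carrier H" "h \<in> carrier H" for g
  proof -
    have "linear_extension (F g) (linear_extension (F h) x) =
        (\<Sum>v\<in>Poly_Mapping.keys x. F g (\<pi> h v) (Poly_Mapping.lookup x v))"
      unfolding linear_extension_def[of "F h"]
      by (simp add: linear_extension_sum F) (simp add: F_def[of h] linear_extension_single F)
    also have "\<dots> = linear_extension (F (g \<otimes>\<^bsub>H\<^esub> h)) x"
      by (simp add: linear_extension_def F_def \<pi>(2)[OF that])
    finally show ?thesis unfolding all by simp
  qed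
  show "act ?M \<one>\<^bsub>H\<^esub> x = x" unfolding all by (rule ext[OF refl])
qed (simp_all add: permutation_gmodule_def)

subsection \<open>The monomial basis\<close>

lemma sum_Times: "(\<Sum>b\<in>A \<times> C. g b) = (\<Sum>a\<in>A. \<Sum>c\<in>C. g (a, c))"
  by (simp add: sum.cartesian_product)

text \<open>The matrix of \<open>g\<close> on the powers \<open>x_l^(p^a)\<close>: block diagonal in
  \<open>a\<close>, each block being \<open>j(g)\<close> with entries raised to the power
  \<open>p^a\<close>. Row \<open>l\<close> lists the coefficients of the image of variable
  \<open>l\<close>, hence the index order \<open>g $ i $ l\<close>.\<close>

definition frobenius_coeff :: "nat \<Rightarrow> ('a \<Rightarrow> 'k::field) \<Rightarrow> 'a ^ 'n ^ 'n \<Rightarrow> nat \<times> 'n \<Rightarrow> nat \<times> 'n \<Rightarrow> 'k" where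
  "frobenius_coeff p j g = (\<lambda>(a, l) (b, i). if a = b then j (g $ i $ l) ^ p ^ a else 0)"

lemma sum_frobenius_coeff:
  fixes x :: "nat \<times> 'n::finite \<Rightarrow> ('m::comm_monoid_add \<Rightarrow>\<^sub>0 'k::field)"
  assumes "a < r"
  shows "(\<Sum>c\<in>{..<r} \<times> UNIV. pscale (frobenius_coeff p j g (a, l) c) (x c)) =
    (\<Sum>i\<in>UNIV. pscale (j (g $ i $ l) ^ p ^ a) (x (a, i)))"
proof -
  have "(\<Sum>c\<in>{..<r} \<times> UNIV. pscale (frobenius_coeff p j g (a, l) c) (x c)) =
      (\<Sum>b<r. \<Sum>i\<in>UNIV. pscale (if a = b then j (g $ i $ l) ^ p ^ a else 0) (x (b, i)))"
    unfolding sum_Times frobenius_coeff_def by simp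
  also have "\<dots> = (\<Sum>b<r. if b = a then \<Sum>i\<in>UNIV. pscale (j (g $ i $ l) ^ p ^ a) (x (a, i)) else 0)"
    by (rule sum.cong) auto
  finally show ?thesis using assms by simp
qed

locale prime_char =
  fixes p r :: nat and TK :: "'k::field itself" and TN :: "'n::finite itself"
  assumes prime_p: "Factorial_Ring.prime p" and char: "CHAR('k) = p" and r: "1 \<le> r"
begin

lemma char_poly_mapping: "CHAR('m::comm_monoid_add \<Rightarrow>\<^sub>0 'k) = p"
  by (simp add: CHAR_poly_mapping char)

lemma frobenius_sum:
  fixes f :: "'i \<Rightarrow> ('m::comm_monoid_add \<Rightarrow>\<^sub>0 'k)"
  shows "(\<Sum>i\<in>I. f i) ^ p ^ a = (\<Sum>i\<in>I. f i ^ p ^ a)"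
  by (rule freshmans_dream_sum'[of _ a]) (simp_all add: char_poly_mapping prime_p)

lemma p_gt_1: "1 < p"
  using prime_p by (rule prime_gt_1_nat)

definition B :: "(nat \<times> 'n) set" where "B = {..<r} \<times> UNIV"

definition xpow :: "nat \<times> 'n \<Rightarrow> ('n, 'k) mpoly" where "xpow = (\<lambda>(a, l). mvar l ^ p ^ a)"

text \<open>The exponent of \<open>x_l\<close> is the number with base-\<open>p\<close> digits
  \<open>f (a, l)\<close>, provided these are less than \<open>p\<close>; otherwise carries are
  still to be made.\<close>

definition expo :: "(nat \<times> 'n \<Rightarrow> nat) \<Rightarrow> ('n \<Rightarrow>\<^sub>0 nat)" where
  "expo f = (\<Sum>b\<in>B. Poly_Mapping.single (snd b) (p ^ fst b * f b))"

lemma finite_B: "finite B"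
  by (simp add: B_def)

lemma gmon_xpow: "gmon B xpow f = Poly_Mapping.single (expo f) 1"
  unfolding gmon_def expo_def xpow_def
  by (simp add: case_prod_unfold mvar_power power_mult[symmetric] prod_single_1)
    (simp add: mvar_power[symmetric] power_mult[symmetric] prod_single_1[symmetric])

lemma lookup_expo: "Poly_Mapping.lookup (expo f) l = (\<Sum>a<r. p ^ a * f (a, l))"
proof -
  have "Poly_Mapping.lookup (expo f) l = (\<Sum>a<r. \<Sum>i\<in>UNIV. if i = l then p ^ a * f (a, i) else 0)"
    unfolding expo_def lookup_sum B_def sum_Times
    by (intro sum.cong) (auto simp: lookup_single when_def)
  then show ?thesis by simp
qed

lemma expo_inj:
  assumes "e \<in> B \<rightarrow>\<^sub>E {..<p}" "f \<in> B \<rightarrow>\<^sub>E {..<p}" "expo e = expo f"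
  shows "e = f"
proof (rule PiE_ext[OF assms(1,2)])
  fix b assume "b \<in> B"
  then obtain a l where b: "b = (a, l)" "a < r" by (auto simp: B_def)
  have "(\<lambda>a. e (a, l)) a = (\<lambda>a. f (a, l)) a"
    by (rule digit_sum_inj[where p = p and r = r])
      (use assms b lookup_expo[of e l] lookup_expo[of f l] in \<open>auto simp: B_def PiE_def Pi_def\<close>)
  then show "e b = f b" using b by simp
qed

lemma lookup_expo_less:
  assumes "e \<in> B \<rightarrow>\<^sub>E {..<p}"
  shows "Poly_Mapping.lookup (expo e) l < p ^ r"
  unfolding lookup_expo by (rule digit_sum_less) (use assms in \<open>auto simp: B_def PiE_def Pi_def\<close>)

text \<open>Everything is put into digit \<open>0\<close>, regardless of size;
  \<open>xpow_reduce\<close> then makes the carries.\<close>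

lemma single_eq_gmon:
  "Poly_Mapping.single \<alpha> 1 = gmon B xpow (\<lambda>(a, l). if a = 0 then Poly_Mapping.lookup \<alpha> l else 0)"
proof -
  have "(\<Sum>a<r. p ^ a * (if a = 0 then Poly_Mapping.lookup \<alpha> l else 0)) =
      (\<Sum>a<r. if a = 0 then Poly_Mapping.lookup \<alpha> l else 0)" for l
    by (rule sum.cong) auto
  then have "expo (\<lambda>(a, l). if a = 0 then Poly_Mapping.lookup \<alpha> l else 0) = \<alpha>"
    using r by (intro poly_mapping_eqI) (simp add: lookup_expo)
  then show ?thesis by (simp add: gmon_xpow)
qed

abbreviation J where "J \<equiv> (truncation_ideal (p ^ r) :: ('n, 'k) mpoly set)"

lemma xpow_carry:
  assumes "b \<in> B"
  shows "(\<exists>c\<in>B. xpow b ^ p = xpow c) \<or> xpow b ^ p \<in> J"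
proof -
  obtain a l where b: "b = (a, l)" "a < r" using assms by (auto simp: B_def)
  have eq: "xpow b ^ p = mvar l ^ p ^ Suc a" by (simp add: b xpow_def power_mult[symmetric] mult.commute)
  show ?thesis
  proof (cases "Suc a < r")
    case True
    then show ?thesis unfolding eq by (intro disjI1 bexI[of _ "(Suc a, l)"]) (auto simp: xpow_def B_def)
  next
    case False
    then have "Suc a = r" using b by simp
    then show ?thesis unfolding eq by (intro disjI2) (simp only: truncation_ideal(4))
  qed
qed

text \<open>A carry replaces \<open>p\<close> factors by a single one, or by an element of the ideal
  at the top digit. The total degree drops by \<open>p - 1\<close>, so the process ends.\<close>

lemma xpow_reduce:
  "gmon B xpow f \<in> pm.span ({gmon B xpow e | e. e \<in> B \<rightarrow>\<^sub>E {..<p} \<and> sum e B \<le> sum f B} \<union> J)"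
proof (induction "sum f B" arbitrary: f rule: less_induct)
  case less
  show ?case
  proof (cases "\<exists>b\<in>B. p \<le> f b")
    case False
    then have "restrict f B \<in> B \<rightarrow>\<^sub>E {..<p}" by auto
    moreover have "gmon B xpow f = gmon B xpow (restrict f B)" "sum (restrict f B) B = sum f B"
      by (auto intro!: gmon_cong)
    ultimately show ?thesis by (intro pm.span_base) fastforce
  next
    case True
    then obtain b where b: "b \<in> B" "p \<le> f b" by blast
    define f' where "f' = (\<lambda>c. f c - (if c = b then p else 0))"
    have f: "f = (\<lambda>c. (if c = b then p else 0) + f' c)" using b by (auto simp: f'_def fun_eq_iff)
    have eq: "gmon B xpow f = xpow b ^ p * gmon B xpow f'"
      by (subst f) (simp add: gmon_add[symmetric] gmon_single[OF finite_B b(1)])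
    have deg: "sum f B = p + sum f' B"
      using finite_B b by (subst f) (simp add: sum.distrib)
    from xpow_carry[OF b(1)] show ?thesis
    proof
      assume "xpow b ^ p \<in> J"
      then have "gmon B xpow f \<in> J" unfolding eq by (rule truncation_ideal(3))
      then show ?thesis by (intro pm.span_base) blast
    next
      assume "\<exists>c\<in>B. xpow b ^ p = xpow c"
      then obtain c where c: "c \<in> B" "xpow b ^ p = xpow c" by blast
      define g where "g = (\<lambda>d. (if d = c then 1 else 0) + f' d)"
      have g: "gmon B xpow f = gmon B xpow g" "sum g B = Suc (sum f' B)"
        unfolding eq c(2) g_def gmon_add[symmetric] gmon_single[OF finite_B c(1)]
        using finite_B c(1) by (simp_all add: sum.distrib)
      have less': "sum g B < sum f B" using g(2) deg p_gt_1 by simp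
      have "pm.span ({gmon B xpow e | e. e \<in> B \<rightarrow>\<^sub>E {..<p} \<and> sum e B \<le> sum g B} \<union> J) \<subseteq>
          pm.span ({gmon B xpow e | e. e \<in> B \<rightarrow>\<^sub>E {..<p} \<and> sum e B \<le> sum f B} \<union> J)"
        by (rule pm.span_mono) (use less' in auto)
      then show ?thesis using less.hyps[OF less'] g(1) by auto
    qed
  qed
qed

sublocale graded: monomial_filtration B p xpow J "(\<le>)" "(<)"
proof
  show "xpow b ^ p \<in> pm.span ({gmon B xpow f | f. sum f B < p} \<union> J)" if b: "b \<in> B" for b
    using xpow_carry[OF b]
  proof
    assume "\<exists>c\<in>B. xpow b ^ p = xpow c"
    then obtain c where c: "c \<in> B" "xpow b ^ p = xpow c" by blast
    have "xpow c = gmon B xpow (\<lambda>d. if d = c then 1 else 0)"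
      by (subst gmon_single[OF finite_B c(1)]) simp
    moreover have "sum (\<lambda>d. if d = c then 1 else 0) B < p" using finite_B c(1) p_gt_1 by simp
    ultimately show ?thesis unfolding c(2) by (intro pm.span_base) blast
  qed (intro pm.span_base, blast)
qed (use finite_B xpow_reduce subspace_truncation_ideal truncation_ideal(3) in auto)

lemma graded_generates:
  "\<exists>d. P - (\<Sum>e\<in>B \<rightarrow>\<^sub>E {..<p}. pscale (d e) (gmon B xpow e)) \<in> J"
proof -
  \<comment> \<open>The conjunct \<open>True\<close> brings the set into the form expected by
    \<open>span_combination\<close>.\<close>
  let ?S = "pm.span ({gmon B xpow e | e. e \<in> B \<rightarrow>\<^sub>E {..<p} \<and> True} \<union> J)"
  have "gmon B xpow f \<in> ?S" for f
    by (rule subsetD[OF pm.span_mono xpow_reduce]) blast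
  then have "Poly_Mapping.single \<alpha> c \<in> ?S" for \<alpha> c
  proof -
    have "Poly_Mapping.single \<alpha> c = pscale c (Poly_Mapping.single \<alpha> 1)" by (simp add: pscale_def mult_single)
    then show ?thesis using \<open>\<And>f. gmon B xpow f \<in> ?S\<close> single_eq_gmon by (simp add: pm.span_scale)
  qed
  then have "P \<in> ?S" by (subst poly_mapping_sum_single[of P]) (rule pm.span_sum)
  from graded.span_combination[OF this] show ?thesis by blast
qed

text \<open>Reduced monomials are distinct monomials in the \<open>x_l\<close> with all exponents
  below \<open>p^r\<close>, so a nonzero combination has a monomial that cannot occur in the
  ideal.\<close>

lemma graded_independent:
  fixes \<eta> :: "'e::finite \<Rightarrow> nat \<times> 'n \<Rightarrow> nat"
  assumes \<eta>: "bij_betw \<eta> UNIV (B \<rightarrow>\<^sub>E {..<p})" and "graded.lift \<eta> c \<in> J"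
  shows "c = 0"
proof (rule ccontr)
  assume "c \<noteq> 0"
  then obtain e where e: "c $ e \<noteq> 0" by (auto simp: vec_eq_iff)
  have mem: "\<eta> f \<in> B \<rightarrow>\<^sub>E {..<p}" for f using bij_betwE[OF \<eta>] by blast
  have inj: "expo (\<eta> f) = expo (\<eta> e) \<longleftrightarrow> f = e" for f
    using expo_inj[OF mem mem] \<eta> by (metis UNIV_I bij_betw_imp_inj_on inj_on_eq_iff)
  have "Poly_Mapping.lookup (graded.lift \<eta> c) (expo (\<eta> e)) = (\<Sum>f\<in>UNIV. if f = e then c $ f else 0)"
    unfolding graded.lift_def lookup_sum gmon_xpow pscale_def
    by (rule sum.cong) (auto simp: mult_single lookup_single when_def inj)
  then have "expo (\<eta> e) \<in> Poly_Mapping.keys (graded.lift \<eta> c)" using e by (simp add: in_keys_iff)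
  from truncation_ideal_keys[OF assms(2) this] show False
    using lookup_expo_less[OF mem] by (metis not_le)
qed

lemma graded_parking:
  fixes H :: "'h monoid" and \<theta> :: "'h \<Rightarrow> 'a::field ^ 'n ^ 'n" and j :: "'a \<Rightarrow> 'k"
    and \<eta> :: "'e::finite \<Rightarrow> nat \<times> 'n \<Rightarrow> nat"
  assumes H: "Group.group H" and j: "j \<in> ring_hom ring_of_type_algebra ring_of_type_algebra"
    and \<theta>: "\<theta> \<one>\<^bsub>H\<^esub> = mat 1" "\<And>g h. g \<in> carrier H \<Longrightarrow> h \<in> carrier H \<Longrightarrow> \<theta> (g \<otimes>\<^bsub>H\<^esub> h) = \<theta> g ** \<theta> h"
    and \<eta>: "bij_betw \<eta> UNIV (B \<rightarrow>\<^sub>E {..<p})"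
  defines "M \<equiv> graded_parking (p ^ r) (\<lambda>h. GL_poly_act j (\<theta> h))"
  shows "group_module (ring_of_type_algebra :: 'k ring) H M"
    and "\<exists>\<Phi> :: 'k ^ 'e \<Rightarrow> _. basis_map M \<Phi> \<and> (\<forall>h\<in>carrier H. \<exists>A.
      leading_matrix B (frobenius_coeff p j (\<theta> h)) \<eta> (<) A \<and> (\<forall>c. act M h (\<Phi> c) = \<Phi> (A *v c)))"
proof -
  let ?K = "ring_of_type_algebra :: 'k ring"
  define P where "P = (poly_gmodule (\<lambda>h. GL_poly_act j (\<theta> h)) :: ('k, ('n, 'k) mpoly, 'h) gmodule)"
  have act: "GL_poly_act j g (x + y) = GL_poly_act j g x + GL_poly_act j g y"
    "GL_poly_act j g (pscale c x) = pscale c (GL_poly_act j g x)"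
    "GL_poly_act j g (x * y) = GL_poly_act j g x * GL_poly_act j g y"
    "GL_poly_act j g 1 = 1" for g :: "'a ^ 'n ^ 'n" and x y c
    unfolding GL_poly_act_def by (simp_all add: msubst_add msubst_pscale msubst_mult)
  interpret P: group_module ?K H P
    unfolding P_def
    by (rule group_module_poly[OF H]) (simp_all add: act \<theta> GL_poly_act_mat_1[OF j] GL_poly_act_mult[OF j])
  have Ps: "carrier P = UNIV" "add P = (+)" "\<zero>\<^bsub>P\<^esub> = 0" "smult P = pscale" "act P = (\<lambda>h. GL_poly_act j (\<theta> h))"
    by (simp_all add: P_def poly_gmodule_def fun_eq_iff mconst_mult_eq_pscale)
  \<comment> \<open>The power \<open>p^a\<close> is additive in characteristic \<open>p\<close>, so
    the linear substitution acts on the \<open>x_l^(p^a)\<close> linearly and without error. For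
    \<open>a = r\<close> this gives the invariance of the ideal in \<open>stable\<close>.\<close>
  have gen: "GL_poly_act j g (xpow (a, l)) = (\<Sum>i\<in>UNIV. pscale (j (g $ i $ l) ^ p ^ a) (xpow (a, i)))"
    for g :: "'a ^ 'n ^ 'n" and a l
    unfolding GL_poly_act_def xpow_def
    by (simp add: msubst_power frobenius_sum power_mult_distrib pscale_power mconst_mult_eq_pscale)
  have stable: "GL_poly_act j g x \<in> J" if "x \<in> J" for g :: "'a ^ 'n ^ 'n" and x
  proof -
    have "J \<subseteq> {x. GL_poly_act j g x \<in> J}"
    proof (rule truncation_ideal_minimal)
      fix i
      have "GL_poly_act j g (mvar i ^ p ^ r) = (\<Sum>t\<in>UNIV. pscale (j (g $ t $ i) ^ p ^ r) (mvar t ^ p ^ r))"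
        using gen[of g r i] by (simp add: xpow_def)
      also have "\<dots> \<in> J"
        by (intro pm.subspace_sum pm.subspace_scale subspace_truncation_ideal truncation_ideal(4))
      finally show "mvar i ^ p ^ r \<in> {x. GL_poly_act j g x \<in> J}" by simp
      have "GL_poly_act j g 0 = 0" using act(1)[of g 0 0] by simp
      then show "0 \<in> {x. GL_poly_act j g x \<in> J}" by (simp add: truncation_ideal(1))
    qed (auto simp: act intro: truncation_ideal)
    then show ?thesis using that by blast
  qed
  have J: "group_submodule ?K H P J"
    by (rule P.group_submoduleI)
      (auto simp: Ps truncation_ideal(1,2) stable intro: pm.subspace_scale[OF subspace_truncation_ideal])
  have M: "M = quotient_gmodule P J" unfolding M_def P_def graded_parking_def truncation_ideal_def ..
  show "group_module ?K H M" unfolding M by (rule P.group_module_quotient[OF J])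
  have min: "x \<ominus>\<^bsub>P\<^esub> y = x - y" for x y
  proof -
    have "\<ominus>\<^bsub>P\<^esub> y = - y" by (rule P.M.minus_equality) (simp_all add: Ps)
    then show ?thesis by (simp add: a_minus_def Ps)
  qed
  define pr where "pr = (\<lambda>x. J +>\<^bsub>P\<^esub> x)"
  note pr = P.quotient_coset[OF J, folded M pr_def, unfolded Ps min, simplified]
  define \<Phi> :: "'k ^ 'e \<Rightarrow> _" where "\<Phi> c = pr (graded.lift \<eta> c)" for c
  have lift: "graded.lift \<eta> (c + d) = graded.lift \<eta> c + graded.lift \<eta> d"
    "graded.lift \<eta> (c - d) = graded.lift \<eta> c - graded.lift \<eta> d"
    "graded.lift \<eta> (a *s c) = pscale a (graded.lift \<eta> c)" for c d :: "'k ^ 'e" and a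
    unfolding graded.lift_def
    by (simp_all add: pm.scale_left_distrib sum.distrib pm.scale_left_diff_distrib sum_subtractf pm.scale_sum_right)
  have "basis_map M \<Phi>"
    unfolding basis_map_def bij_betw_def
  proof (intro conjI allI)
    show "inj \<Phi>"
    proof (rule injI)
      fix c d assume "\<Phi> c = \<Phi> d"
      then have "graded.lift \<eta> (c - d) \<in> J" unfolding \<Phi>_def pr(7) lift .
      then show "c = d" using graded_independent[OF \<eta>] by fastforce
    qed
    show "range \<Phi> = carrier M"
    proof (intro subset_antisym subsetI)
      fix y assume "y \<in> carrier M"
      then obtain x where x: "y = pr x" using pr(2) by blast
      obtain d where d: "x - (\<Sum>e\<in>B \<rightarrow>\<^sub>E {..<p}. pscale (d e) (gmon B xpow e)) \<in> J"
        using graded_generates by blast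
      have "(\<Sum>e\<in>B \<rightarrow>\<^sub>E {..<p}. pscale (d e) (gmon B xpow e)) = graded.lift \<eta> (vec_lambda (\<lambda>e. d (\<eta> e)))"
        unfolding graded.lift_def by (subst sum.reindex_bij_betw[OF \<eta>, symmetric]) simp
      with d have "y = \<Phi> (vec_lambda (\<lambda>e. d (\<eta> e)))" unfolding x \<Phi>_def pr(7) by simp
      then show "y \<in> range \<Phi>" by blast
    qed (use pr(1) \<Phi>_def in auto)
    show "\<Phi> (c + d) = \<Phi> c \<oplus>\<^bsub>M\<^esub> \<Phi> d" for c d unfolding \<Phi>_def lift by (rule pr(4))
    show "\<Phi> (a *s c) = a \<odot>\<^bsub>M\<^esub> \<Phi> c" for a c unfolding \<Phi>_def lift by (rule pr(5))
  qed
  moreover have "\<exists>A. leading_matrix B (frobenius_coeff p j (\<theta> h)) \<eta> (<) A \<and> (\<forall>c. act M h (\<Phi> c) = \<Phi> (A *v c))"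
    if h: "h \<in> carrier H" for h
  proof -
    have "GL_poly_act j (\<theta> h) (xpow b) - (\<Sum>c\<in>B. pscale (frobenius_coeff p j (\<theta> h) b c) (xpow c)) \<in> graded.L 1"
      if "b \<in> B" for b
    proof -
      obtain a l where b: "b = (a, l)" "a < r" using \<open>b \<in> B\<close> by (auto simp: B_def)
      show ?thesis
        using sum_frobenius_coeff[OF b(2), of p j "\<theta> h" l xpow] pm.subspace_0[OF graded.subspace_L]
        unfolding b(1) gen B_def[symmetric] by simp
    qed
    from graded.action_matrix[OF \<eta> act(4,3,1,2) this]
    obtain A where A: "leading_matrix B (frobenius_coeff p j (\<theta> h)) \<eta> (<) A"
      "\<And>c. GL_poly_act j (\<theta> h) (graded.lift \<eta> c) - graded.lift \<eta> (A *v c) \<in> J" by blast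
    have "act M h (\<Phi> c) = \<Phi> (A *v c)" for c
      unfolding \<Phi>_def using pr(6)[OF h, of "graded.lift \<eta> c"] A(2)[of c] pr(7) by metis
    then show ?thesis using A(1) by blast
  qed
  ultimately show "\<exists>\<Phi> :: 'k ^ 'e \<Rightarrow> _. basis_map M \<Phi> \<and> (\<forall>h\<in>carrier H. \<exists>A.
      leading_matrix B (frobenius_coeff p j (\<theta> h)) \<eta> (<) A \<and> (\<forall>c. act M h (\<Phi> c) = \<Phi> (A *v c)))"
    by blast
qed

end

section \<open>Finite fields\<close>

lemma finite_field_power_CARD:
  fixes x :: "'a::{field,finite}"
  shows "x ^ CARD('a) = x"
proof (cases "x = 0")
  case False
  have bij: "bij_betw ((*) x) (UNIV - {0}) (UNIV - {0})"
    by (rule bij_betw_byWitness[where f' = "\<lambda>y. y / x"]) (use False in auto)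
  have "(\<Prod>y\<in>UNIV - {0}. y) = (\<Prod>y\<in>UNIV - {0}. x * y)"
    by (rule prod.reindex_bij_betw[OF bij, symmetric])
  also have "\<dots> = x ^ (CARD('a) - 1) * (\<Prod>y\<in>UNIV - {0}. y)"
    by (simp add: prod.distrib card_Diff_singleton)
  finally have "x ^ (CARD('a) - 1) = 1" by simp
  then have "x ^ Suc (CARD('a) - 1) = x" by (simp only: power_Suc mult_1_right)
  moreover have "Suc (CARD('a) - 1) = CARD('a)" by simp
  ultimately show ?thesis by (simp only:)
qed (simp add: power_0_left)

lemma finite_field_power_CARD_power:
  fixes x :: "'a::{field,finite}"
  shows "x ^ (CARD('a) ^ n) = x"
  by (induction n) (simp_all add: power_mult finite_field_power_CARD)

lemma CHAR_finite_field:
  assumes "Factorial_Ring.prime p" "CARD('a::{field,finite}) = p ^ s"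
  shows "CHAR('a) = p"
proof -
  have "CHAR('a) dvd p ^ s" using CHAR_dvd_CARD[where ?'a = 'a] assms(2) by simp
  moreover have "Factorial_Ring.prime CHAR('a)"
    using finite_imp_CHAR_pos[where ?'a = 'a] prime_CHAR_semidom[where ?'a = 'a] by simp
  ultimately show ?thesis using assms(1) by (metis prime_dvd_power primes_dvd_imp_eq)
qed

lemma card_power_fixed_points:
  assumes "1 < k"
  shows "card {x :: 'a::idom. x ^ k = x} \<le> k"
proof -
  define P :: "'a poly" where "P = Polynomial.monom 1 k - Polynomial.monom 1 1"
  have "Polynomial.coeff P k = 1" using assms by (simp add: P_def)
  then have "P \<noteq> 0" by auto
  have "Polynomial.degree P \<le> k"
    unfolding P_def by (rule degree_diff_le) (use assms in \<open>auto simp: degree_monom_eq\<close>)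
  then have "card {x. poly P x = 0} \<le> k"
    using card_poly_roots_bound[OF \<open>P \<noteq> 0\<close>] by simp
  then show ?thesis by (simp add: P_def poly_monom)
qed

context
  fixes p s :: nat and TA :: "'a::{field,finite} itself"
  assumes p: "Factorial_Ring.prime p" and card: "CARD('a) = p ^ s"
begin

lemma field_frobenius_sum: "(\<Sum>i\<in>I. f i :: 'a) ^ p ^ n = (\<Sum>i\<in>I. f i ^ p ^ n)"
  by (rule freshmans_dream_sum'[of _ n]) (simp_all add: CHAR_finite_field[OF p card] p)

text \<open>\<open>X^p - X\<close> has at most \<open>p\<close> roots, and the images of
  \<open>0, ..., p - 1\<close> are already \<open>p\<close> of them.\<close>

lemma fixed_by_frobenius_eq_of_nat:
  assumes "x ^ p = (x :: 'a)"
  shows "\<exists>n. x = of_nat n"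
proof -
  have p1: "1 < p" using p by (rule prime_gt_1_nat)
  have inj: "inj_on (of_nat :: nat \<Rightarrow> 'a) {..<p}"
  proof (rule inj_onI)
    fix a b assume ab: "a \<in> {..<p}" "b \<in> {..<p}" "of_nat a = (of_nat b :: 'a)"
    then have "[a = b] (mod p)"
      using of_nat_eq_iff_cong_CHAR[where ?'a = 'a, of a b] CHAR_finite_field[OF p card] by simp
    then show "a = b" using ab by (simp add: cong_def)
  qed
  have fixed: "of_nat n ^ p = (of_nat n :: 'a)" for n
    using field_frobenius_sum[of "\<lambda>_. 1" "{..<n}" 1] by simp
  then have sub: "of_nat ` {..<p} \<subseteq> {x :: 'a. x ^ p = x}" by auto
  have "of_nat ` {..<p} = {x :: 'a. x ^ p = x}"
    by (rule card_seteq[OF _ sub]) (use card_power_fixed_points[OF p1] card_image[OF inj] in auto)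
  then show ?thesis using assms by blast
qed

section \<open>Traces to the prime field and sums of multiplicative characters\<close>

definition field_trace :: "'a \<Rightarrow> 'a" where
  "field_trace x = (\<Sum>i<s. x ^ p ^ i)"

text \<open>The Frobenius permutes the summands cyclically because \<open>x^(p^s) = x\<close>, so
  the trace is fixed by it and lies in the prime field.\<close>

lemma field_trace_eq_of_nat: "\<exists>n. field_trace x = of_nat n"
proof (rule fixed_by_frobenius_eq_of_nat)
  have "x ^ p ^ s = x" using finite_field_power_CARD[of x] card by simp
  moreover have "(\<Sum>i<s. x ^ p ^ Suc i) + x ^ p ^ 0 = (\<Sum>i<s. x ^ p ^ i) + x ^ p ^ s"
    using sum.lessThan_Suc_shift[of "\<lambda>i. x ^ p ^ i" s] by (simp add: add.commute)
  ultimately have "(\<Sum>i<s. x ^ p ^ Suc i) = (\<Sum>i<s. x ^ p ^ i)" by simp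
  moreover have "field_trace x ^ p ^ 1 = (\<Sum>i<s. x ^ p ^ Suc i)"
    unfolding field_trace_def field_frobenius_sum by (simp add: power_mult[symmetric] mult.commute)
  ultimately show "field_trace x ^ p = field_trace x" by (simp add: field_trace_def)
qed

text \<open>Orthogonality of characters. For \<open>0 < i < s\<close> some nonzero \<open>t\<close>
  has \<open>t^(p^i) \<noteq> t\<close>, since \<open>X^(p^i) - X\<close> has too few roots;
  substituting \<open>t * b\<close> for \<open>b\<close> multiplies the sum by a factor other than
  \<open>1\<close>. For \<open>i = 0\<close> it is the number of units, which is \<open>-1\<close>
  in the field.\<close>

lemma sum_quotient_frobenius:
  assumes "i < s"
  shows "(\<Sum>b\<in>UNIV - {0}. b / b ^ p ^ i) = (if i = 0 then - 1 else (0 :: 'a))"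
proof (cases "i = 0")
  case True
  have "(\<Sum>b\<in>UNIV - {0}. b / b ^ p ^ i) = (\<Sum>b\<in>UNIV - {0 :: 'a}. (1 :: 'a))"
    by (rule sum.cong) (use True in auto)
  also have "\<dots> = of_nat (CARD('a) - 1)" by (simp add: card_Diff_singleton)
  also have "\<dots> = of_nat CARD('a) - 1" by (simp add: of_nat_diff)
  also have "of_nat CARD('a) = (0 :: 'a)" using CHAR_dvd_CARD[where ?'a = 'a] of_nat_eq_0_iff_char_dvd by blast
  finally show ?thesis using True by simp
next
  case False
  have p1: "1 < p" using p by (rule prime_gt_1_nat)
  have pi: "1 < p ^ i" using False by (intro one_less_power[OF p1]) simp
  have "p ^ i < p ^ s" using assms p1 by simp
  then have "card {x :: 'a. x ^ p ^ i = x} \<noteq> CARD('a)"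
    using card_power_fixed_points[OF pi, where ?'a = 'a] card by simp
  then obtain t :: 'a where t: "t ^ p ^ i \<noteq> t" by force
  have t0: "t \<noteq> 0" using t p1 by (auto simp: power_0_left)
  have bij: "bij_betw ((*) t) (UNIV - {0}) (UNIV - {0})"
    by (rule bij_betw_byWitness[where f' = "\<lambda>y. y / t"]) (use t0 in auto)
  define S where "S = (\<Sum>b\<in>UNIV - {0}. b / b ^ p ^ i :: 'a)"
  have "S = (\<Sum>b\<in>UNIV - {0}. (t * b) / (t * b) ^ p ^ i)"
    unfolding S_def by (rule sum.reindex_bij_betw[OF bij, symmetric])
  also have "\<dots> = t / t ^ p ^ i * S"
    unfolding S_def sum_distrib_left by (rule sum.cong) (auto simp: power_mult_distrib)
  finally have "(1 - t / t ^ p ^ i) * S = 0" by (simp add: algebra_simps)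
  then have "1 = t / t ^ p ^ i \<or> S = 0" by (simp only: mult_eq_0_iff right_minus_eq)
  moreover have "t / t ^ p ^ i \<noteq> 1" using t t0 by (auto simp: field_simps)
  ultimately have "S = 0" by metis
  then show ?thesis using False by (simp add: S_def)
qed

text \<open>Inversion formula: after expanding the trace and exchanging the sums, orthogonality
  leaves only the term \<open>i = 0\<close>.\<close>

lemma sum_field_trace: "(\<Sum>b\<in>UNIV - {0}. field_trace (a / b) * b) = - a"
proof (cases "s = 0")
  case True
  then have "card (UNIV :: 'a set) = 1" using card by simp
  then have "(0 :: 'a) = 1" by (metis UNIV_I card_1_singletonE singletonD)
  then show ?thesis by simp
next
  case False
  have "(\<Sum>b\<in>UNIV - {0}. field_trace (a / b) * b) =
      (\<Sum>b\<in>UNIV - {0}. \<Sum>i<s. a ^ p ^ i * (b / b ^ p ^ i))"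
    unfolding field_trace_def sum_distrib_right by (simp add: power_divide)
  also have "\<dots> = (\<Sum>i<s. a ^ p ^ i * (\<Sum>b\<in>UNIV - {0}. b / b ^ p ^ i))"
    unfolding sum_distrib_left by (rule sum.swap)
  also have "\<dots> = (\<Sum>i<s. if i = 0 then - a else 0)"
    by (rule sum.cong) (auto simp: sum_quotient_frobenius)
  finally show ?thesis using False by simp
qed

end

section \<open>The ungraded parking space\<close>

text \<open>Monomials with an exponent of at least \<open>p\<close> vanish, so carries and
  reductions are trivial with \<open>J = {0}\<close>. The order is reversed because errors will have
  larger degree.\<close>

lemma nilpotent_filtration:
  assumes "finite B" and z: "\<And>b. b \<in> B \<Longrightarrow> z b ^ p = (0 :: 'm::comm_monoid_add \<Rightarrow>\<^sub>0 'k::field)"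
  shows "monomial_filtration B p z {0} (\<ge>) (>)"
    and "\<And>f b. b \<in> B \<Longrightarrow> p \<le> f b \<Longrightarrow> gmon B z f = 0"
proof -
  show zero: "gmon B z f = 0" if "b \<in> B" "p \<le> f b" for f b
  proof -
    have "z b ^ f b = z b ^ p * z b ^ (f b - p)" using that(2) by (simp add: power_add[symmetric])
    then have "z b ^ f b = 0" using z[OF that(1)] by simp
    then show ?thesis unfolding gmon_def using assms(1) that(1) by (intro prod_zero) auto
  qed
  show "monomial_filtration B p z {0} (\<ge>) (>)"
  proof
    fix f
    show "gmon B z f \<in> pm.span ({gmon B z e | e. e \<in> B \<rightarrow>\<^sub>E {..<p} \<and> sum f B \<le> sum e B} \<union> {0})"
    proof (cases "\<exists>b\<in>B. p \<le> f b")
      case True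
      then have "gmon B z f = 0" using zero by blast
      then show ?thesis by (simp add: pm.span_zero)
    next
      case False
      then have "restrict f B \<in> B \<rightarrow>\<^sub>E {..<p}" by auto
      moreover have "gmon B z f = gmon B z (restrict f B)" "sum (restrict f B) B = sum f B"
        by (auto intro!: gmon_cong)
      ultimately show ?thesis by (intro pm.span_base) fastforce
    qed
  qed (use assms in \<open>auto simp: pm.span_zero\<close>)
qed

section \<open>The group algebra of \<open>F_(q^m)^n\<close> and its augmentation ideal\<close>

definition aug :: "'v::comm_monoid_add \<Rightarrow> ('v \<Rightarrow>\<^sub>0 'k::field)" where
  "aug v = Poly_Mapping.single v 1 - 1"

lemma aug_0 [simp]: "aug 0 = 0"
  by (simp add: aug_def)

lemma aug_add: "aug (u + v) = aug u * aug v + aug u + aug v"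
proof -
  have "Poly_Mapping.single (u + v) 1 = Poly_Mapping.single u 1 * (Poly_Mapping.single v 1 :: _ \<Rightarrow>\<^sub>0 'b)"
    by (simp add: mult_single)
  then show ?thesis by (simp add: aug_def algebra_simps)
qed

text \<open>The square of the augmentation ideal, which is itself spanned by the elements
  \<open>aug v\<close>.\<close>

definition aug2 :: "('v::comm_monoid_add \<Rightarrow>\<^sub>0 'k::field) set" where
  "aug2 = pm.span {aug u * aug v | u v. True}"

lemma subspace_aug2: "pm.subspace aug2"
  unfolding aug2_def by (rule pm.subspace_span)

lemma aug_add_mod: "aug (u + v) - (aug u + aug v) \<in> aug2"
  unfolding aug_add aug2_def by (rule pm.span_base) auto

lemma aug_sum_mod: "aug (\<Sum>i\<in>I. v i) - (\<Sum>i\<in>I. aug (v i)) \<in> aug2"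
proof (induction I rule: infinite_finite_induct)
  case (insert i I)
  have eq: "aug (\<Sum>i\<in>insert i I. v i) - (\<Sum>i\<in>insert i I. aug (v i)) =
      (aug (v i + (\<Sum>i\<in>I. v i)) - (aug (v i) + aug (\<Sum>i\<in>I. v i))) + (aug (\<Sum>i\<in>I. v i) - (\<Sum>i\<in>I. aug (v i)))"
    using insert by simp
  show ?case unfolding eq by (intro pm.subspace_add[OF subspace_aug2] aug_add_mod insert)
qed (simp_all add: pm.subspace_0[OF subspace_aug2])

lemma sum_const_smult: "(\<Sum>i<k. v) = of_nat k *s (v :: 'c::field ^ 'n)"
  by (induction k) (simp_all del: sum_constant add: vec.scale_left_distrib)

text \<open>
  The action of \<open>GL\<^sub>n(F\<^sub>q)\<close> is the case \<open>'a = F\<^sub>q\<close> with an \<open>F\<^sub>q\<close>-basis \<open>\<omega>\<close> of \<open>'f\<close>; that of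
  \<open>GL\<^sub>n(F\<^sub>q) \<times> C\<close> is the case \<open>'a = 'f\<close>, with the pair of \<open>g\<close> and \<open>\<gamma>\<close> acting by the matrix \<open>\<gamma> g\<close>.
\<close>

locale parking_spaces = prime_char p r TK TN
  for p r :: nat and TK :: "'k::field itself" and TN :: "'n::finite itself" +
  fixes s m :: nat and \<kappa> :: "'a::{field,finite} \<Rightarrow> 'f::{field,finite}" and j :: "'a \<Rightarrow> 'k"
    and \<omega> :: "nat \<Rightarrow> 'f"
  assumes rsm: "r = m * s" and card_a: "CARD('a) = p ^ s" and card_f: "CARD('f) = p ^ r"
    and \<kappa>: "\<kappa> \<in> ring_hom ring_of_type_algebra ring_of_type_algebra"
    and j: "j \<in> ring_hom ring_of_type_algebra ring_of_type_algebra"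
    and \<omega>: "\<And>x. \<exists>c. x = (\<Sum>u<m. \<kappa> (c u) * \<omega> u)"
begin

lemmas \<kappa>D = ring_hom_type_algebraD[OF \<kappa>] and jD = ring_hom_type_algebraD[OF j]

lemma j_power: "j (x ^ k) = j x ^ k"
  by (induction k) (simp_all add: jD)

lemma j_of_nat: "j (of_nat k) = of_nat k"
  by (induction k) (simp_all add: jD)

lemma j_nonzero: "x \<noteq> 0 \<Longrightarrow> j x \<noteq> 0"
  by (metis jD(2,3) mult_zero_left right_inverse zero_neq_one)

lemma aug_power: "(aug v :: 'f ^ 'n \<Rightarrow>\<^sub>0 'k) ^ p = 0"
proof -
  let ?x = "Poly_Mapping.single v 1 :: 'f ^ 'n \<Rightarrow>\<^sub>0 'k"
  have "CHAR('f) = p" by (rule CHAR_finite_field[OF prime_p card_f])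
  then have "(of_nat p :: 'f) = 0" by (metis of_nat_CHAR)
  then have "(\<Sum>i<p. v) = 0" by (simp only: sum_const_smult vec.scale_zero_left)
  then have x: "?x ^ p = 1" by (simp only: single_power single_one)
  \<comment> \<open>\<open>e_v = aug v + 1\<close> is written as a sum over two indices so that
    \<open>frobenius_sum\<close> applies.\<close>
  have "?x ^ p ^ 1 = (\<Sum>i<2::nat. if i = 0 then aug v else 1) ^ p ^ 1"
    by (simp add: numeral_2_eq_2 aug_def)
  also have "\<dots> = aug v ^ p ^ 1 + 1" unfolding frobenius_sum by (simp add: numeral_2_eq_2)
  finally show ?thesis using x by simp
qed

text \<open>Component of \<open>a |-> aug (\<kappa> a *s \<epsilon>)\<close> for the multiplicative
  character \<open>a |-> j(a)^(p^i)\<close>. The sign is the inverse of the number of units, which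
  is \<open>-1\<close> in characteristic \<open>p\<close>.\<close>

definition fourier :: "'f ^ 'n \<Rightarrow> nat \<Rightarrow> ('f ^ 'n \<Rightarrow>\<^sub>0 'k)" where
  "fourier \<epsilon> i = (\<Sum>a\<in>UNIV - {0}. pscale (- (inverse (j a) ^ p ^ i)) (aug (\<kappa> a *s \<epsilon>)))"

lemma fourier_power: "fourier \<epsilon> i ^ p = 0"
proof -
  have "fourier \<epsilon> i ^ p ^ 1 = 0"
    unfolding fourier_def frobenius_sum
    by (simp only: pscale_power power_one_right aug_power pm.scale_zero_right sum.neutral_const)
  then show ?thesis by simp
qed

text \<open>Substituting \<open>t * a\<close> for \<open>a\<close> moves \<open>t\<close> into the
  character. The identity is exact, not only modulo \<open>aug2\<close>.\<close>

lemma fourier_scale: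
  "(\<Sum>a\<in>UNIV - {0}. pscale (- (inverse (j a) ^ p ^ i)) (aug (\<kappa> (t * a) *s \<epsilon>))) =
    pscale (j t ^ p ^ i) (fourier \<epsilon> i)"
proof (cases "t = 0")
  case True
  then show ?thesis using p_gt_1 by (simp add: \<kappa>D jD)
next
  case False
  have bij: "bij_betw ((*) t) (UNIV - {0}) (UNIV - {0})"
    by (rule bij_betw_byWitness[where f' = "\<lambda>y. y / t"]) (use False in auto)
  have "pscale (j t ^ p ^ i) (fourier \<epsilon> i) = (\<Sum>a\<in>UNIV - {0}. pscale (j t ^ p ^ i)
      (pscale (- (inverse (j (t * a)) ^ p ^ i)) (aug (\<kappa> (t * a) *s \<epsilon>))))"
    unfolding fourier_def pm.scale_sum_right by (rule sum.reindex_bij_betw[OF bij, symmetric])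
  also have "\<dots> = (\<Sum>a\<in>UNIV - {0}. pscale (- (inverse (j a) ^ p ^ i)) (aug (\<kappa> (t * a) *s \<epsilon>)))"
  proof (rule sum.cong[OF refl])
    fix a
    have "j t ^ p ^ i * inverse (j t) ^ p ^ i = 1"
      by (simp only: power_mult_distrib[symmetric] right_inverse[OF j_nonzero[OF False]] power_one)
    then have "j t ^ p ^ i * - (inverse (j (t * a)) ^ p ^ i) = - (inverse (j a) ^ p ^ i)"
      by (simp add: jD power_mult_distrib mult.assoc[symmetric])
    then show "pscale (j t ^ p ^ i) (pscale (- (inverse (j (t * a)) ^ p ^ i)) (aug (\<kappa> (t * a) *s \<epsilon>))) =
        pscale (- (inverse (j a) ^ p ^ i)) (aug (\<kappa> (t * a) *s \<epsilon>))"
      by (simp only: pm.scale_scale)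
  qed
  finally show ?thesis by simp
qed

lemma aug_of_nat_mod: "pscale (of_nat k) (aug v) - aug (of_nat k *s v) \<in> (aug2 :: ('f ^ 'n \<Rightarrow>\<^sub>0 'k) set)"
proof -
  have "aug (\<Sum>i<k. v) - (\<Sum>i<k. aug v) \<in> (aug2 :: ('f ^ 'n \<Rightarrow>\<^sub>0 'k) set)" by (rule aug_sum_mod)
  moreover note sum_const_smult[of v k]
  moreover have "(\<Sum>i<k. aug v) = pscale (of_nat k) (aug v :: 'f ^ 'n \<Rightarrow>\<^sub>0 'k)"
    by (induction k) (simp_all del: sum_constant add: pm.scale_left_distrib)
  ultimately have "aug (of_nat k *s v) - pscale (of_nat k) (aug v) \<in> (aug2 :: ('f ^ 'n \<Rightarrow>\<^sub>0 'k) set)"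
    by (simp only:)
  from pm.subspace_neg[OF subspace_aug2 this] show ?thesis by simp
qed

lemma \<kappa>_of_nat: "\<kappa> (of_nat k) = of_nat k"
  by (induction k) (simp_all add: \<kappa>D)

text \<open>
  Fourier inversion modulo the square of the augmentation ideal. The exponents \<open>p^i\<close> suffice since
  the trace takes values in the prime field, and \<open>aug\<close> is additive modulo \<open>aug2\<close>.
\<close>

lemma aug_eq_fourier_mod:
  "aug (\<kappa> a *s \<epsilon>) - (\<Sum>i<s. pscale (j a ^ p ^ i) (fourier \<epsilon> i)) \<in> aug2"
proof -
  let ?tr = "field_trace p s :: 'a \<Rightarrow> 'a"
  let ?S = "UNIV - {0 :: 'a}"
  have "(\<Sum>i<s. pscale (j a ^ p ^ i) (fourier \<epsilon> i)) =
      (\<Sum>b\<in>?S. \<Sum>i<s. pscale (- (j (a / b) ^ p ^ i)) (aug (\<kappa> b *s \<epsilon>)))"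
    (is "?F = _")
  proof -
    have div: "j (a / b) = j a * inverse (j b)" if "b \<noteq> 0" for b
    proof -
      have "j (a / b) * j b = j a" using that by (simp add: jD(2)[symmetric])
      then show ?thesis using j_nonzero[OF that] by (simp add: field_simps)
    qed
    have "?F = (\<Sum>i<s. \<Sum>b\<in>?S. pscale (- (j (a / b) ^ p ^ i)) (aug (\<kappa> b *s \<epsilon>)))"
      unfolding fourier_def pm.scale_sum_right
      by (intro sum.cong refl) (simp add: pm.scale_scale div power_mult_distrib)
    then show ?thesis by (subst (asm) sum.swap)
  qed
  also have "\<dots> = (\<Sum>b\<in>?S. - pscale (j (?tr (a / b))) (aug (\<kappa> b *s \<epsilon>)))"
  proof (rule sum.cong[OF refl])
    fix b
    have "j (?tr (a / b)) = (\<Sum>i<s. j (a / b) ^ p ^ i)"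
      unfolding field_trace_def[OF prime_p card_a] by (simp add: hom_sum jD j_power)
    then show "(\<Sum>i<s. pscale (- (j (a / b) ^ p ^ i)) (aug (\<kappa> b *s \<epsilon>))) =
        - pscale (j (?tr (a / b))) (aug (\<kappa> b *s \<epsilon>))"
      by (simp add: pm.scale_sum_left sum_negf)
  qed
  finally have F: "?F = - (\<Sum>b\<in>?S. pscale (j (?tr (a / b))) (aug (\<kappa> b *s \<epsilon>)))"
    by (simp add: sum_negf)
  \<comment> \<open>The trace is a natural number \<open>k\<close> in the field, and
    \<open>k\<close> times \<open>aug v\<close> is \<open>aug (k v)\<close> modulo
    \<open>aug2\<close>; this moves the trace from the coefficient into the vector.\<close>
  have 1: "pscale (j (?tr (a / b))) (aug (\<kappa> b *s \<epsilon>)) - aug (\<kappa> (?tr (a / b) * b) *s \<epsilon>) \<in> aug2" for b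
  proof -
    obtain k where k: "?tr (a / b) = of_nat k" using field_trace_eq_of_nat[OF prime_p card_a] by blast
    have eq: "\<kappa> (?tr (a / b) * b) *s \<epsilon> = of_nat k *s (\<kappa> b *s \<epsilon>)"
      by (simp add: k \<kappa>D \<kappa>_of_nat vector_smult_assoc)
    show ?thesis unfolding eq using aug_of_nat_mod[of k "\<kappa> b *s \<epsilon>"] by (simp only: k j_of_nat)
  qed
  have "(\<Sum>b\<in>?S. pscale (j (?tr (a / b))) (aug (\<kappa> b *s \<epsilon>)) - aug (\<kappa> (?tr (a / b) * b) *s \<epsilon>)) \<in> aug2"
    by (intro pm.subspace_sum[OF subspace_aug2] 1)
  then have 2: "- ?F - (\<Sum>b\<in>?S. aug (\<kappa> (?tr (a / b) * b) *s \<epsilon>)) \<in> aug2"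
    unfolding F by (simp add: sum_subtractf)
  have "(\<Sum>b\<in>?S. \<kappa> (?tr (a / b) * b) *s \<epsilon>) = \<kappa> (\<Sum>b\<in>?S. ?tr (a / b) * b) *s \<epsilon>"
    by (simp add: hom_sum[of \<kappa>, OF \<kappa>D(1,4)] vec.scale_sum_left)
  also have "\<dots> = - (\<kappa> a *s \<epsilon>)"
  proof -
    have "\<kappa> (- a) + \<kappa> a = 0" by (simp add: \<kappa>D(1)[symmetric] \<kappa>D(4))
    then have "\<kappa> (- a) = - \<kappa> a" by (simp add: eq_neg_iff_add_eq_0)
    then show ?thesis by (simp add: sum_field_trace[OF prime_p card_a])
  qed
  finally have sum: "(\<Sum>b\<in>?S. \<kappa> (?tr (a / b) * b) *s \<epsilon>) = - (\<kappa> a *s \<epsilon>)" .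
  have 3: "aug (- (\<kappa> a *s \<epsilon>)) - (\<Sum>b\<in>?S. aug (\<kappa> (?tr (a / b) * b) *s \<epsilon>)) \<in> (aug2 :: ('f ^ 'n \<Rightarrow>\<^sub>0 'k) set)"
    using aug_sum_mod[of "\<lambda>b. \<kappa> (?tr (a / b) * b) *s \<epsilon>" ?S] unfolding sum .
  have 4: "aug (\<kappa> a *s \<epsilon> + - (\<kappa> a *s \<epsilon>)) - (aug (\<kappa> a *s \<epsilon>) + aug (- (\<kappa> a *s \<epsilon>)))
      \<in> (aug2 :: ('f ^ 'n \<Rightarrow>\<^sub>0 'k) set)"
    by (rule aug_add_mod)
  \<comment> \<open>The inversion formula produces the vector with a minus sign. The last bracket
    corrects it: \<open>aug\<close> of zero is zero, so \<open>aug (- v)\<close> is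
    \<open>- aug v\<close> modulo \<open>aug2\<close>.\<close>
  have "aug (\<kappa> a *s \<epsilon>) - ?F =
      (- ?F - (\<Sum>b\<in>?S. aug (\<kappa> (?tr (a / b) * b) *s \<epsilon>))) -
      (aug (- (\<kappa> a *s \<epsilon>)) - (\<Sum>b\<in>?S. aug (\<kappa> (?tr (a / b) * b) *s \<epsilon>))) -
      (aug (\<kappa> a *s \<epsilon> + - (\<kappa> a *s \<epsilon>)) - (aug (\<kappa> a *s \<epsilon>) + aug (- (\<kappa> a *s \<epsilon>))))"
    by simp
  also have "\<dots> \<in> aug2" by (intro pm.subspace_diff[OF subspace_aug2] 2 3 4)
  finally show ?thesis .
qed

text \<open>The index \<open>a < r = m * s\<close> is read as \<open>u * s + i\<close>:
  \<open>u = a div s\<close> selects the vector \<open>\<omega> u\<close>, and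
  \<open>i = a mod s\<close> is the Frobenius twist. So \<open>y (a, l)\<close> transforms like
  \<open>x_l^(p^a)\<close>, because powers \<open>p^a\<close> of elements of \<open>'a\<close>
  depend on \<open>a mod s\<close> only.\<close>

definition y :: "nat \<times> 'n \<Rightarrow> ('f ^ 'n \<Rightarrow>\<^sub>0 'k)" where
  "y = (\<lambda>(a, l). fourier (axis l (\<omega> (a div s))) (a mod s))"

lemma y_power: "y b ^ p = 0"
  unfolding y_def by (simp add: case_prod_unfold fourier_power)

sublocale ungraded: monomial_filtration B p y "{0}" "(\<ge>)" "(>)"
  by (rule nilpotent_filtration(1)[OF finite_B y_power])

text \<open>\<open>augm.U t\<close> is the \<open>t\<close>-th power of the augmentation ideal.\<close>

sublocale augm: monomial_filtration "UNIV :: ('f ^ 'n) set" p "aug :: 'f ^ 'n \<Rightarrow> ('f ^ 'n \<Rightarrow>\<^sub>0 'k)" "{0}" "(\<ge>)" "(>)"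
  by (rule nilpotent_filtration(1)[OF finite_class.finite_UNIV aug_power])

lemma aug_mem: "aug v \<in> augm.U 1"
  using augm.gmon_mem_U[of "\<lambda>w. if w = v then 1 else 0"] gmon_single[of UNIV v "aug :: 'f ^ 'n \<Rightarrow> ('f ^ 'n \<Rightarrow>\<^sub>0 'k)" 1]
  by simp

lemma y_mem: "b \<in> B \<Longrightarrow> y b \<in> ungraded.U 1"
  using ungraded.gmon_mem_U[of "\<lambda>c. if c = b then 1 else 0"] gmon_single[OF finite_B, of b y 1] finite_B
  by simp

lemma aug2_subset: "aug2 \<subseteq> augm.U 2"
  unfolding aug2_def
proof (rule pm.span_minimal[OF _ augm.subspace_U])
  show "{aug u * aug v | u v. True} \<subseteq> augm.U 2"
    using augm.mult_U[OF aug_mem aug_mem] by (auto simp: numeral_2_eq_2)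
qed

lemma U_antimono: "t \<le> t' \<Longrightarrow> augm.U t' \<subseteq> augm.U t" "t \<le> t' \<Longrightarrow> ungraded.U t' \<subseteq> ungraded.U t"
  unfolding augm.U_def ungraded.U_def by (rule pm.span_mono; fastforce)+

text \<open>Additivity modulo \<open>aug2\<close> reduces \<open>v\<close> to vectors with a single
  coordinate \<open>\<kappa> c * \<omega> u\<close>, and for these Fourier inversion gives a
  combination of the elements \<open>y\<close>.\<close>

lemma aug_approx: "\<exists>w\<in>ungraded.U 1. aug v - w \<in> augm.U 2"
proof -
  define P where "P v \<longleftrightarrow> (\<exists>w\<in>ungraded.U 1. aug v - w \<in> augm.U 2)" for v
  have add: "P (u + v)" if u: "P u" and v: "P v" for u v
  proof -
    from u obtain w where w: "w \<in> ungraded.U 1" "aug u - w \<in> augm.U 2" unfolding P_def by blast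
    from v obtain w' where w': "w' \<in> ungraded.U 1" "aug v - w' \<in> augm.U 2" unfolding P_def by blast
    have eq: "aug (u + v) - (w + w') = (aug (u + v) - (aug u + aug v)) + (aug u - w) + (aug v - w')" by simp
    have "aug (u + v) - (w + w') \<in> augm.U 2"
      unfolding eq using w w' aug2_subset aug_add_mod
      by (intro pm.subspace_add[OF augm.subspace_U]) blast+
    then show ?thesis unfolding P_def using pm.subspace_add[OF ungraded.subspace_U w(1) w'(1)] by blast
  qed
  have P0: "P 0"
    unfolding P_def using pm.subspace_0[OF ungraded.subspace_U] pm.subspace_0[OF augm.subspace_U]
    by (intro bexI[of _ 0]) auto
  have sum: "P (\<Sum>i\<in>I. x i)" if "\<And>i. i \<in> I \<Longrightarrow> P (x i)" for I :: "'i set" and x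
    using that by (induction I rule: infinite_finite_induct) (simp_all add: P0 add)
  have base: "P (axis l (\<kappa> c * \<omega> u))" if u: "u < m" for l c u
  proof -
    let ?\<epsilon> = "axis l (\<omega> u)"
    have y: "fourier ?\<epsilon> i = y (u * s + i, l)" "(u * s + i, l) \<in> B" if "i < s" for i
    proof -
      have "u * s + i < Suc u * s" using that by simp
      also have "\<dots> \<le> r" unfolding rsm using u by (intro mult_le_mono1) simp
      finally show "(u * s + i, l) \<in> B" by (simp add: B_def)
      show "fourier ?\<epsilon> i = y (u * s + i, l)" using that by (simp add: y_def)
    qed
    have "(\<Sum>i<s. pscale (j c ^ p ^ i) (fourier ?\<epsilon> i)) \<in> ungraded.U 1"
      by (intro pm.subspace_sum[OF ungraded.subspace_U] pm.subspace_scale[OF ungraded.subspace_U])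
        (use y y_mem in auto)
    moreover have "axis l (\<kappa> c * \<omega> u) = \<kappa> c *s ?\<epsilon>" by (auto simp: vec_eq_iff axis_def)
    ultimately show ?thesis
      unfolding P_def using aug_eq_fourier_mod[of c ?\<epsilon>] aug2_subset by auto
  qed
  have ax: "P (axis l x)" for l x
  proof -
    obtain c where c: "x = (\<Sum>u<m. \<kappa> (c u) * \<omega> u)" using \<omega> by blast
    have "axis l x = (\<Sum>u<m. axis l (\<kappa> (c u) * \<omega> u))" unfolding c by (auto simp: vec_eq_iff axis_def)
    then show ?thesis using base by (auto intro!: sum)
  qed
  have "v = (\<Sum>l\<in>UNIV. axis l (v $ l))" by (simp add: vec_eq_iff axis_def)
  then have "P v" using sum[of UNIV "\<lambda>l. axis l (v $ l)"] ax by metis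
  then show ?thesis unfolding P_def .
qed

section \<open>The elements \<open>y\<close> generate the augmentation ideal\<close>

lemma ungraded_subset_augm: "ungraded.U t \<subseteq> augm.U t"
proof -
  have fourier: "fourier \<epsilon> i \<in> augm.U 1" for \<epsilon> i
    unfolding fourier_def
    by (intro pm.subspace_sum[OF augm.subspace_U] pm.subspace_scale[OF augm.subspace_U] aug_mem)
  have one: "1 \<in> augm.U 0" using augm.gmon_mem_U[of "\<lambda>_. 0"] by (simp add: gmon_def)
  have power: "y b ^ k \<in> augm.U k" for b k
  proof (induction k)
    case (Suc k)
    then show ?case using augm.mult_U[of "y b" 1 "y b ^ k" k] fourier by (simp add: y_def case_prod_unfold)
  qed (simp add: one)
  have "gmon C y f \<in> augm.U (sum f C)" if "finite C" for C f
    using that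
  proof (induction C)
    case (insert b C)
    then show ?case using augm.mult_U[OF power insert.IH] by (simp add: gmon_def)
  qed (simp add: gmon_def one)
  then have "{gmon B y f | f. t \<le> sum f B} \<union> {0} \<subseteq> augm.U t"
    using finite_B U_antimono(1) pm.subspace_0[OF augm.subspace_U] by fastforce
  then show ?thesis unfolding ungraded.U_def[of t] by (rule pm.span_minimal[OF _ augm.subspace_U])
qed

text \<open>In a product of at least \<open>t\<close> elements \<open>aug v\<close>, each factor is
  replaced by its approximation by the \<open>y\<close>. Every replacement has an error in the
  square of the ideal, so the product changes by an element of the power
  \<open>t + 1\<close>.\<close>

lemma augm_step:
  assumes "1 \<le> t" "x \<in> augm.U t"
  shows "\<exists>w\<in>ungraded.U 1. x - w \<in> augm.U (Suc t)"
proof -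
  obtain w where w: "\<And>v. w v \<in> ungraded.U 1" "\<And>v. aug v - w v \<in> augm.U 2" using aug_approx by metis
  from assms(2) show ?thesis
    unfolding augm.U_def[of t]
  proof (induction rule: pm.span_induct_alt)
    case base
    then show ?case
      using pm.subspace_0[OF ungraded.subspace_U] pm.subspace_0[OF augm.subspace_U]
      by (intro bexI[of _ 0]) auto
  next
    case (step c a x)
    then obtain w1 where w1: "w1 \<in> ungraded.U 1" "x - w1 \<in> augm.U (Suc t)" by blast
    have "\<exists>w2\<in>ungraded.U 1. a - w2 \<in> augm.U (Suc t)"
    proof (cases "a = 0")
      case True
      then show ?thesis
        using pm.subspace_0[OF ungraded.subspace_U] pm.subspace_0[OF augm.subspace_U]
        by (intro bexI[of _ 0]) auto
    next
      case False
      then obtain f where f: "a = gmon UNIV aug f" "t \<le> sum f UNIV" using step.hyps by blast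
      let ?I = "slots UNIV f"
      have fin: "finite ?I" by (rule finite_slots) simp
      have card: "card ?I = sum f UNIV" by (rule card_slots) simp
      have 1: "(\<Prod>i\<in>?I. w (fst i)) \<in> augm.U (card ?I) \<and>
          (\<Prod>i\<in>?I. aug (fst i)) - (\<Prod>i\<in>?I. w (fst i)) \<in> augm.U (Suc (card ?I))"
      proof (rule prod_diff_mem[where U = augm.U and L = "\<lambda>t. augm.U (Suc t)"])
        show "1 \<in> augm.U 0" using augm.gmon_mem_U[of "\<lambda>_. 0"] by (simp add: gmon_def)
        show "augm.U (Suc s) \<subseteq> augm.U s" for s by (rule U_antimono) simp
        show "x * y \<in> augm.U (Suc (s + t))" if "x \<in> augm.U (Suc s)" "y \<in> augm.U t" for s t x y
          using augm.mult_U[OF that] by simp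
        show "w (fst i) \<in> augm.U 1" for i using w(1) ungraded_subset_augm by blast
        show "aug (fst i) - w (fst i) \<in> augm.U (Suc 1)" for i using w(2) by (simp add: numeral_2_eq_2)
      qed (use augm.subspace_U augm.mult_U fin in auto)
      have one: "1 \<in> ungraded.U 0" using ungraded.gmon_mem_U[of "\<lambda>_. 0"] by (simp add: gmon_def)
      have prodU: "(\<Prod>i\<in>I. w (fst i)) \<in> ungraded.U (card I)" if "finite I" for I :: "(('f ^ 'n) \<times> nat) set"
        using that
      proof (induction I)
        case (insert i I)
        then show ?case using ungraded.mult_U[OF w(1) insert.IH] by simp
      qed (simp add: one)
      have "(\<Prod>i\<in>?I. w (fst i)) \<in> ungraded.U 1"
        by (rule subsetD[OF U_antimono(2) prodU[OF fin]]) (use card f(2) assms(1) in simp)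
      moreover have "a - (\<Prod>i\<in>?I. w (fst i)) \<in> augm.U (Suc t)"
        unfolding f(1) gmon_slots[OF finite_class.finite_UNIV]
        using 1 U_antimono(1)[of "Suc t" "Suc (card ?I)"] card f(2) by auto
      ultimately show ?thesis by blast
    qed
    then obtain w2 where w2: "w2 \<in> ungraded.U 1" "a - w2 \<in> augm.U (Suc t)" by blast
    have "pscale c a + x - (pscale c w2 + w1) = pscale c (a - w2) + (x - w1)"
      by (simp add: pm.scale_right_diff_distrib)
    then have "pscale c a + x - (pscale c w2 + w1) \<in> augm.U (Suc t)"
      using w1(2) w2(2) by (simp only: pm.subspace_add[OF augm.subspace_U] pm.subspace_scale[OF augm.subspace_U])
    moreover have "pscale c w2 + w1 \<in> ungraded.U 1"
      using w1(1) w2(1) by (intro pm.subspace_add[OF ungraded.subspace_U] pm.subspace_scale[OF ungraded.subspace_U])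
    ultimately show ?case by blast
  qed
qed

text \<open>Pigeonhole: in so large a degree some \<open>aug v\<close> has an exponent of at least
  \<open>p\<close>, and its \<open>p\<close>-th power is zero.\<close>

lemma augm_nilpotent: "augm.U (Suc (CARD('f ^ 'n) * p)) \<subseteq> {0}"
  unfolding augm.U_def
proof (rule pm.span_minimal[OF _ pm.subspace_single_0])
  have "gmon UNIV aug f = (0 :: 'f ^ 'n \<Rightarrow>\<^sub>0 'k)" if f: "Suc (CARD('f ^ 'n) * p) \<le> sum f UNIV" for f
  proof -
    have "\<exists>v. p \<le> f v"
    proof (rule ccontr)
      assume "\<not> ?thesis"
      then have "sum f UNIV \<le> (\<Sum>v\<in>(UNIV :: ('f ^ 'n) set). p)" by (intro sum_mono) (simp add: not_le less_imp_le)
      then show False using f by simp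
    qed
    then obtain v where v: "p \<le> f v" by blast
    show ?thesis
      by (rule nilpotent_filtration(2)[where f = f and z = aug, OF finite_class.finite_UNIV aug_power UNIV_I v])
  qed
  then show "{gmon UNIV aug f | f. Suc (CARD('f ^ 'n) * p) \<le> sum f UNIV} \<union> {0} \<subseteq> {0 :: 'f ^ 'n \<Rightarrow>\<^sub>0 'k}" by blast
qed

text \<open>Successive approximation as in Nakayama's lemma: the error moves into ever higher powers
  of the ideal, one of which is zero.\<close>

lemma aug_mem_ungraded: "aug v \<in> ungraded.U 1"
proof -
  have "\<exists>w\<in>ungraded.U 1. aug v - w \<in> augm.U (Suc t)" for t
  proof (induction t)
    case 0
    then show ?case using pm.subspace_0[OF ungraded.subspace_U] aug_mem[of v] by (intro bexI[of _ 0]) auto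
  next
    case (Suc t)
    then obtain w where w: "w \<in> ungraded.U 1" "aug v - w \<in> augm.U (Suc t)" by blast
    from augm_step[OF _ w(2)] obtain w' where w': "w' \<in> ungraded.U 1" "aug v - w - w' \<in> augm.U (Suc (Suc t))"
      by auto
    then show ?case using pm.subspace_add[OF ungraded.subspace_U w(1) w'(1)]
      by (intro bexI[of _ "w + w'"]) (simp_all add: algebra_simps)
  qed
  from this[of "CARD('f ^ 'n) * p"] show ?thesis using augm_nilpotent by auto
qed

text \<open>Converts errors modulo the square of the augmentation ideal into errors of larger degree
  in the \<open>y\<close>, as \<open>action_matrix\<close> requires.\<close>

lemma aug2_subset_L: "aug2 \<subseteq> ungraded.L 1"
proof -
  have "ungraded.U 2 \<subseteq> ungraded.L 1"
    unfolding ungraded.U_def ungraded.L_def by (rule pm.span_mono) auto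
  moreover have "aug2 \<subseteq> ungraded.U 2"
    unfolding aug2_def
  proof (rule pm.span_minimal[OF _ ungraded.subspace_U])
    show "{aug u * aug v | u v. True} \<subseteq> ungraded.U 2"
      using ungraded.mult_U[OF aug_mem_ungraded aug_mem_ungraded] by (auto simp: numeral_2_eq_2)
  qed
  ultimately show ?thesis by blast
qed

lemma ungraded_generates: "x \<in> pm.span {gmon B y e | e. e \<in> B \<rightarrow>\<^sub>E {..<p}}"
proof -
  have one: "1 \<in> ungraded.U 0" using ungraded.gmon_mem_U[of "\<lambda>_. 0"] by (simp add: gmon_def)
  have "Poly_Mapping.single v c \<in> ungraded.U 0" for v c
  proof -
    have "aug v + 1 \<in> ungraded.U 0"
      using aug_mem_ungraded U_antimono(2)[of 0 1] one
      by (intro pm.subspace_add[OF ungraded.subspace_U]) auto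
    from pm.subspace_scale[OF ungraded.subspace_U this, of c]
    show ?thesis by (simp add: aug_def pscale_def mult_single)
  qed
  then have "x \<in> ungraded.U 0"
    by (subst poly_mapping_sum_single[of x]) (intro pm.subspace_sum[OF ungraded.subspace_U])
  moreover have "ungraded.U 0 \<subseteq> pm.span {gmon B y e | e. e \<in> B \<rightarrow>\<^sub>E {..<p}}"
    unfolding ungraded.U_def
  proof (rule pm.span_minimal[OF _ pm.subspace_span], rule subsetI)
    fix z assume "z \<in> {gmon B y f | f. 0 \<le> sum f B} \<union> {0}"
    then consider f where "z = gmon B y f" | "z = 0" by blast
    then show "z \<in> pm.span {gmon B y e | e. e \<in> B \<rightarrow>\<^sub>E {..<p}}"
    proof cases
      case 1
      have "pm.span ({gmon B y e | e. e \<in> B \<rightarrow>\<^sub>E {..<p} \<and> sum f B \<le> sum e B} \<union> {0}) \<subseteq>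
          pm.span {gmon B y e | e. e \<in> B \<rightarrow>\<^sub>E {..<p}}"
        by (rule pm.span_minimal[OF _ pm.subspace_span]) (auto intro: pm.span_base pm.span_zero)
      then show ?thesis using ungraded.reduce[of f] 1 by auto
    qed (simp add: pm.span_zero)
  qed
  ultimately show ?thesis by blast
qed


text \<open>Matrices act additively on vectors, so they act on the group algebra by algebra
  endomorphisms. Hence it is enough to know the images of the \<open>y\<close> modulo
  \<open>aug2\<close>.\<close>

lemma permutation_module:
  fixes H :: "'h monoid" and \<theta> :: "'h \<Rightarrow> 'a ^ 'n ^ 'n" and \<eta> :: "'f ^ 'n \<Rightarrow> nat \<times> 'n \<Rightarrow> nat"
  assumes H: "Group.group H"
    and \<theta>: "\<theta> \<one>\<^bsub>H\<^esub> = mat 1" "\<And>g h. g \<in> carrier H \<Longrightarrow> h \<in> carrier H \<Longrightarrow> \<theta> (g \<otimes>\<^bsub>H\<^esub> h) = \<theta> g ** \<theta> h"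
    and \<eta>: "bij_betw \<eta> UNIV (B \<rightarrow>\<^sub>E {..<p})"
  defines "M \<equiv> permutation_gmodule (\<lambda>h. GL_vec_act \<kappa> (\<theta> h))"
  shows "group_module (ring_of_type_algebra :: 'k ring) H M"
    and "\<exists>\<Psi> :: 'k ^ ('f ^ 'n) \<Rightarrow> _. basis_map M \<Psi> \<and> (\<forall>h\<in>carrier H. \<exists>A.
      leading_matrix B (frobenius_coeff p j (\<theta> h)) \<eta> (>) A \<and> (\<forall>c. act M h (\<Psi> c) = \<Psi> (A *v c)))"
proof -
  let ?K = "ring_of_type_algebra :: 'k ring"
  have comp: "GL_vec_act \<kappa> g v $ t = (\<Sum>l\<in>UNIV. \<kappa> (g $ t $ l) * v $ l)" for g and v :: "'f ^ 'n" and t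
    by (simp add: GL_vec_act_def matrix_vector_mult_def)
  have add: "GL_vec_act \<kappa> g (u + v) = GL_vec_act \<kappa> g u + GL_vec_act \<kappa> g v" for g and u v :: "'f ^ 'n"
    by (simp add: vec_eq_iff comp distrib_left sum.distrib)
  have one: "GL_vec_act \<kappa> (mat 1) v = v" for v :: "'f ^ 'n"
  proof -
    have "(\<Sum>l\<in>UNIV. \<kappa> (mat 1 $ t $ l) * v $ l) = (\<Sum>l\<in>UNIV. if l = t then v $ l else 0)" for t
      by (rule sum.cong) (auto simp: mat_def \<kappa>D)
    then show ?thesis by (simp add: vec_eq_iff comp)
  qed
  have mult: "GL_vec_act \<kappa> (g ** h) v = GL_vec_act \<kappa> g (GL_vec_act \<kappa> h v)" for g h and v :: "'f ^ 'n"
  proof -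
    have "map_matrix \<kappa> (g ** h) = map_matrix \<kappa> g ** map_matrix \<kappa> h"
      by (simp add: vec_eq_iff matrix_matrix_mult_def hom_sum[of \<kappa>, OF \<kappa>D(1,4)] \<kappa>D(2))
    then show ?thesis by (simp add: GL_vec_act_def matrix_vector_mul_assoc)
  qed
  show "group_module ?K H M"
    unfolding M_def by (rule group_module_permutation[OF H]) (simp_all add: \<theta> one mult)
  have Ms: "carrier M = UNIV" "add M = (+)" "smult M = pscale"
    by (simp_all add: M_def permutation_gmodule_def fun_eq_iff pscale_def mult_map_scale_conv_mult)
  define F where "F g v c = Poly_Mapping.single (GL_vec_act \<kappa> g v) c" for g and v :: "'f ^ 'n" and c :: 'k
  have act: "act M h = linear_extension (F (\<theta> h))" for h
    by (simp add: M_def permutation_gmodule_def fun_eq_iff linear_extension_def F_def)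
  have F: "F g v 0 = 0" "F g v (c + d) = F g v c + F g v d" "F g (u + v) (c * d) = F g u c * F g v d" for g u v c d
    by (simp_all add: F_def single_add add mult_single)
  define \<rho> where "\<rho> g = linear_extension (F g)" for g
  have \<rho>_single: "\<rho> g (Poly_Mapping.single v c) = Poly_Mapping.single (GL_vec_act \<kappa> g v) c" for g v c
    unfolding \<rho>_def by (subst linear_extension_single) (simp_all add: F_def)
  have \<rho>_add: "\<rho> g (x + z) = \<rho> g x + \<rho> g z" for g x z
    unfolding \<rho>_def by (rule linear_extension_add) (rule F)+
  have \<rho>_mult: "\<rho> g (x * z) = \<rho> g x * \<rho> g z" for g x z
    unfolding \<rho>_def by (rule linear_extension_mult) (rule F)+
  have zero: "GL_vec_act \<kappa> g 0 = (0 :: 'f ^ 'n)" for g by (simp add: vec_eq_iff comp)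
  have \<rho>_1: "\<rho> g 1 = 1" for g
    using \<rho>_single[of g 0 1] by (simp add: zero)
  have \<rho>_pscale: "\<rho> g (pscale c x) = pscale c (\<rho> g x)" for g c x
    unfolding pscale_def \<rho>_mult \<rho>_single zero ..
  have \<rho>_aug: "\<rho> g (aug v) = aug (GL_vec_act \<kappa> g v)" for g v
  proof -
    have "\<rho> g (aug v) + \<rho> g 1 = \<rho> g (Poly_Mapping.single v 1)" unfolding \<rho>_add[symmetric] by (simp add: aug_def)
    then show ?thesis by (simp add: \<rho>_1 \<rho>_single aug_def algebra_simps)
  qed
  have \<rho>_sum: "\<rho> g (\<Sum>i\<in>I. x i) = (\<Sum>i\<in>I. \<rho> g (x i))" for g x and I :: "'a set"
    unfolding \<rho>_def by (rule linear_extension_sum) (rule F)+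
  have gen: "\<rho> g (y b) - (\<Sum>c\<in>B. pscale (frobenius_coeff p j g b c) (y c)) \<in> ungraded.L 1"
    if "b \<in> B" for g b
  proof -
    obtain a l where b: "b = (a, l)" "a < r" using \<open>b \<in> B\<close> by (auto simp: B_def)
    define i x where "i = a mod s" and "x = \<omega> (a div s)"
    \<comment> \<open>\<open>p^a\<close> is a power of \<open>CARD('a)\<close> times
      \<open>p^i\<close>, and raising to the power \<open>CARD('a)\<close> is the identity on
      \<open>'a\<close>.\<close>
    have jpow: "j z ^ p ^ a = j z ^ p ^ i" for z
    proof -
      have "p ^ a = CARD('a) ^ (a div s) * p ^ i"
        unfolding card_a i_def by (simp add: power_mult[symmetric] power_add[symmetric])
      then have "z ^ p ^ a = z ^ p ^ i" by (simp add: power_mult finite_field_power_CARD_power)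
      then show ?thesis by (simp add: j_power[symmetric])
    qed
    \<comment> \<open>The contribution of coordinate \<open>t\<close> to the image of the vector
      \<open>\<kappa> c *s axis l x\<close>. Splitting \<open>aug\<close> over these contributions
      costs an error in \<open>aug2\<close>, and \<open>fourier_scale\<close> identifies the sum
      that remains.\<close>
    define v where "v c t = \<kappa> (g $ t $ l * c) *s axis t x" for c t
    have pi: "GL_vec_act \<kappa> g (\<kappa> c *s axis l x) = (\<Sum>t\<in>UNIV. v c t)" for c
    proof -
      have "(\<Sum>k\<in>UNIV. \<kappa> (g $ t $ k) * (\<kappa> c * (axis l x :: 'f ^ 'n) $ k)) =
          (\<Sum>k\<in>UNIV. if k = l then \<kappa> (g $ t $ l) * (\<kappa> c * x) else 0)" for t
        by (rule sum.cong) (auto simp: axis_def)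
      moreover have "(\<Sum>k\<in>UNIV. v c k $ t) = (\<Sum>k\<in>UNIV. if k = t then \<kappa> (g $ t $ l * c) * x else 0)" for t
        by (rule sum.cong) (auto simp: v_def axis_def)
      ultimately show ?thesis by (simp add: vec_eq_iff comp \<kappa>D(2) mult.assoc)
    qed
    have "\<rho> g (y b) = (\<Sum>c\<in>UNIV - {0}. pscale (- (inverse (j c) ^ p ^ i)) (aug (\<Sum>t\<in>UNIV. v c t)))"
      unfolding b y_def fourier_def by (simp add: \<rho>_sum \<rho>_pscale \<rho>_aug pi i_def[symmetric] x_def[symmetric] del: pm.scale_minus_left)
    moreover have "(\<Sum>c\<in>B. pscale (frobenius_coeff p j g b c) (y c)) =
        (\<Sum>c\<in>UNIV - {0}. pscale (- (inverse (j c) ^ p ^ i)) (\<Sum>t\<in>UNIV. aug (v c t)))"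
    proof -
      have "(\<Sum>c\<in>B. pscale (frobenius_coeff p j g b c) (y c)) =
          (\<Sum>t\<in>UNIV. pscale (j (g $ t $ l) ^ p ^ i) (fourier (axis t x) i))"
        unfolding b(1) B_def sum_frobenius_coeff[OF b(2)]
        by (simp add: y_def jpow i_def x_def)
      also have "\<dots> = (\<Sum>t\<in>UNIV. \<Sum>c\<in>UNIV - {0}. pscale (- (inverse (j c) ^ p ^ i)) (aug (v c t)))"
        unfolding fourier_scale[symmetric] v_def ..
      also have "\<dots> = (\<Sum>c\<in>UNIV - {0}. \<Sum>t\<in>UNIV. pscale (- (inverse (j c) ^ p ^ i)) (aug (v c t)))"
        by (rule sum.swap)
      finally show ?thesis unfolding pm.scale_sum_right .
    qed
    ultimately have eq: "\<rho> g (y b) - (\<Sum>c\<in>B. pscale (frobenius_coeff p j g b c) (y c)) =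
        (\<Sum>c\<in>UNIV - {0}. pscale (- (inverse (j c) ^ p ^ i)) (aug (\<Sum>t\<in>UNIV. v c t) - (\<Sum>t\<in>UNIV. aug (v c t))))"
      by (simp only: pm.scale_right_diff_distrib sum_subtractf)
    have "\<dots> \<in> aug2"
      by (intro pm.subspace_sum[OF subspace_aug2] pm.subspace_scale[OF subspace_aug2] aug_sum_mod)
    then show ?thesis unfolding eq using aug2_subset_L by blast
  qed
  define \<Psi> :: "'k ^ ('f ^ 'n) \<Rightarrow> _" where "\<Psi> = ungraded.lift \<eta>"
  have lift: "\<Psi> (c + d) = \<Psi> c + \<Psi> d" "\<Psi> (a *s c) = pscale a (\<Psi> c)" for c d a
    unfolding \<Psi>_def ungraded.lift_def
    by (simp_all add: pm.scale_left_distrib sum.distrib pm.scale_sum_right)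
  have surj: "\<exists>c. x = \<Psi> c" for x
  proof -
    have "x \<in> pm.span ({gmon B y e | e. e \<in> B \<rightarrow>\<^sub>E {..<p} \<and> True} \<union> {0})"
      by (rule subsetD[OF pm.span_mono ungraded_generates]) blast
    from ungraded.span_combination[OF this] obtain d
      where d: "x = (\<Sum>e\<in>B \<rightarrow>\<^sub>E {..<p}. pscale (d e) (gmon B y e))" by auto
    have "x = \<Psi> (vec_lambda (\<lambda>e. d (\<eta> e)))"
      unfolding d \<Psi>_def ungraded.lift_def by (subst sum.reindex_bij_betw[OF \<eta>, symmetric]) simp
    then show ?thesis by blast
  qed
  have inj: "inj \<Psi>"
  proof -
    \<comment> \<open>Coordinates are indexed by \<open>'f ^ 'n\<close>, which is also the index set
      of the standard basis. So \<open>T\<close> is an endomorphism of a finite-dimensional space,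
      and surjectivity gives injectivity.\<close>
    define T :: "'k ^ ('f ^ 'n) \<Rightarrow> 'k ^ ('f ^ 'n)" where "T c = vec_lambda (\<lambda>v. Poly_Mapping.lookup (\<Psi> c) v)" for c
    have "Vector_Spaces.linear (*s) (*s) T"
      unfolding Vector_Spaces.linear_iff
      by (simp add: vec.vector_space_axioms T_def vec_eq_iff lift lookup_add lookup_pscale)
    moreover have "surj T"
      unfolding surj_def
    proof
      fix d :: "'k ^ ('f ^ 'n)"
      obtain c where c: "(\<Sum>v\<in>UNIV. Poly_Mapping.single v (d $ v)) = \<Psi> c" using surj by blast
      have "T c = d" unfolding T_def c[symmetric] 
        by (subst vec_eq_iff) (simp add: lookup_sum lookup_single when_def)
      then show "\<exists>c. d = T c" by blast
    qed
    ultimately have "inj T" by (rule vec.linear_surj_imp_inj)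
    then show ?thesis unfolding inj_def T_def by metis
  qed
  have "basis_map M \<Psi>"
    unfolding basis_map_def bij_betw_def Ms using inj surj lift by blast
  moreover have "\<exists>A. leading_matrix B (frobenius_coeff p j (\<theta> h)) \<eta> (>) A \<and> (\<forall>c. act M h (\<Psi> c) = \<Psi> (A *v c))" for h
  proof -
    from ungraded.action_matrix[where \<rho> = "\<rho> (\<theta> h)" and G = "frobenius_coeff p j (\<theta> h)",
        OF \<eta> \<rho>_1 \<rho>_mult \<rho>_add \<rho>_pscale gen]
    obtain A where A: "leading_matrix B (frobenius_coeff p j (\<theta> h)) \<eta> (>) A"
      "\<And>c. \<rho> (\<theta> h) (ungraded.lift \<eta> c) - ungraded.lift \<eta> (A *v c) \<in> {0}" by blast
    have "act M h (\<Psi> c) = \<Psi> (A *v c)" for c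
      using A(2)[of c] unfolding act \<rho>_def[symmetric] \<Psi>_def by simp
    then show ?thesis using A(1) by blast
  qed
  ultimately show "\<exists>\<Psi> :: 'k ^ ('f ^ 'n) \<Rightarrow> _. basis_map M \<Psi> \<and> (\<forall>h\<in>carrier H. \<exists>A.
      leading_matrix B (frobenius_coeff p j (\<theta> h)) \<eta> (>) A \<and> (\<forall>c. act M h (\<Psi> c) = \<Psi> (A *v c)))"
    by blast
qed

theorem brauer_isomorphic_parking_spaces:
  fixes H :: "'h monoid" and \<theta> :: "'h \<Rightarrow> 'a ^ 'n ^ 'n"
  assumes H: "Group.group H"
    and \<theta>: "\<theta> \<one>\<^bsub>H\<^esub> = mat 1" "\<And>g h. g \<in> carrier H \<Longrightarrow> h \<in> carrier H \<Longrightarrow> \<theta> (g \<otimes>\<^bsub>H\<^esub> h) = \<theta> g ** \<theta> h"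
  shows "brauer_isomorphic TYPE('s) (ring_of_type_algebra :: 'k ring) H
    (graded_parking (p ^ r) (\<lambda>h. GL_poly_act j (\<theta> h)) :: ('k, ('n, 'k) mpoly set, 'h) gmodule)
    (permutation_gmodule (\<lambda>h. GL_vec_act \<kappa> (\<theta> h)))"
proof -
  let ?K = "ring_of_type_algebra :: 'k ring"
  let ?M = "graded_parking (p ^ r) (\<lambda>h. GL_poly_act j (\<theta> h)) :: ('k, ('n, 'k) mpoly set, 'h) gmodule"
  let ?N = "permutation_gmodule (\<lambda>h. GL_vec_act \<kappa> (\<theta> h)) :: ('k, 'f ^ 'n \<Rightarrow>\<^sub>0 'k, 'h) gmodule"
  \<comment> \<open>Reduced exponents and vectors are equally many, \<open>p^(r*n)\<close>. So the
    type \<open>'f ^ 'n\<close> serves as index set of both monomial bases, through the same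
    enumeration \<open>\<eta>\<close>.\<close>
  have "card (B \<rightarrow>\<^sub>E {..<p}) = CARD('f ^ 'n)"
    by (simp add: card_PiE finite_B) (simp add: B_def card_cartesian_product card_f power_mult)
  then obtain \<eta> :: "'f ^ 'n \<Rightarrow> nat \<times> 'n \<Rightarrow> nat" where \<eta>: "bij_betw \<eta> UNIV (B \<rightarrow>\<^sub>E {..<p})"
    using finite_same_card_bij[OF finite_class.finite_UNIV graded.finite_exponents] by metis
  obtain \<Phi> :: "'k ^ ('f ^ 'n) \<Rightarrow> _" where \<Phi>: "basis_map ?M \<Phi>" "\<And>h. h \<in> carrier H \<Longrightarrow> \<exists>A.
      leading_matrix B (frobenius_coeff p j (\<theta> h)) \<eta> (<) A \<and> (\<forall>c. act ?M h (\<Phi> c) = \<Phi> (A *v c))"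
    using graded_parking(2)[OF H j \<theta> \<eta>] by blast
  obtain \<Psi> :: "'k ^ ('f ^ 'n) \<Rightarrow> _" where \<Psi>: "basis_map ?N \<Psi>" "\<And>h. h \<in> carrier H \<Longrightarrow> \<exists>A.
      leading_matrix B (frobenius_coeff p j (\<theta> h)) \<eta> (>) A \<and> (\<forall>c. act ?N h (\<Psi> c) = \<Psi> (A *v c))"
    using permutation_module(2)[OF H \<theta> \<eta>] by blast
  have "triangular_pair H ?M ?N \<Phi> \<Psi> (\<lambda>e. int (sum (\<eta> e) B))"
  proof (rule triangular_pair.intro[OF graded_parking(1)[OF H j \<theta> \<eta>] permutation_module(1)[OF H \<theta> \<eta>]
        triangular_pair_axioms.intro[OF \<Phi>(1) \<Psi>(1)]])
    fix h assume h: "h \<in> carrier H"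
    from \<Phi>(2)[OF h] \<Psi>(2)[OF h] obtain A A'
      where A: "leading_matrix B (frobenius_coeff p j (\<theta> h)) \<eta> (<) A" "\<And>c. act ?M h (\<Phi> c) = \<Phi> (A *v c)"
        and A': "leading_matrix B (frobenius_coeff p j (\<theta> h)) \<eta> (>) A'" "\<And>c. act ?N h (\<Psi> c) = \<Psi> (A' *v c)"
      by blast
    show "\<exists>A B'. \<forall>c. act ?M h (\<Phi> c) = \<Phi> (A *v c) \<and> act ?N h (\<Psi> c) = \<Psi> (B' *v c) \<and>
      (\<forall>f e. (int (sum (\<eta> e) B) < int (sum (\<eta> f) B) \<longrightarrow> A $ f $ e = 0) \<and>
        (int (sum (\<eta> f) B) < int (sum (\<eta> e) B) \<longrightarrow> B' $ f $ e = 0) \<and>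
        (int (sum (\<eta> f) B) = int (sum (\<eta> e) B) \<longrightarrow> A $ f $ e = B' $ f $ e))"
      by (intro exI[of _ A] exI[of _ A'] allI conjI impI) 
        (use A A' in \<open>auto simp: leading_matrix_def simp del: of_nat_sum\<close>)
  qed
  then show ?thesis by (rule brauer_isomorphic_triangular)
qed

end

section \<open>The two parking spaces are Brauer-isomorphic\<close>

lemma group_GL: "Group.group (GL :: ('q::field ^ 'n ^ 'n::finite) monoid)"
proof (rule groupI)
  fix g :: "'q ^ 'n ^ 'n" assume "g \<in> carrier GL"
  then obtain h where h: "g ** h = mat 1" "h ** g = mat 1" by (auto simp: GL_def invertible_def)
  then have "h \<in> carrier GL" by (auto simp: GL_def invertible_def)
  then show "\<exists>h\<in>carrier GL. h \<otimes>\<^bsub>GL\<^esub> g = \<one>\<^bsub>GL\<^esub>" using h by (auto simp: GL_def)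
next
  show "\<one>\<^bsub>GL\<^esub> \<in> carrier (GL :: ('q ^ 'n ^ 'n) monoid)"
    by (auto simp: GL_def invertible_def intro!: exI[of _ "mat 1"])
qed (simp_all add: GL_def invertible_mult matrix_mul_assoc)

text \<open>A basis \<open>C\<close> over the small field has at most \<open>m\<close> elements,
  because distinct coefficient functions give distinct elements of \<open>'f\<close>, which has
  \<open>CARD('q) ^ m\<close> elements.\<close>

lemma exists_spanning_family:
  fixes \<iota> :: "'q::{field,finite} \<Rightarrow> 'f::{field,finite}"
  assumes \<iota>: "\<iota> \<in> ring_hom ring_of_type_algebra ring_of_type_algebra" and card: "CARD('f) = CARD('q) ^ m"
  shows "\<exists>\<omega> :: nat \<Rightarrow> 'f. \<forall>x. \<exists>c. x = (\<Sum>u<m. \<iota> (c u) * \<omega> u)"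
proof -
  note \<iota>D = ring_hom_type_algebraD[OF \<iota>]
  interpret V: vector_space "\<lambda>a x. \<iota> a * x"
    by standard (simp_all add: \<iota>D algebra_simps)
  define C where "C = V.extend_basis {}"
  have C: "V.independent C" "V.span C = UNIV"
    unfolding C_def using V.independent_extend_basis[OF V.independent_empty] V.span_extend_basis[OF V.independent_empty]
    by auto
  have inj: "inj_on (\<lambda>c. \<Sum>v\<in>C. \<iota> (c v) * v) (C \<rightarrow>\<^sub>E UNIV)"
  proof (rule inj_onI, rule PiE_ext, assumption, assumption)
    fix c d v assume cd: "(\<Sum>v\<in>C. \<iota> (c v) * v) = (\<Sum>v\<in>C. \<iota> (d v) * v)" and v: "v \<in> C"
    have diff: "\<iota> (a - b) = \<iota> a - \<iota> b" for a b
      using \<iota>D(1)[of "a - b" b] by simp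
    have sum0: "(\<Sum>v\<in>C. \<iota> (c v - d v) * v) = 0" using cd by (simp add: diff left_diff_distrib sum_subtractf)
    show "c v = d v"
    proof (rule ccontr)
      assume "c v \<noteq> d v"
      then have ne: "c v - d v \<noteq> 0" by simp
      have "V.dependent C"
        unfolding V.dependent_finite[OF finite_class.finite[of C]]
        by (intro exI[of _ "\<lambda>v. c v - d v"] conjI bexI[of _ v]) (rule ne, rule v, rule sum0)
      then show False using C(1) by simp
    qed
  qed
  have "CARD('q) ^ card C = card ((\<lambda>c. \<Sum>v\<in>C. \<iota> (c v) * v) ` (C \<rightarrow>\<^sub>E UNIV))"
    unfolding card_image[OF inj] by (simp add: card_PiE)
  also have "\<dots> \<le> CARD('q) ^ m" unfolding card[symmetric] by (rule card_mono) auto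
  finally have le: "CARD('q) ^ card C \<le> CARD('q) ^ m" .
  have "card {0 :: 'q, 1} \<le> CARD('q)" by (rule card_mono) auto
  then have "1 < CARD('q)" by simp
  then have cm: "card C \<le> m" using le by simp
  obtain \<beta> where \<beta>: "bij_betw \<beta> {..<card C} C"
    using ex_bij_betw_nat_finite[of C] by (auto simp: atLeast0LessThan)
  \<comment> \<open>Padding by zeros gives a family of length exactly \<open>m\<close>, which still
    spans.\<close>
  define \<omega> where "\<omega> u = (if u < card C then \<beta> u else 0)" for u
  have "\<exists>c. x = (\<Sum>u<m. \<iota> (c u) * \<omega> u)" for x
  proof -
    have "x \<in> V.span C" using C(2) by simp
    then obtain c where c: "x = (\<Sum>v\<in>C. \<iota> (c v) * v)" by (auto simp: V.span_finite)
    also have "\<dots> = (\<Sum>u<card C. \<iota> (c (\<beta> u)) * \<beta> u)" by (rule sum.reindex_bij_betw[OF \<beta>, symmetric])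
    also have "\<dots> = (\<Sum>u<m. \<iota> (c (\<beta> u)) * \<omega> u)"
      by (rule sum.mono_neutral_cong_left) (use cm in \<open>auto simp: \<omega>_def\<close>)
    finally show ?thesis by (intro exI[of _ "\<lambda>u. c (\<beta> u)"])
  qed
  then show ?thesis by (intro exI[of _ \<omega>] allI)
qed

lemma CHAR_extension:
  fixes j :: "'a::field \<Rightarrow> 'k::field"
  assumes p: "Factorial_Ring.prime p" and char: "CHAR('a) = p"
    and j: "j \<in> ring_hom ring_of_type_algebra ring_of_type_algebra"
  shows "CHAR('k) = p"
proof -
  note jD = ring_hom_type_algebraD[OF j]
  have "j (of_nat n) = of_nat n" for n by (induction n) (simp_all add: jD)
  from this[of p] have "of_nat p = (0 :: 'k)" using of_nat_CHAR[where ?'a = 'a] char jD(4) by simp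
  then have dvd: "CHAR('k) dvd p" by (simp add: of_nat_eq_0_iff_char_dvd)
  have "CHAR('k) \<noteq> 1"
  proof
    assume "CHAR('k) = 1"
    then have "of_nat 1 = (0 :: 'k)" using of_nat_CHAR[where ?'a = 'k] by metis
    then show False by simp
  qed
  then show ?thesis using dvd p by (auto simp: prime_nat_iff)
qed

theorem corollary6p11:
  fixes q m :: nat
    and \<iota> :: "'q::{field,finite} \<Rightarrow> 'f::{field,finite}"
  assumes "primepow q" and "m \<ge> 1"
    and "CARD('q) = q" and "CARD('f) = q ^ m"
    and "\<iota> \<in> ring_hom ring_of_type_algebra ring_of_type_algebra"
  shows
    "(\<forall>j :: 'q \<Rightarrow> 'k::field. j \<in> ring_hom ring_of_type_algebra ring_of_type_algebra \<longrightarrow>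
        brauer_isomorphic TYPE('s) (ring_of_type_algebra :: 'k ring)
          (GL :: ('q ^ 'n::finite ^ 'n) monoid)
          (graded_parking (q ^ m) (GL_poly_act j))
          (permutation_gmodule (GL_vec_act \<iota>))) \<and>
     (\<forall>j :: 'f \<Rightarrow> 'k. j \<in> ring_hom ring_of_type_algebra ring_of_type_algebra \<longrightarrow>
        brauer_isomorphic TYPE('s) (ring_of_type_algebra :: 'k ring)
          ((GL :: ('q ^ 'n ^ 'n) monoid) \<times>\<times> (unit_group :: 'f monoid))
          (graded_parking (q ^ m)
             (\<lambda>(g, \<gamma>). GL_poly_act (j \<circ> \<iota>) g \<circ> scalar_poly_act j \<gamma>))
          (permutation_gmodule (\<lambda>(g, \<gamma>) v. \<gamma> *s GL_vec_act \<iota> g v)))"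
proof -
  obtain p s where ps: "Factorial_Ring.prime p" "0 < s" "q = p ^ s"
    using assms(1) unfolding primepow_def by blast
  define r where "r = m * s"
  have r: "1 \<le> r" using assms(2) ps(2) by (simp add: r_def)
  have card_q: "CARD('q) = p ^ s" and card_f: "CARD('f) = p ^ r" and qm: "q ^ m = p ^ r"
    using assms(3,4) ps(3) by (simp_all add: r_def power_mult[symmetric] mult.commute)
  note \<iota>D = ring_hom_type_algebraD[OF assms(5)]
  show ?thesis
  proof (intro conjI allI impI)
    fix j :: "'q \<Rightarrow> 'k" assume j: "j \<in> ring_hom ring_of_type_algebra ring_of_type_algebra"
    have char: "CHAR('k) = p" by (rule CHAR_extension[OF ps(1) CHAR_finite_field[OF ps(1) card_q] j])
    obtain \<omega> where \<omega>: "\<And>x. \<exists>c. x = (\<Sum>u<m. \<iota> (c u) * \<omega> u)"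
      using exists_spanning_family[OF assms(5)] assms(3,4) by blast
    interpret parking_spaces p r "TYPE('k)" "TYPE('n)" s m \<iota> j \<omega>
      by unfold_locales (use ps(1) char r card_q card_f assms(5) j \<omega> in \<open>auto simp: r_def\<close>)
    show "brauer_isomorphic TYPE('s) (ring_of_type_algebra :: 'k ring)
          (GL :: ('q ^ 'n ^ 'n) monoid)
          (graded_parking (q ^ m) (GL_poly_act j))
          (permutation_gmodule (GL_vec_act \<iota>))"
      unfolding qm
      by (rule brauer_isomorphic_parking_spaces[OF group_GL, where \<theta> = "\<lambda>g. g"]) (simp_all add: GL_def)
  next
    fix j :: "'f \<Rightarrow> 'k" assume j: "j \<in> ring_hom ring_of_type_algebra ring_of_type_algebra"
    note jD = ring_hom_type_algebraD[OF j]
    have char: "CHAR('k) = p" by (rule CHAR_extension[OF ps(1) CHAR_finite_field[OF ps(1) card_f] j])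
    have id: "(\<lambda>x. x) \<in> ring_hom (ring_of_type_algebra :: 'f ring) ring_of_type_algebra"
      by (simp add: ring_hom_def)
    \<comment> \<open>Here the base field of the matrices is \<open>'f\<close> itself:
      \<open>s = r\<close>, \<open>m = 1\<close>, and the spanning family is the single element
      \<open>1\<close>.\<close>
    interpret parking_spaces p r "TYPE('k)" "TYPE('n)" r 1 "\<lambda>x :: 'f. x" j "\<lambda>_. 1"
      by unfold_locales (use ps(1) char r card_f id j in auto)
    \<comment> \<open>On both spaces \<open>\<gamma>\<close> acts as a scalar matrix. Scalars are
      central, so the combined matrix \<open>\<gamma> g\<close> depends multiplicatively on the
      pair.\<close>
    define \<theta> :: "('q ^ 'n ^ 'n) \<times> 'f \<Rightarrow> 'f ^ 'n ^ 'n"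
      where "\<theta> = (\<lambda>(g, \<gamma>). vec_lambda (\<lambda>i. vec_lambda (\<lambda>l. \<gamma> * \<iota> (g $ i $ l))))"
    have poly: "(\<lambda>(g, \<gamma>). GL_poly_act (j \<circ> \<iota>) g \<circ> scalar_poly_act j \<gamma>) =
        (\<lambda>h. GL_poly_act j (\<theta> h) :: ('n, 'k) mpoly \<Rightarrow> _)"
      by (auto simp: fun_eq_iff GL_poly_act_def scalar_poly_act_def msubst_msubst msubst_mult \<theta>_def jD(2)
          mconst_mult sum_distrib_left mult.assoc)
    have perm: "(\<lambda>(g, \<gamma>) v. \<gamma> *s GL_vec_act \<iota> g v) = (\<lambda>h. GL_vec_act (\<lambda>x. x) (\<theta> h))"
      by (auto simp: fun_eq_iff GL_vec_act_def \<theta>_def vec_eq_iff matrix_vector_mult_def sum_distrib_left mult.assoc)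
    interpret F: Ring.field "ring_of_type_algebra :: 'f ring" by (rule field_from_type_algebra)
    have grp: "Group.group ((GL :: ('q ^ 'n ^ 'n) monoid) \<times>\<times> (unit_group :: 'f monoid))"
      by (rule DirProd_group[OF group_GL F.units_group])
    show "brauer_isomorphic TYPE('s) (ring_of_type_algebra :: 'k ring)
          ((GL :: ('q ^ 'n ^ 'n) monoid) \<times>\<times> (unit_group :: 'f monoid))
          (graded_parking (q ^ m)
             (\<lambda>(g, \<gamma>). GL_poly_act (j \<circ> \<iota>) g \<circ> scalar_poly_act j \<gamma>))
          (permutation_gmodule (\<lambda>(g, \<gamma>) v. \<gamma> *s GL_vec_act \<iota> g v))"
      unfolding qm poly perm
    proof (rule brauer_isomorphic_parking_spaces[OF grp])
      show "\<theta> \<one>\<^bsub>GL \<times>\<times> unit_group\<^esub> = mat 1"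
        by (auto simp: GL_def \<theta>_def units_of_one vec_eq_iff mat_def \<iota>D)
      fix g h :: "('q ^ 'n ^ 'n) \<times> 'f"
      have hs: "\<iota> (\<Sum>i\<in>UNIV. x i) = (\<Sum>i\<in>UNIV. \<iota> (x i))" for x :: "'n \<Rightarrow> 'q"
        by (rule hom_sum) (rule \<iota>D)+
      show "\<theta> (g \<otimes>\<^bsub>GL \<times>\<times> unit_group\<^esub> h) = \<theta> g ** \<theta> h"
        by (cases g; cases h)
          (simp add: GL_def \<theta>_def units_of_mult vec_eq_iff matrix_matrix_mult_def hs \<iota>D(2)
            sum_distrib_left mult_ac)
    qed
  qed
qed

end
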